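(* Let $f\in\mu_{q-1}[x_1^{\pm1},\dots,x_n^{\pm1}]$ be a non-constant Laurent polynomial, and let $\chi=\omega^{-d}$ with $d\in\mathbb{Z}^n/(q-1)$. Then the series $L_{f,\chi}(s,T)$ is $T$-adic meromorphic in $s$.
   Context: $p$ is a prime, $q$ a power of $p$, $\mathbb{Z}_{q^k}=W(\mathbb{F}_{q^k})$, $\mu_{q^k-1}\subset\mathbb{Z}_{q^k}$ the group of $(q^k-1)$-th roots of unity. The notation $f\in\mu_{q-1}[x_1^{\pm1},\dots,x_n^{\pm1}]$ means $f=\sum_{u\in I}a_ux^u$ with $I\subset\mathbb{Z}^n$ finite and $a_u\in\mu_{q-1}$. $\omega$ is the Teichmüller character, $\omega:\mathbb{F}_q^\times\to\mu_{q-1}$, $x\mapsto\hat x$; for $d\in\mathbb{Z}^n/(q-1)\mathbb{Z}^n$, $\chi=\omega^{-d}$ is the character $x\mapsto\hat x^{-d}=\prod_i\hat x_i^{-d_i}$ of $(\mathbb{F}_q^\times)^n$, and $\chi_k=\chi\circ\mathrm{Norm}_{\mathbb{F}_{q^k}/\mathbb{F}_q}$, viewed also as a function on $\mu_{q^k-1}^n\cong(\mathbb{F}_{q^k}^\times)^n$; thus $\chi_k(x)=x^{-d(1+q+\cdots+q^{k-1})}$. Let $\psi(x)=(1+T)^x$ for $x\in\mathbb{Z}_p$ and $\psi_{q^k}=\psi\circ\mathrm{Tr}_{\mathbb{Z}_{q^k}/\mathbb{Z}_p}$. Put $$S_f(T,\chi_k,\mathbb{F}_{q^k})=\sum_{x\in\mu_{q^k-1}^n}\chi_k(x)\,\psi_{q^k}(f(x)),\qquad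 L_{f,\chi}(s,T)=\exp\Big(\sum_{k=1}^{\infty}S_f(T,\chi_k,\mathbb{F}_{q^k})\frac{s^k}{k}\Big)\in 1+s\mathbb{Z}_q[[T]][[s]].$$ A series $\sum_i a_i(T)s^i$ with $a_i\in\mathbb{Z}_q[[T]]$ is $T$-adic entire in $s$ if $\mathrm{ord}_T(a_i)/i\to\infty$; a series is $T$-adic meromorphic if it is a quotient of two $T$-adic entire series in $1+s\mathbb{Z}_q[[T]][[s]]$. *)

theory Defs
  imports
    "HOL-Library.Poly_Mapping"
    "HOL-Library.Extended_Real"
    "HOL-Computational_Algebra.Computational_Algebra"
    "HOL-Analysis.Finite_Cartesian_Product"
begin

section \<open>Integer polynomials in arbitrarily many variables\<close>

type_synonym 'v zpoly = "('v \<Rightarrow>\<^sub>0 nat) \<Rightarrow>\<^sub>0 int"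

definition zvar :: "'v \<Rightarrow> 'v zpoly" where
  "zvar v = Poly_Mapping.single (Poly_Mapping.single v 1) 1"

definition mon_eval :: "('v \<Rightarrow> 'a::comm_ring_1) \<Rightarrow> ('v \<Rightarrow>\<^sub>0 nat) \<Rightarrow> 'a" where
  "mon_eval \<phi> m = (\<Prod>v\<in>Poly_Mapping.keys m. \<phi> v ^ Poly_Mapping.lookup m v)"

definition zeval :: "('v \<Rightarrow> 'a::comm_ring_1) \<Rightarrow> 'v zpoly \<Rightarrow> 'a" where
  "zeval \<phi> P = (\<Sum>m\<in>Poly_Mapping.keys P. of_int (Poly_Mapping.lookup P m) * mon_eval \<phi> m)"

lemma mon_eval_superset:
  "finite A \<Longrightarrow> Poly_Mapping.keys m \<subseteq> A \<Longrightarrow> mon_eval \<phi> m = (\<Prod>v\<in>A. \<phi> v ^ Poly_Mapping.lookup m v)"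
  unfolding mon_eval_def by (rule prod.mono_neutral_left) (auto simp: in_keys_iff)

lemma mon_eval_add: "mon_eval \<phi> (m + n) = mon_eval \<phi> m * mon_eval \<phi> n"
proof -
  let ?A = "Poly_Mapping.keys m \<union> Poly_Mapping.keys n"
  have "finite ?A" by simp
  moreover have "Poly_Mapping.keys (m + n) \<subseteq> ?A" by (rule keys_add)
  ultimately show ?thesis
    by (simp add: mon_eval_superset[of ?A] lookup_add power_add prod.distrib)
qed

lemma zeval_superset:
  "finite A \<Longrightarrow> Poly_Mapping.keys P \<subseteq> A \<Longrightarrow>
     zeval \<phi> P = (\<Sum>m\<in>A. of_int (Poly_Mapping.lookup P m) * mon_eval \<phi> m)"
  unfolding zeval_def by (rule sum.mono_neutral_left) (auto simp: in_keys_iff)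

lemma zeval_0 [simp]: "zeval \<phi> 0 = 0"
  by (simp add: zeval_def)

lemma zeval_add [simp]: "zeval \<phi> (P + Q) = zeval \<phi> P + zeval \<phi> Q"
proof -
  let ?A = "Poly_Mapping.keys P \<union> Poly_Mapping.keys Q"
  have "finite ?A" by simp
  moreover have "Poly_Mapping.keys (P + Q) \<subseteq> ?A" by (rule keys_add)
  ultimately show ?thesis
    by (simp add: zeval_superset[of ?A] lookup_add distrib_right sum.distrib)
qed

lemma zeval_uminus [simp]: "zeval \<phi> (- P) = - zeval \<phi> P"
  using zeval_add[of \<phi> P "- P"] by (simp add: eq_neg_iff_add_eq_0 add.commute)

lemma zeval_diff [simp]: "zeval \<phi> (P - Q) = zeval \<phi> P - zeval \<phi> Q"
  using zeval_add[of \<phi> P "- Q"] by simp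

lemma zeval_single: "zeval \<phi> (Poly_Mapping.single m c) = of_int c * mon_eval \<phi> m"
  by (cases "c = 0") (simp_all add: zeval_def)

lemma zeval_frag_of: "zeval \<phi> (frag_of m) = mon_eval \<phi> m"
  using zeval_single[of \<phi> m 1] by simp

lemma zpoly_induct [case_names zero mono diff]:
  fixes P :: "'v zpoly"
  assumes "Q 0" "\<And>m. Q (frag_of m)" "\<And>a b. Q a \<Longrightarrow> Q b \<Longrightarrow> Q (a - b)"
  shows "Q P"
  by (rule frag_induction[of P UNIV]) (use assms in auto)

lemma frag_of_mult: "frag_of m * frag_of n = (frag_of (m + n) :: 'v zpoly)"
  by (simp add: mult_single)

lemma zeval_mult [simp]: "zeval \<phi> (P * Q) = zeval \<phi> P * zeval \<phi> Q"
proof (induction P rule: zpoly_induct)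
  case (mono m)
  show ?case
    by (induction Q rule: zpoly_induct)
       (simp_all add: frag_of_mult zeval_frag_of mon_eval_add right_diff_distrib)
qed (simp_all add: left_diff_distrib)

lemma zeval_1 [simp]: "zeval \<phi> 1 = 1"
  using zeval_single[of \<phi> 0 1] by (simp add: mon_eval_def)

lemma zeval_power [simp]: "zeval \<phi> (P ^ n) = zeval \<phi> P ^ n"
  by (induction n) simp_all

lemma zeval_of_nat [simp]: "zeval \<phi> (of_nat n) = of_nat n"
  by (induction n) simp_all

lemma zeval_sum [simp]: "zeval \<phi> (sum g A) = (\<Sum>i\<in>A. zeval \<phi> (g i))"
  by (induction A rule: infinite_finite_induct) simp_all

lemma zeval_prod [simp]: "zeval \<phi> (prod g A) = (\<Prod>i\<in>A. zeval \<phi> (g i))"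
  by (induction A rule: infinite_finite_induct) simp_all

lemma zeval_zvar [simp]: "zeval \<phi> (zvar v) = \<phi> v"
  by (simp add: zvar_def zeval_single mon_eval_def)

lemma zeval_mon_eval: "zeval \<psi> (mon_eval \<phi> m) = mon_eval (\<lambda>v. zeval \<psi> (\<phi> v)) m"
  by (simp add: mon_eval_def)

lemma zeval_zeval: "zeval \<psi> (zeval \<phi> P) = zeval (\<lambda>v. zeval \<psi> (\<phi> v)) P"
  by (induction P rule: zpoly_induct) (simp_all add: zeval_frag_of zeval_mon_eval)

lemma mon_eval_zvar: "mon_eval zvar m = frag_of m"
proof -
  have pow: "zvar v ^ k = Poly_Mapping.single (Poly_Mapping.single v k) (1::int)" for v :: 'v and k
    by (induction k) (simp_all add: zvar_def mult_single flip: single_add)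
  have prod: "finite A \<Longrightarrow> (\<Prod>v\<in>A. Poly_Mapping.single (g v) (1::int)) = Poly_Mapping.single (\<Sum>v\<in>A. g v) 1"
    for A and g :: "'v \<Rightarrow> 'v \<Rightarrow>\<^sub>0 nat"
    by (induction A rule: finite_induct) (simp_all add: mult_single)
  have "m = (\<Sum>v\<in>Poly_Mapping.keys m. Poly_Mapping.single v (Poly_Mapping.lookup m v))"
    by (rule poly_mapping_eqI)
       (auto simp: lookup_sum lookup_single when_def in_keys_iff sum.delta)
  then show ?thesis
    by (simp add: mon_eval_def pow prod)
qed

lemma lookup_of_nat_mult:
  "Poly_Mapping.lookup (of_nat k * P :: 'v zpoly) m = of_nat k * Poly_Mapping.lookup P m"
  by (induction k) (simp_all add: distrib_right lookup_add)

lemma zpoly_torsion_free: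
  assumes "p > 0" "of_nat p * (P :: 'v zpoly) = 0" shows "P = 0"
proof (rule poly_mapping_eqI)
  fix m
  have "of_nat p * Poly_Mapping.lookup P m = 0"
    using assms(2) by (metis lookup_of_nat_mult lookup_zero)
  then show "Poly_Mapping.lookup P m = Poly_Mapping.lookup 0 m"
    using assms(1) by simp
qed


section \<open>Congruences\<close>

lemma freshman_dvd:
  fixes a b :: "'a::comm_ring_1"
  assumes "prime p"
  shows "of_nat p dvd (a + b) ^ p - a ^ p - b ^ p"
proof -
  have p: "p > 1" using assms by (rule prime_gt_1_nat)
  have split: "{..p} = insert 0 (insert p {1..<p})" using p by auto
  have "(a + b) ^ p = (\<Sum>k\<le>p. of_nat (p choose k) * a ^ k * b ^ (p - k))"
    by (rule binomial_ring)
  also have "\<dots> = b ^ p + (a ^ p + (\<Sum>k\<in>{1..<p}. of_nat (p choose k) * a ^ k * b ^ (p - k)))"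
    unfolding split using p by simp
  finally have "(a + b) ^ p - a ^ p - b ^ p = (\<Sum>k\<in>{1..<p}. of_nat (p choose k) * a ^ k * b ^ (p - k))"
    by (simp add: algebra_simps)
  moreover have "of_nat p dvd (of_nat (p choose k) :: 'a)" if "k \<in> {1..<p}" for k
    using dvd_choose_prime[of k p] that assms p by (auto elim!: dvdE)
  ultimately show ?thesis
    by (auto intro!: dvd_sum dvd_mult2)
qed

lemma power_prime_cong:
  fixes a b :: "'a::comm_ring_1"
  assumes "of_nat p ^ Suc n dvd a - b"
  shows "of_nat p ^ Suc (Suc n) dvd a ^ p - b ^ p"
proof -
  have ab: "of_nat p dvd a - b"
    using assms by (rule dvd_trans[rotated]) simp
  have pw: "of_nat p dvd a ^ i - b ^ i" for i
    using ab dvd_trans power_diff_sumr2[of a i b] by (metis dvd_triv_left)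
  have "(\<Sum>i<p. b ^ (p - Suc i) * a ^ i) - of_nat p * b ^ (p - 1)
        = (\<Sum>i<p. b ^ (p - Suc i) * a ^ i - b ^ (p - 1))"
    by (simp add: sum_subtractf)
  also have "\<dots> = (\<Sum>i<p. b ^ (p - Suc i) * (a ^ i - b ^ i))"
    by (intro sum.cong) (auto simp: right_diff_distrib simp flip: power_add)
  finally have "of_nat p dvd (\<Sum>i<p. b ^ (p - Suc i) * a ^ i) - of_nat p * b ^ (p - 1)"
    using pw by (auto intro!: dvd_sum dvd_mult)
  then have "of_nat p dvd (\<Sum>i<p. b ^ (p - Suc i) * a ^ i)"
    by (metis dvd_triv_left dvd_diff_commute dvd_diffD diff_add_cancel dvd_add)
  then have "of_nat p ^ Suc n * of_nat p dvd (a - b) * (\<Sum>i<p. b ^ (p - Suc i) * a ^ i)"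
    using assms by (intro mult_dvd_mono)
  then show ?thesis
    by (simp add: power_diff_sumr2 mult_ac)
qed

lemma power_prime_power_cong:
  fixes a b :: "'a::comm_ring_1"
  assumes "of_nat p dvd a - b"
  shows "of_nat p ^ Suc n dvd a ^ (p ^ n) - b ^ (p ^ n)"
proof (induction n)
  case (Suc n)
  then show ?case
    using power_prime_cong[OF Suc] by (simp add: mult.commute flip: power_mult)
qed (use assms in simp)

definition zfrob :: "nat \<Rightarrow> 'v zpoly \<Rightarrow> 'v zpoly" where
  "zfrob p = zeval (\<lambda>v. zvar v ^ p)"

lemma zfrob_cong:
  assumes "prime p"
  shows "of_nat p dvd zfrob p P - P ^ p"
proof (induction P rule: zpoly_induct)
  case zero
  have "p > 0" using assms by (rule prime_gt_0_nat)
  then show ?case by (simp add: zfrob_def power_0_left)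
next
  case (mono m)
  have "mon_eval (\<lambda>v. zvar v ^ p) m = mon_eval zvar m ^ p"
    by (simp add: mon_eval_def mult.commute prod_power_distrib flip: power_mult)
  then show ?case
    by (simp add: zfrob_def zeval_frag_of mon_eval_zvar)
next
  case (diff a b)
  have "zfrob p (a - b) - (a - b) ^ p = ((a - b + b) ^ p - (a - b) ^ p - b ^ p)
          + (zfrob p a - a ^ p) - (zfrob p b - b ^ p)"
    by (simp add: zfrob_def)
  then show ?case
    by (metis assms diff dvd_add dvd_diff freshman_dvd)
qed


section \<open>The universal Witt polynomials\<close>

definition ghost :: "nat \<Rightarrow> (nat \<Rightarrow> 'a::comm_ring_1) \<Rightarrow> nat \<Rightarrow> 'a" where
  "ghost p x n = (\<Sum>i\<le>n. of_nat p ^ i * x i ^ (p ^ (n - i)))"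

lemma ghost_lessThan: "ghost p x n = (\<Sum>i<n. of_nat p ^ i * x i ^ (p ^ (n - i))) + of_nat p ^ n * x n"
proof -
  have "{..n} = insert n {..<n}" by auto
  then show ?thesis by (simp add: ghost_def add.commute)
qed

lemma zeval_ghost: "zeval \<phi> (ghost p x n) = ghost p (\<lambda>i. zeval \<phi> (x i)) n"
  by (simp add: ghost_def)

lemma zpoly_torsion_free_power:
  assumes "p > 0" "of_nat p ^ n * (P :: 'v zpoly) = of_nat p ^ n * Q" shows "P = Q"
proof -
  have "of_nat (p ^ n) * (P - Q) = 0" using assms(2) by (simp add: algebra_simps)
  then have "P - Q = 0" by (rule zpoly_torsion_free[rotated]) (use assms(1) in simp)
  then show ?thesis by simp
qed

lemma zpoly_dvd_cancel:
  assumes "p > 0" "of_nat p ^ (n + r) dvd of_nat p ^ n * (P :: 'v zpoly)"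
  shows "of_nat p ^ r dvd P"
proof -
  obtain Q where "of_nat p ^ n * P = of_nat p ^ (n + r) * Q"
    using assms(2) by (rule dvdE)
  then have "of_nat p ^ n * P = of_nat p ^ n * (of_nat p ^ r * Q)"
    by (simp only: power_add mult.assoc)
  then have "P = of_nat p ^ r * Q" by (rule zpoly_torsion_free_power[OF assms(1)])
  then show ?thesis by simp
qed

lemma ghost_cong: "(\<And>i. i \<le> n \<Longrightarrow> S i = T i) \<Longrightarrow> ghost p S n = ghost p T n"
  by (simp add: ghost_def)

lemma ghost_inj_upto:
  fixes S T :: "nat \<Rightarrow> 'v zpoly"
  assumes p: "p > 0" and eq: "\<And>m. m \<le> n \<Longrightarrow> ghost p S m = ghost p T m"
  shows "S n = T n"
  using eq
proof (induction n rule: less_induct)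
  case (less n)
  have "(\<Sum>i<n. of_nat p ^ i * S i ^ (p ^ (n - i))) = (\<Sum>i<n. of_nat p ^ i * T i ^ (p ^ (n - i)))"
  proof (rule sum.cong)
    fix i assume i: "i \<in> {..<n}"
    have "S i = T i" by (rule less.IH) (use i less.prems in simp_all)
    then show "of_nat p ^ i * S i ^ (p ^ (n - i)) = of_nat p ^ i * T i ^ (p ^ (n - i))" by simp
  qed simp
  then have "of_nat p ^ n * S n = of_nat p ^ n * T n"
    using less.prems[OF order_refl] by (simp only: ghost_lessThan add_left_cancel)
  then show ?case by (rule zpoly_torsion_free_power[OF p])
qed

lemma ghost_inj:
  fixes S T :: "nat \<Rightarrow> 'v zpoly"
  assumes "p > 0" "\<And>n. ghost p S n = ghost p T n"
  shows "S = T"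
  by (rule ext, rule ghost_inj_upto[OF assms(1)]) (rule assms(2))

text \<open>Dwork's criterion for a sequence of polynomials to consist of ghost components.\<close>

lemma ghost_ex_step:
  fixes w :: "nat \<Rightarrow> 'v zpoly"
  assumes p: "prime p" and w: "of_nat p ^ Suc n dvd w (Suc n) - zfrob p (w n)"
    and S: "ghost p S n = w n"
  shows "\<exists>z. ghost p (S(Suc n := z)) (Suc n) = w (Suc n)"
proof -
  have "zfrob p (w n) = (\<Sum>i\<le>n. of_nat p ^ i * zfrob p (S i) ^ (p ^ (n - i)))"
    unfolding S[symmetric] ghost_def by (simp add: zfrob_def)
  moreover have "of_nat p ^ Suc n dvd
      of_nat p ^ i * zfrob p (S i) ^ (p ^ (n - i)) - of_nat p ^ i * S i ^ (p ^ (Suc n - i))"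
    if "i \<le> n" for i
  proof -
    have "of_nat p ^ Suc (n - i) dvd zfrob p (S i) ^ (p ^ (n - i)) - (S i ^ p) ^ (p ^ (n - i))"
      by (rule power_prime_power_cong) (rule zfrob_cong[OF p])
    then have "of_nat p ^ i * of_nat p ^ Suc (n - i) dvd
        of_nat p ^ i * (zfrob p (S i) ^ (p ^ (n - i)) - (S i ^ p) ^ (p ^ (n - i)))"
      by (rule mult_dvd_mono[OF dvd_refl])
    moreover have "(S i ^ p) ^ (p ^ (n - i)) = S i ^ (p ^ (Suc n - i))"
      using that by (simp only: Suc_diff_le power_mult[symmetric] power_Suc)
    moreover have "of_nat p ^ i * of_nat p ^ Suc (n - i) = (of_nat p ^ Suc n :: 'v zpoly)"
    proof -
      have "i + Suc (n - i) = Suc n" using that by simp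
      then show ?thesis by (simp only: power_add[symmetric])
    qed
    ultimately show ?thesis by (simp only: right_diff_distrib)
  qed
  ultimately have "of_nat p ^ Suc n dvd zfrob p (w n) - (\<Sum>i\<le>n. of_nat p ^ i * S i ^ (p ^ (Suc n - i)))"
    by (simp only: sum_subtractf[symmetric]) (rule dvd_sum, simp only: atMost_iff)
  then have "of_nat p ^ Suc n dvd (w (Suc n) - zfrob p (w n)) +
      (zfrob p (w n) - (\<Sum>i\<le>n. of_nat p ^ i * S i ^ (p ^ (Suc n - i))))"
    by (rule dvd_add[OF w])
  then have "of_nat p ^ Suc n dvd w (Suc n) - (\<Sum>i<Suc n. of_nat p ^ i * S i ^ (p ^ (Suc n - i)))"
    by (simp only: lessThan_Suc_atMost add_diff_eq diff_add_cancel)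
  then obtain z where z: "w (Suc n) - (\<Sum>i<Suc n. of_nat p ^ i * S i ^ (p ^ (Suc n - i))) = of_nat p ^ Suc n * z"
    by (rule dvdE)
  have "(\<Sum>i<Suc n. of_nat p ^ i * (S(Suc n := z)) i ^ (p ^ (Suc n - i)))
      = (\<Sum>i<Suc n. of_nat p ^ i * S i ^ (p ^ (Suc n - i)))"
    by (rule sum.cong) auto
  then have "ghost p (S(Suc n := z)) (Suc n) = w (Suc n)"
    by (simp only: ghost_lessThan fun_upd_same z[symmetric] add_diff_eq add_diff_cancel_left')
  then show ?thesis ..
qed

lemma ghost_ex:
  fixes w :: "nat \<Rightarrow> 'v zpoly"
  assumes p: "prime p" and w: "\<And>n. of_nat p ^ Suc n dvd w (Suc n) - zfrob p (w n)"
  shows "\<exists>!S. ghost p S = w"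
proof (rule ex_ex1I)
  have p0: "p > 0" using p by (rule prime_gt_0_nat)
  have "\<exists>S. \<forall>m\<le>n. ghost p S m = w m" for n
  proof (induction n)
    case 0
    show ?case by (rule exI[of _ "\<lambda>_. w 0"]) (simp add: ghost_def)
  next
    case (Suc n)
    then obtain S where S: "\<And>m. m \<le> n \<Longrightarrow> ghost p S m = w m" by blast
    obtain z where z: "ghost p (S(Suc n := z)) (Suc n) = w (Suc n)"
      using ghost_ex_step[OF p w S[OF order_refl]] by blast
    have "ghost p (S(Suc n := z)) m = w m" if "m \<le> Suc n" for m
    proof (cases "m = Suc n")
      case False
      then have "ghost p (S(Suc n := z)) m = ghost p S m" using that by (intro ghost_cong) auto
      then show ?thesis using S[of m] that False by simp
    qed (use z in simp)
    then show ?case by blast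
  qed
  then obtain S where S: "\<And>n m. m \<le> n \<Longrightarrow> ghost p (S n) m = w m" by metis
  have coh: "S i i = S n i" if "i \<le> n" for i n
    by (rule ghost_inj_upto[OF p0]) (use S that in simp)
  have "ghost p (\<lambda>i. S i i) n = w n" for n
    using ghost_cong[of n "\<lambda>i. S i i" "S n"] coh S by simp
  then show "\<exists>S. ghost p S = w" by blast
next
  fix S T assume "ghost p S = w" "ghost p T = w"
  then show "S = T" using ghost_inj[of p S T] prime_gt_0_nat[OF p] by simp
qed

text \<open>
  The universal Witt polynomials are the polynomials with integer coefficients whose ghost components are
  those of the sum, the product and the negation.
\<close>

definition witt_polys :: "nat \<Rightarrow> (nat \<Rightarrow> 'v zpoly) \<Rightarrow> nat \<Rightarrow> 'v zpoly" where
  "witt_polys p w = (THE S. ghost p S = w)"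

lemma ghost_witt_polys:
  assumes "prime p" "\<And>n. of_nat p ^ Suc n dvd w (Suc n) - zfrob p (w n)"
  shows "ghost p (witt_polys p w) = w"
  unfolding witt_polys_def by (rule theI'[of "\<lambda>S. ghost p S = w"]) (rule ghost_ex[OF assms])

text \<open>The variable \<open>zvar (j, i)\<close> is the \<open>i\<close>-th component of the \<open>j\<close>-th argument.\<close>

definition witt_vars :: "nat \<Rightarrow> nat \<Rightarrow> (nat \<times> nat) zpoly" where
  "witt_vars j i = zvar (j, i)"

lemma ghost_vars_cong:
  "of_nat p ^ Suc n dvd ghost p (witt_vars j) (Suc n) - zfrob p (ghost p (witt_vars j) n)"
proof -
  have "ghost p (witt_vars j) (Suc n) = zfrob p (ghost p (witt_vars j) n) + of_nat p ^ Suc n * witt_vars j (Suc n)"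
    unfolding ghost_lessThan[of _ _ "Suc n"] zfrob_def zeval_ghost unfolding ghost_def
    by (auto simp: witt_vars_def lessThan_Suc_atMost Suc_diff_le simp flip: power_mult intro!: sum.cong)
  then show ?thesis by simp
qed

definition witt_add_polys :: "nat \<Rightarrow> nat \<Rightarrow> (nat \<times> nat) zpoly" where
  "witt_add_polys p = witt_polys p (\<lambda>n. ghost p (witt_vars 0) n + ghost p (witt_vars 1) n)"

definition witt_mult_polys :: "nat \<Rightarrow> nat \<Rightarrow> (nat \<times> nat) zpoly" where
  "witt_mult_polys p = witt_polys p (\<lambda>n. ghost p (witt_vars 0) n * ghost p (witt_vars 1) n)"

definition witt_uminus_polys :: "nat \<Rightarrow> nat \<Rightarrow> (nat \<times> nat) zpoly" where
  "witt_uminus_polys p = witt_polys p (\<lambda>n. - ghost p (witt_vars 0) n)"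

context
  fixes p :: nat assumes p: "prime p"
begin

lemma ghost_add_polys:
  "ghost p (witt_add_polys p) n = ghost p (witt_vars 0) n + ghost p (witt_vars 1) n"
proof -
  have "of_nat p ^ Suc n dvd
      (ghost p (witt_vars 0) (Suc n) - zfrob p (ghost p (witt_vars 0) n)) +
      (ghost p (witt_vars 1) (Suc n) - zfrob p (ghost p (witt_vars 1) n))" for n
    by (intro dvd_add ghost_vars_cong)
  then show ?thesis
    unfolding witt_add_polys_def by (subst ghost_witt_polys[OF p]) (simp_all add: zfrob_def algebra_simps)
qed

lemma ghost_mult_polys:
  "ghost p (witt_mult_polys p) n = ghost p (witt_vars 0) n * ghost p (witt_vars 1) n"
proof -
  have "of_nat p ^ Suc n dvd
      (ghost p (witt_vars 0) (Suc n) - zfrob p (ghost p (witt_vars 0) n)) * ghost p (witt_vars 1) (Suc n) +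
      zfrob p (ghost p (witt_vars 0) n) * (ghost p (witt_vars 1) (Suc n) - zfrob p (ghost p (witt_vars 1) n))" for n
    by (intro dvd_add dvd_mult dvd_mult2 ghost_vars_cong)
  then show ?thesis
    unfolding witt_mult_polys_def by (subst ghost_witt_polys[OF p]) (simp_all add: zfrob_def algebra_simps)
qed

lemma ghost_uminus_polys:
  "ghost p (witt_uminus_polys p) n = - ghost p (witt_vars 0) n"
proof -
  have "of_nat p ^ Suc n dvd
      - (ghost p (witt_vars 0) (Suc n) - zfrob p (ghost p (witt_vars 0) n))" for n
    unfolding dvd_minus_iff by (rule ghost_vars_cong)
  then show ?thesis
    unfolding witt_uminus_polys_def by (subst ghost_witt_polys[OF p]) (simp_all add: zfrob_def algebra_simps)
qed

end

definition args2 :: "(nat \<Rightarrow> 'a) \<Rightarrow> (nat \<Rightarrow> 'a) \<Rightarrow> nat \<times> nat \<Rightarrow> 'a" where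
  "args2 x y = (\<lambda>(j, i). if j = 0 then x i else y i)"

definition wadd :: "nat \<Rightarrow> (nat \<Rightarrow> 'a::comm_ring_1) \<Rightarrow> (nat \<Rightarrow> 'a) \<Rightarrow> nat \<Rightarrow> 'a" where
  "wadd p x y n = zeval (args2 x y) (witt_add_polys p n)"

definition wmult :: "nat \<Rightarrow> (nat \<Rightarrow> 'a::comm_ring_1) \<Rightarrow> (nat \<Rightarrow> 'a) \<Rightarrow> nat \<Rightarrow> 'a" where
  "wmult p x y n = zeval (args2 x y) (witt_mult_polys p n)"

definition wuminus :: "nat \<Rightarrow> (nat \<Rightarrow> 'a::comm_ring_1) \<Rightarrow> nat \<Rightarrow> 'a" where
  "wuminus p x n = zeval (args2 x x) (witt_uminus_polys p n)"

definition wone :: "nat \<Rightarrow> 'a::comm_ring_1" where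
  "wone n = (if n = 0 then 1 else 0)"

lemma zeval_args2_vars [simp]:
  "zeval (args2 x y) (witt_vars 0 i) = x i"  "zeval (args2 x y) (witt_vars (Suc j) i) = y i"
  by (simp_all add: witt_vars_def args2_def)

lemma ghost_wadd: "prime p \<Longrightarrow> ghost p (wadd p x y) n = ghost p x n + ghost p y n"
  using arg_cong[OF ghost_add_polys, of p "zeval (args2 x y)" n]
  by (simp add: zeval_ghost wadd_def[abs_def])

lemma ghost_wmult: "prime p \<Longrightarrow> ghost p (wmult p x y) n = ghost p x n * ghost p y n"
  using arg_cong[OF ghost_mult_polys, of p "zeval (args2 x y)" n]
  by (simp add: zeval_ghost wmult_def[abs_def])

lemma ghost_wuminus: "prime p \<Longrightarrow> ghost p (wuminus p x) n = - ghost p x n"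
  using arg_cong[OF ghost_uminus_polys, of p "zeval (args2 x x)" n]
  by (simp add: zeval_ghost wuminus_def[abs_def])

lemma ghost_zero: "p > 0 \<Longrightarrow> ghost p (\<lambda>_. 0) n = 0"
  by (simp add: ghost_def power_0_left)

lemma ghost_wone: "p > 0 \<Longrightarrow> ghost p wone n = 1"
  by (simp add: ghost_def wone_def sum.atMost_shift power_0_left)

lemma zeval_args2: "zeval \<psi> (zeval (args2 x y) P) = zeval (args2 (\<lambda>i. zeval \<psi> (x i)) (\<lambda>i. zeval \<psi> (y i))) P"
  unfolding zeval_zeval by (intro arg_cong2[where f = zeval]) (auto simp: args2_def)

lemma zeval_wadd: "zeval \<psi> (wadd p x y n) = wadd p (\<lambda>i. zeval \<psi> (x i)) (\<lambda>i. zeval \<psi> (y i)) n"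
  by (simp add: wadd_def zeval_args2)

lemma zeval_wmult: "zeval \<psi> (wmult p x y n) = wmult p (\<lambda>i. zeval \<psi> (x i)) (\<lambda>i. zeval \<psi> (y i)) n"
  by (simp add: wmult_def zeval_args2)

lemma zeval_wuminus: "zeval \<psi> (wuminus p x n) = wuminus p (\<lambda>i. zeval \<psi> (x i)) n"
  by (simp add: wuminus_def zeval_args2)

lemma zeval_wone: "zeval \<psi> (wone n) = wone n"
  by (simp add: wone_def)


section \<open>The ring of Witt vectors\<close>

definition args3 :: "(nat \<Rightarrow> 'a) \<Rightarrow> (nat \<Rightarrow> 'a) \<Rightarrow> (nat \<Rightarrow> 'a) \<Rightarrow> nat \<times> nat \<Rightarrow> 'a" where
  "args3 x y z = (\<lambda>(j, i). if j = 0 then x i else if j = 1 then y i else z i)"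

lemma zeval_args3_vars [simp]:
  "zeval (args3 x y z) (witt_vars 0 i) = x i"
  "zeval (args3 x y z) (witt_vars (Suc 0) i) = y i"
  "zeval (args3 x y z) (witt_vars (Suc (Suc j)) i) = z i"
  by (simp_all add: witt_vars_def args3_def)

lemmas zeval_wops = zeval_wadd zeval_wmult zeval_wuminus zeval_wone

context
  fixes p :: nat assumes p: "prime p"
begin

lemma p_pos: "p > 0"
  using p by (rule prime_gt_0_nat)

lemmas ghosts = ghost_wadd[OF p] ghost_wmult[OF p] ghost_wuminus[OF p] ghost_zero[OF p_pos] ghost_wone[OF p_pos]

lemma witt_law:
  fixes F G :: "nat \<Rightarrow> (nat \<times> nat) zpoly"
  assumes "\<And>n. ghost p F n = ghost p G n"
  shows "zeval \<phi> (F n) = zeval \<phi> (G n)"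
  using ghost_inj[OF p_pos, of F G] assms by simp

lemma wadd_assoc: "wadd p (wadd p x y) z = wadd p x (wadd p y z)"
proof
  fix n
  show "wadd p (wadd p x y) z n = wadd p x (wadd p y z) n"
    using witt_law[of "wadd p (wadd p (witt_vars 0) (witt_vars 1)) (witt_vars 2)"
        "wadd p (witt_vars 0) (wadd p (witt_vars 1) (witt_vars 2))" "args3 x y z" n]
    by (simp add: ghosts zeval_wops algebra_simps numeral_2_eq_2)
qed

lemma wadd_commute: "wadd p x y = wadd p y x"
proof
  fix n
  show "wadd p x y n = wadd p y x n"
    using witt_law[of "wadd p (witt_vars 0) (witt_vars 1)"
        "wadd p (witt_vars 1) (witt_vars 0)" "args3 x y y" n]
    by (simp add: ghosts zeval_wops algebra_simps numeral_2_eq_2)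
qed

lemma wadd_0: "wadd p (\<lambda>_. 0) x = x"
proof
  fix n
  show "wadd p (\<lambda>_. 0) x n = x n"
    using witt_law[of "wadd p (\<lambda>_. 0) (witt_vars 0)" "witt_vars 0" "args3 x x x" n]
    by (simp add: ghosts zeval_wops algebra_simps numeral_2_eq_2)
qed

lemma wadd_wuminus: "wadd p (wuminus p x) x = (\<lambda>_. 0)"
proof
  fix n
  show "wadd p (wuminus p x) x n = 0"
    using witt_law[of "wadd p (wuminus p (witt_vars 0)) (witt_vars 0)" "\<lambda>_. 0" "args3 x x x" n]
    by (simp add: ghosts zeval_wops algebra_simps numeral_2_eq_2)
qed

lemma wmult_assoc: "wmult p (wmult p x y) z = wmult p x (wmult p y z)"
proof
  fix n
  show "wmult p (wmult p x y) z n = wmult p x (wmult p y z) n"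
    using witt_law[of "wmult p (wmult p (witt_vars 0) (witt_vars 1)) (witt_vars 2)"
        "wmult p (witt_vars 0) (wmult p (witt_vars 1) (witt_vars 2))" "args3 x y z" n]
    by (simp add: ghosts zeval_wops algebra_simps numeral_2_eq_2)
qed

lemma wmult_commute: "wmult p x y = wmult p y x"
proof
  fix n
  show "wmult p x y n = wmult p y x n"
    using witt_law[of "wmult p (witt_vars 0) (witt_vars 1)"
        "wmult p (witt_vars 1) (witt_vars 0)" "args3 x y y" n]
    by (simp add: ghosts zeval_wops algebra_simps numeral_2_eq_2)
qed

lemma wmult_1: "wmult p wone x = x"
proof
  fix n
  show "wmult p wone x n = x n"
    using witt_law[of "wmult p wone (witt_vars 0)" "witt_vars 0" "args3 x x x" n]
    by (simp add: ghosts zeval_wops algebra_simps numeral_2_eq_2)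
qed

lemma wadd_wmult_distrib: "wmult p (wadd p x y) z = wadd p (wmult p x z) (wmult p y z)"
proof
  fix n
  show "wmult p (wadd p x y) z n = wadd p (wmult p x z) (wmult p y z) n"
    using witt_law[of "wmult p (wadd p (witt_vars 0) (witt_vars 1)) (witt_vars 2)"
        "wadd p (wmult p (witt_vars 0) (witt_vars 2)) (wmult p (witt_vars 1) (witt_vars 2))" "args3 x y z" n]
    by (simp add: ghosts zeval_wops algebra_simps numeral_2_eq_2)
qed

lemma wadd_nth_0: "wadd p x y 0 = x 0 + y 0"
  using ghost_wadd[OF p, of x y 0] by (simp add: ghost_def)

lemma ghost_shift:
  fixes X :: "nat \<Rightarrow> 'v zpoly"
  assumes "\<And>m. m < i \<Longrightarrow> X m = 0"
  shows "of_nat p ^ i dvd ghost p X n"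
    and "of_nat p ^ Suc i dvd ghost p X (i + k) - of_nat p ^ i * X i ^ (p ^ k)"
proof -
  show "of_nat p ^ i dvd ghost p X n"
    unfolding ghost_def
  proof (rule dvd_sum)
    fix m
    show "of_nat p ^ i dvd of_nat p ^ m * X m ^ p ^ (n - m)"
      using assms[of m] p_pos
      by (cases "m < i") (auto simp: power_0_left not_less intro!: dvd_mult2 le_imp_power_dvd)
  qed
  have split: "{..i + k} = insert i ({..i + k} - {i})" by auto
  have "ghost p X (i + k) - of_nat p ^ i * X i ^ (p ^ k)
      = (\<Sum>m\<in>{..i + k} - {i}. of_nat p ^ m * X m ^ p ^ (i + k - m))"
    unfolding ghost_def by (subst split, subst sum.insert) auto
  also have "of_nat p ^ Suc i dvd \<dots>"
  proof (rule dvd_sum)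
    fix m assume "m \<in> {..i + k} - {i}"
    then have "m < i \<or> Suc i \<le> m" by auto
    then show "of_nat p ^ Suc i dvd of_nat p ^ m * X m ^ p ^ (i + k - m)"
    proof
      assume "m < i"
      then show ?thesis using assms[of m] p_pos by (simp add: power_0_left)
    next
      assume "Suc i \<le> m"
      then show ?thesis by (intro dvd_mult2 le_imp_power_dvd)
    qed
  qed
  finally show "of_nat p ^ Suc i dvd ghost p X (i + k) - of_nat p ^ i * X i ^ (p ^ k)" .
qed

lemma mult_p_power_ge:
  assumes "0 < r" shows "r + 1 \<le> r * p ^ r"
proof -
  have "2 \<le> p ^ 1" using prime_ge_2_nat[OF p] by simp
  also have "p ^ 1 \<le> p ^ r" using assms p_pos by (intro power_increasing) auto
  finally have "2 \<le> p ^ r" by simp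
  then have "r * 2 \<le> r * p ^ r" by (rule mult_le_mono2)
  moreover have "r + 1 \<le> r * 2" using assms by simp
  ultimately show ?thesis by (rule le_trans[rotated])
qed

lemma wmult_lead_poly:
  fixes X Y :: "nat \<Rightarrow> 'v zpoly"
  assumes X: "\<And>m. m < i \<Longrightarrow> X m = 0" and Y: "\<And>m. m < j \<Longrightarrow> Y m = 0"
  shows "of_nat p dvd wmult p X Y (i + j) - X i ^ (p ^ j) * Y j ^ (p ^ i)"
proof -
  let ?P = "wmult p X Y"
  have gh: "ghost p ?P n = ghost p X n * ghost p Y n" for n
    by (rule ghost_wmult[OF p])
  have low: "of_nat p ^ (i + j - n) dvd ?P n" if "n < i + j" for n
    using that
  proof (induction n rule: less_induct)
    case (less n)
    have "of_nat p ^ (i + j) dvd ghost p ?P n"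
      unfolding gh power_add using X Y by (intro mult_dvd_mono ghost_shift(1))
    moreover have "of_nat p ^ (i + j) dvd (\<Sum>m<n. of_nat p ^ m * ?P m ^ (p ^ (n - m)))"
    proof (rule dvd_sum)
      fix m assume "m \<in> {..<n}"
      then have m: "m < n" by simp
      have "of_nat p ^ (i + j - m) dvd ?P m" using less m by auto
      also have "?P m dvd ?P m ^ (p ^ (n - m))" using p_pos by (simp add: dvd_power)
      finally have "of_nat p ^ m * of_nat p ^ (i + j - m) dvd of_nat p ^ m * ?P m ^ (p ^ (n - m))"
        by (rule mult_dvd_mono[OF dvd_refl])
      moreover have "m + (i + j - m) = i + j" using m less.prems by simp
      ultimately show "of_nat p ^ (i + j) dvd of_nat p ^ m * ?P m ^ (p ^ (n - m))"
        by (simp only: power_add[symmetric])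
    qed
    ultimately have "of_nat p ^ (i + j) dvd
        ghost p ?P n - (\<Sum>m<n. of_nat p ^ m * ?P m ^ (p ^ (n - m)))"
      by (rule dvd_diff)
    then have "of_nat p ^ (i + j) dvd of_nat p ^ n * ?P n"
      by (simp only: ghost_lessThan add_diff_cancel_left')
    moreover have "n + (i + j - n) = i + j" using less.prems by simp
    ultimately show ?case using zpoly_dvd_cancel[OF p_pos, of n "i + j - n" "?P n"] by simp
  qed
  let ?N = "i + j"
  let ?a = "X i ^ (p ^ j)" and ?b = "Y j ^ (p ^ i)"
  have "of_nat p ^ Suc ?N dvd
      (ghost p X ?N - of_nat p ^ i * ?a) * ghost p Y ?N + of_nat p ^ i * ?a * (ghost p Y ?N - of_nat p ^ j * ?b)"
  proof (rule dvd_add)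
    have "of_nat p ^ Suc i * of_nat p ^ j dvd (ghost p X ?N - of_nat p ^ i * ?a) * ghost p Y ?N"
      using X Y by (intro mult_dvd_mono ghost_shift) auto
    then show "of_nat p ^ Suc ?N dvd (ghost p X ?N - of_nat p ^ i * ?a) * ghost p Y ?N"
      by (simp add: power_add mult_ac)
    have "of_nat p ^ i * of_nat p ^ Suc j dvd (of_nat p ^ i * ?a) * (ghost p Y (j + i) - of_nat p ^ j * ?b)"
      using Y by (intro mult_dvd_mono ghost_shift) auto
    then show "of_nat p ^ Suc ?N dvd of_nat p ^ i * ?a * (ghost p Y ?N - of_nat p ^ j * ?b)"
      by (simp add: power_add mult_ac add.commute)
  qed
  then have main: "of_nat p ^ Suc ?N dvd ghost p ?P ?N - of_nat p ^ ?N * (?a * ?b)"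
    by (simp add: gh power_add algebra_simps)
  have "of_nat p ^ Suc ?N dvd (\<Sum>m<?N. of_nat p ^ m * ?P m ^ (p ^ (?N - m)))"
  proof (rule dvd_sum)
    fix m assume "m \<in> {..<?N}"
    then have m: "m < ?N" by simp
    let ?r = "?N - m"
    have "(of_nat p ^ ?r) ^ (p ^ ?r) dvd ?P m ^ (p ^ ?r)"
      using low[OF m] by (rule dvd_power_same)
    moreover have "of_nat p ^ Suc ?r dvd (of_nat p ^ ?r :: 'v zpoly) ^ (p ^ ?r)"
      unfolding power_mult[symmetric] using mult_p_power_ge[of ?r] m by (intro le_imp_power_dvd) simp
    ultimately have "of_nat p ^ Suc ?r dvd ?P m ^ (p ^ ?r)"
      by (rule dvd_trans[rotated])
    then have "of_nat p ^ m * of_nat p ^ Suc ?r dvd of_nat p ^ m * ?P m ^ (p ^ ?r)"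
      by (rule mult_dvd_mono[OF dvd_refl])
    moreover have "m + Suc ?r = Suc ?N" using m by simp
    ultimately show "of_nat p ^ Suc ?N dvd of_nat p ^ m * ?P m ^ (p ^ ?r)"
      by (simp only: power_add[symmetric])
  qed
  with main have "of_nat p ^ Suc ?N dvd (ghost p ?P ?N - of_nat p ^ ?N * (?a * ?b))
      - (\<Sum>m<?N. of_nat p ^ m * ?P m ^ (p ^ (?N - m)))"
    by (rule dvd_diff)
  moreover have "(ghost p ?P ?N - of_nat p ^ ?N * (?a * ?b)) - (\<Sum>m<?N. of_nat p ^ m * ?P m ^ (p ^ (?N - m)))
      = of_nat p ^ ?N * (?P ?N - ?a * ?b)"
    by (simp only: ghost_lessThan[of _ _ ?N] right_diff_distrib) (simp only: algebra_simps)
  ultimately have "of_nat p ^ (?N + 1) dvd of_nat p ^ ?N * (?P ?N - ?a * ?b)" by simp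
  from zpoly_dvd_cancel[OF p_pos this] show ?thesis by simp
qed

lemma wmult_lead:
  fixes x y :: "nat \<Rightarrow> 'a::comm_ring_1"
  assumes char: "of_nat p = (0::'a)"
    and x: "\<And>m. m < i \<Longrightarrow> x m = 0" and y: "\<And>m. m < j \<Longrightarrow> y m = 0"
  shows "wmult p x y (i + j) = x i ^ (p ^ j) * y j ^ (p ^ i)"
proof -
  define X :: "nat \<Rightarrow> (nat \<times> nat) zpoly" where "X = (\<lambda>m. if m < i then 0 else witt_vars 0 m)"
  define Y :: "nat \<Rightarrow> (nat \<times> nat) zpoly" where "Y = (\<lambda>m. if m < j then 0 else witt_vars 1 m)"
  have X: "zeval (args2 x y) (X m) = x m" for m
    using x[of m] by (simp add: X_def)
  have Y: "zeval (args2 x y) (Y m) = y m" for m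
    using y[of m] by (simp add: Y_def)
  have "of_nat p dvd wmult p X Y (i + j) - X i ^ (p ^ j) * Y j ^ (p ^ i)"
  proof (rule wmult_lead_poly)
    show "X m = 0" if "m < i" for m using that by (simp add: X_def)
    show "Y m = 0" if "m < j" for m using that by (simp add: Y_def)
  qed
  then obtain Q where Q: "wmult p X Y (i + j) - X i ^ (p ^ j) * Y j ^ (p ^ i) = of_nat p * Q"
    by (rule dvdE)
  have "zeval (args2 x y) (wmult p X Y (i + j) - X i ^ (p ^ j) * Y j ^ (p ^ i)) = 0"
    unfolding Q by (simp add: char)
  then show ?thesis
    by (simp only: zeval_diff zeval_mult zeval_power zeval_wmult X Y right_minus_eq)
qed

lemma wadd_iterate_1:
  assumes char: "of_nat p = (0::'a::comm_ring_1)"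
  shows "(wadd p wone ^^ p) (\<lambda>_. 0) 1 = (1::'a)"
proof -
  define N :: "nat \<Rightarrow> nat \<Rightarrow> (nat \<times> nat) zpoly" where "N k = (wadd p wone ^^ k) (\<lambda>_. 0)" for k
  have gh: "ghost p (N k) n = of_nat k" for k n
    by (induction k) (simp_all add: N_def ghosts)
  have ev: "zeval \<phi> (N k n) = (wadd p wone ^^ k) (\<lambda>_. 0) n" for \<phi> :: "nat \<times> nat \<Rightarrow> 'a" and k n
    by (induction k arbitrary: n) (simp_all add: N_def zeval_wops)
  have "N p 0 = of_nat p"
    using gh[of p 0] by (simp add: ghost_def)
  then have "of_nat p ^ p + of_nat p * N p 1 = of_nat p"
    using gh[of p 1] by (simp add: ghost_def)
  moreover have "of_nat p ^ p = of_nat p * (of_nat p ^ (p - 1) :: (nat \<times> nat) zpoly)"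
    using power_Suc[of "of_nat p :: (nat \<times> nat) zpoly" "p - 1"] p_pos by simp
  ultimately have "of_nat p ^ 1 * (of_nat p ^ (p - 1) + N p 1) = of_nat p ^ 1 * 1"
    by (simp add: distrib_left)
  then have "of_nat p ^ (p - 1) + N p 1 = 1"
    by (rule zpoly_torsion_free_power[OF p_pos])
  then have "zeval (\<lambda>_. 0 :: 'a) (of_nat p ^ (p - 1) + N p 1) = 1"
    by simp
  moreover have "p - 1 > 0" using prime_gt_1_nat[OF p] by simp
  ultimately show ?thesis
    using char by (simp add: ev power_0_left)
qed

end


typedef 'a witt = "UNIV :: (nat \<Rightarrow> 'a) set"
  morphisms witt_nth Abs_witt ..

setup_lifting type_definition_witt

text \<open>
  \<open>p\<close>-typical Witt vectors, where \<open>p\<close> is the (prime) characteristic of the coefficient ring.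
  The operations evaluate the universal Witt polynomials at the components.
\<close>

instantiation witt :: (comm_ring_prime_char) comm_ring_1
begin

lift_definition zero_witt :: "'a witt" is "\<lambda>_. 0" .
lift_definition one_witt :: "'a witt" is wone .
lift_definition plus_witt :: "'a witt \<Rightarrow> 'a witt \<Rightarrow> 'a witt" is "wadd CHAR('a)" .
lift_definition times_witt :: "'a witt \<Rightarrow> 'a witt \<Rightarrow> 'a witt" is "wmult CHAR('a)" .
lift_definition uminus_witt :: "'a witt \<Rightarrow> 'a witt" is "wuminus CHAR('a)" .
definition minus_witt :: "'a witt \<Rightarrow> 'a witt \<Rightarrow> 'a witt" where "minus_witt x y = x + - y"

instance
proof
  fix x y z :: "'a witt"
  show "x + y + z = x + (y + z)" by transfer (rule wadd_assoc[OF CHAR_prime])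
  show comm: "x + y = y + x" for x y :: "'a witt" by transfer (rule wadd_commute[OF CHAR_prime])
  show "0 + x = x" by transfer (rule wadd_0[OF CHAR_prime])
  show "- x + x = 0" by transfer (rule wadd_wuminus[OF CHAR_prime])
  show "x - y = x + - y" by (rule minus_witt_def)
  show "x * y * z = x * (y * z)" by transfer (rule wmult_assoc[OF CHAR_prime])
  show "x * y = y * x" by transfer (rule wmult_commute[OF CHAR_prime])
  show "1 * x = x" by transfer (rule wmult_1[OF CHAR_prime])
  show "(x + y) * z = x * z + y * z" by transfer (rule wadd_wmult_distrib[OF CHAR_prime])
  show "(0::'a witt) \<noteq> 1" by transfer (auto simp: wone_def fun_eq_iff intro!: exI[of _ 0])
qed

end

lemma witt_nth_0 [simp]: "witt_nth (0 :: 'a::comm_ring_prime_char witt) n = 0"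
  by transfer simp

instance witt :: (idom_prime_char) idom
proof
  fix x y :: "'a witt"
  assume "x \<noteq> 0" "y \<noteq> 0"
  then have ex: "\<exists>i. witt_nth x i \<noteq> 0" "\<exists>j. witt_nth y j \<noteq> 0"
    by (auto simp: witt_nth_inject[symmetric] fun_eq_iff)
  define i where "i = (LEAST i. witt_nth x i \<noteq> 0)"
  define j where "j = (LEAST j. witt_nth y j \<noteq> 0)"
  have i: "witt_nth x i \<noteq> 0" "\<And>m. m < i \<Longrightarrow> witt_nth x m = 0"
    unfolding i_def by (rule LeastI_ex[OF ex(1)]) (use not_less_Least in blast)
  have j: "witt_nth y j \<noteq> 0" "\<And>m. m < j \<Longrightarrow> witt_nth y m = 0"
    unfolding j_def by (rule LeastI_ex[OF ex(2)]) (use not_less_Least in blast)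
  have "witt_nth (x * y) (i + j) = witt_nth x i ^ (CHAR('a) ^ j) * witt_nth y j ^ (CHAR('a) ^ i)"
    unfolding times_witt.rep_eq by (rule wmult_lead[OF CHAR_prime]) (use i j in auto)
  then show "x * y \<noteq> 0" using i(1) j(1) by (metis mult_eq_0_iff power_not_zero witt_nth_0)
qed

instance witt :: (idom_prime_char) ring_char_0
proof
  have nth_of_nat: "witt_nth (of_nat k :: 'a witt) = (wadd CHAR('a) wone ^^ k) (\<lambda>_. 0)" for k
    by (induction k) (simp_all add: zero_witt.rep_eq plus_witt.rep_eq one_witt.rep_eq)
  have nth_0: "witt_nth (of_nat k :: 'a witt) 0 = of_nat k" for k
    by (induction k) (simp_all add: plus_witt.rep_eq one_witt.rep_eq wadd_nth_0 wone_def)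
  have "CHAR('a witt) = 0"
  proof (rule ccontr)
    assume "CHAR('a witt) \<noteq> 0"
    then have pr: "prime CHAR('a witt)" by (simp add: prime_CHAR_semidom)
    have "of_nat CHAR('a witt) = (0 :: 'a)"
      using nth_0[of "CHAR('a witt)"] by simp
    then have "CHAR('a) dvd CHAR('a witt)"
      by (simp add: of_nat_eq_0_iff_char_dvd)
    then have eq: "CHAR('a) = CHAR('a witt)"
      using pr by (simp add: primes_dvd_imp_eq)
    have "witt_nth (of_nat CHAR('a) :: 'a witt) 1 = 1"
      unfolding nth_of_nat by (rule wadd_iterate_1) simp_all
    then show False unfolding eq by simp
  qed
  then have nz: "of_nat k \<noteq> (0 :: 'a witt)" if "k > 0" for k
    using that unfolding CHAR_eq0_iff by blast
  have "of_nat m \<noteq> (of_nat n :: 'a witt)" if "m < n" for m n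
    using nz[of "n - m"] that by (simp add: of_nat_diff)
  then show "inj (of_nat :: nat \<Rightarrow> 'a witt)"
    by (intro injI) (metis linorder_neqE_nat)
qed

instantiation witt :: (idom_prime_char) inverse
begin

text \<open>As for power series, \<open>inverse\<close> is only meaningful on units; it makes \<open>powi\<close> available.\<close>

definition inverse_witt :: "'a witt \<Rightarrow> 'a witt" where
  "inverse_witt x = (if x dvd 1 then THE y. x * y = 1 else 0)"

definition divide_witt :: "'a witt \<Rightarrow> 'a witt \<Rightarrow> 'a witt" where
  "divide_witt x y = x * inverse y"

instance ..

end

lemma of_nat_fract: "of_nat n = to_fract (of_nat n :: 'a::idom)"
  by (induction n) simp_all

instance fract :: ("{idom, ring_char_0}") ring_char_0
  by standard (auto intro!: injI simp: of_nat_fract)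

instance fract :: ("{idom, ring_char_0}") field_char_0 ..


section \<open>Finite fields and their Witt vectors\<close>

text \<open>
  Throughout, \<open>'k\<close> is a field of prime characteristic \<open>p = CHAR('k)\<close>, and \<open>q\<close> is a power of \<open>p\<close>.
  When \<open>'k\<close> is algebraically closed (for example, an algebraic closure of a finite field) it contains exactly one field with \<open>q\<close> elements, for every
  such \<open>q\<close>; all the rings \<open>W(\<F>\<^sub>q)\<close> are then subrings of the type \<open>'k witt\<close>, namely those
  of the vectors with all components in \<open>\<F>\<^sub>q\<close>.
\<close>

definition Fq :: "nat \<Rightarrow> 'k::field_prime_char set" where
  "Fq q = {x. x ^ q = x}"

definition Zq :: "nat \<Rightarrow> 'k::field_prime_char witt set" where
  "Zq q = {w. \<forall>i. witt_nth w i \<in> Fq q}"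

definition mu :: "nat \<Rightarrow> 'k::field_prime_char witt set" where
  "mu q = {z \<in> Zq q. z ^ (q - 1) = 1}"

definition teich :: "'k::field_prime_char \<Rightarrow> 'k witt" where
  "teich x = Abs_witt (\<lambda>i. if i = 0 then x else 0)"

definition witt_frob :: "'k::field_prime_char witt \<Rightarrow> 'k witt" where
  "witt_frob w = Abs_witt (\<lambda>i. witt_nth w i ^ CHAR('k))"

text \<open>
  The trace from \<open>W(\<F>\<^sub>Q)\<close> to \<open>\<int>\<^sub>p\<close> and the norm from \<open>\<F>\<close> with \<open>q ^ k\<close> elements to \<open>\<F>\<^sub>q\<close>, as the
  sum, respectively product, of the Galois conjugates. The two Galois groups are cyclic,
  generated by the Witt vector Frobenius (of order \<open>m\<close> if \<open>Q = p ^ m\<close>) and by \<open>x \<mapsto> x ^ q\<close>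
  (of order \<open>k\<close>).
\<close>

definition trace_Zp :: "nat \<Rightarrow> 'k::field_prime_char witt \<Rightarrow> 'k witt" where
  "trace_Zp Q w = (\<Sum>j<(THE m. Q = CHAR('k) ^ m). (witt_frob ^^ j) w)"

definition norm_Fq :: "nat \<Rightarrow> nat \<Rightarrow> 'k::field_prime_char \<Rightarrow> 'k" where
  "norm_Fq q k x = (\<Prod>j<k. x ^ (q ^ j))"


section \<open>Exponential sums and \<open>L\<close>-series\<close>

text \<open>
  The Laurent polynomial ring in the variables indexed by \<open>'n\<close> is the monoid algebra of
  \<open>\<int>\<^sup>n\<close>, rendered by the type of finitely supported functions on \<open>int ^ 'n\<close>.
\<close>

type_synonym ('n, 'r) laurent_poly = "(int ^ 'n) \<Rightarrow>\<^sub>0 'r"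

definition laurent_eval :: "('n::finite, 'k::field_prime_char witt) laurent_poly \<Rightarrow> 'k witt ^ 'n \<Rightarrow> 'k witt" where
  "laurent_eval f x =
     (\<Sum>u\<in>Poly_Mapping.keys f. Poly_Mapping.lookup f u * (\<Prod>i\<in>UNIV. (x $ i) powi (u $ i)))"

text \<open>\<open>omega_char d\<close> is the character \<open>\<omega>\<^sup>-\<^sup>d\<close>; on \<open>(\<F>\<^sub>q\<^sup>\<times>)\<^sup>n\<close> it depends only on \<open>d\<close> modulo \<open>q - 1\<close>.\<close>

definition omega_char :: "int ^ 'n \<Rightarrow> 'k::field_prime_char ^ 'n::finite \<Rightarrow> 'k witt" where
  "omega_char d x = (\<Prod>i\<in>UNIV. teich (x $ i) powi (- (d $ i)))"

text \<open>
  The character \<open>\<chi>\<^sub>k\<close> on tuples of roots of unity: the component \<open>witt_nth _ 0\<close> is reduction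
  modulo \<open>p\<close>, which identifies \<open>mu (q ^ k)\<close> with the nonzero elements of \<open>Fq (q ^ k)\<close>.
\<close>

definition chi :: "nat \<Rightarrow> nat \<Rightarrow> int ^ 'n \<Rightarrow> 'k::field_prime_char witt ^ 'n::finite \<Rightarrow> 'k witt" where
  "chi q k d x = omega_char d (\<chi> i. norm_Fq q k (witt_nth (x $ i) 0))"

text \<open>
  \<open>(1 + T) ^ x\<close>, a series over the fraction field of \<open>'k witt\<close>. Its coefficients are the binomial
  coefficients of \<open>x\<close>; it has coefficients in \<open>\<int>\<^sub>p\<close> for \<open>x\<close> in \<open>\<int>\<^sub>p\<close>.
\<close>

definition psi :: "'k::field_prime_char witt \<Rightarrow> 'k witt fract fps" where
  "psi x = fps_binomial (to_fract x)"

definition S_sum ::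
  "nat \<Rightarrow> nat \<Rightarrow> ('n::finite, 'k::field_prime_char witt) laurent_poly \<Rightarrow> int ^ 'n \<Rightarrow> 'k witt fract fps" where
  "S_sum q k f d =
     (\<Sum>x\<in>{x :: 'k witt ^ 'n. \<forall>i. x $ i \<in> mu (q ^ k)}.
        fps_const (to_fract (chi q k d x)) * psi (trace_Zp (q ^ k) (laurent_eval f x)))"

text \<open>Series in \<open>s\<close> (outer) with coefficients that are series in \<open>T\<close> (inner).\<close>

definition exp_series :: "'a::field_char_0 fps fps \<Rightarrow> 'a fps fps" where
  "exp_series G = Abs_fps (\<lambda>m. fps_const (1 / fact m)) oo G"

definition L_series ::
  "nat \<Rightarrow> ('n::finite, 'k::field_prime_char witt) laurent_poly \<Rightarrow> int ^ 'n \<Rightarrow> 'k witt fract fps fps" where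
  "L_series q f d =
     exp_series (Abs_fps (\<lambda>k. if k = 0 then 0 else fps_const (1 / of_nat k) * S_sum q k f d))"

definition one_plus_s_Zq :: "nat \<Rightarrow> 'k::field_prime_char witt fract fps fps set" where
  "one_plus_s_Zq q =
     {A. fps_nth A 0 = 1 \<and> (\<forall>i j. fps_nth (fps_nth A i) j \<in> to_fract ` Zq q)}"

definition ord_T :: "'a::zero fps \<Rightarrow> ereal" where
  "ord_T a = (if a = 0 then \<infinity> else ereal (real (subdegree a)))"

definition T_adic_entire :: "'a::zero fps fps \<Rightarrow> bool" where
  "T_adic_entire A \<longleftrightarrow> (\<lambda>i. ord_T (fps_nth A i) / ereal (real i)) \<longlonglongrightarrow> \<infinity>"

definition T_adic_meromorphic :: "nat \<Rightarrow> 'k::field_prime_char witt fract fps fps \<Rightarrow> bool" where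
  "T_adic_meromorphic q L \<longleftrightarrow>
     (\<exists>A B. A \<in> one_plus_s_Zq q \<and> B \<in> one_plus_s_Zq q \<and> T_adic_entire A \<and> T_adic_entire B \<and> L * B = A)"

end

theory Submission
  imports Defs "Jordan_Normal_Form.Determinant"
begin

text \<open>
  The proof is Dwork's: the sums are traces of powers of a completely continuous operator, and the
  \<open>L\<close>-series is an alternating product of its Fredholm determinants. Write \<open>p\<close> for the characteristic
  of \<open>'k\<close>, \<open>n\<close> for the number of variables, and \<open>K\<close> for the field of fractions of \<open>'k witt\<close>.

  Splitting. The Artin--Hasse series \<open>E(X) = exp (\<Sum>i. X ^ p ^ i / p ^ i)\<close> has \<open>p\<close>-integral coefficients, and so
  has the series \<open>\<pi>(T)\<close> with \<open>E(\<pi>) = 1 + T\<close>. If \<open>y ^ p ^ m = y\<close>, then \<open>\<Sum>j<m. (y ^ p ^ j) ^ p ^ i\<close> is the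
  trace of \<open>y\<close> for every \<open>i\<close>, so the product of the \<open>E(\<pi> * y ^ p ^ j)\<close> over \<open>j < m\<close> is \<open>(1 + T)\<close> to the
  power of that trace (\<open>prod_artin_hasse\<close>). Hence the summand of the exponential sum at \<open>x\<close> is
  \<open>\<Prod>l<k. G(x ^ q ^ l)\<close> with \<open>G(X) = X ^ (-d) \<Prod>u. \<Prod>i<a. E(\<pi> * (a\<^sub>u X ^ u) ^ p ^ i)\<close>, and the order in \<open>T\<close>
  of the coefficient \<open>G\<^sub>v\<close> of \<open>X ^ v\<close> grows linearly with \<open>\<bar>v\<bar>\<close>.

  Trace formula. Let \<open>M\<close> be the matrix with the entries \<open>G\<close> at \<open>q u - v\<close>, for \<open>u\<close> and \<open>v\<close> in \<open>\<int>\<^sup>n\<close>.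
  The coefficient of \<open>G(X) G(X ^ q) \<dots>\<close> (\<open>k\<close> factors) at \<open>q ^ k u - v\<close> is the entry of \<open>M ^ k\<close> at \<open>(u, v)\<close>,
  and summation over the roots of unity retains the exponents divisible by \<open>q ^ k - 1\<close>. Therefore
  \<open>S\<^sub>k = (q ^ k - 1) ^ n * Tr (M ^ k)\<close>. With \<open>A(s) = det (1 - s M) = exp (- \<Sum> Tr (M ^ k) s ^ k / k)\<close>,
  expanding the power of \<open>q ^ k - 1\<close> writes \<open>L\<close> as a product of powers of the series \<open>A(q ^ i s)\<close>,
  \<open>i \<le> n\<close>, with exponents \<open>\<plusminus> (n choose i)\<close>.

  Entireness. The entry of \<open>M\<close> at \<open>(u, v)\<close> has order about \<open>\<bar>q u - v\<bar> \<ge> q \<bar>u\<bar> - \<bar>v\<bar>\<close>. In a product over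
  a permutation of a finite set of indices the terms \<open>\<bar>u\<bar> - \<bar>v\<bar>\<close> cancel, which leaves
  \<open>(q - 1) \<Sum> \<bar>u\<bar>\<close>. As only finitely many \<open>u\<close> have \<open>\<bar>u\<bar> < R\<close>, this exceeds every linear function of the
  number of indices (\<open>slope_ge_det_char_mat\<close>).

  Infinite matrices are avoided altogether. Modulo \<open>T ^ h\<close> each Artin--Hasse series is a polynomial, so
  \<open>G\<close> may be replaced by a Laurent polynomial. For a Laurent polynomial the rows and columns outside a
  finite box contribute nothing to the traces, and \<open>trace_formula\<close> concerns an ordinary determinant.
  The series \<open>A\<close> itself is defined by its traces \<open>S\<^sub>k / (q ^ k - 1) ^ n\<close>. It agrees modulo \<open>T ^ h\<close> with the
  \<open>h\<close>-th determinant, and inherits the integrality of the coefficients and the growth estimate, which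
  is uniform in \<open>h\<close> (\<open>entire_of_truncations\<close>, \<open>fredholm_series_entire\<close>).
\<close>


section \<open>Power series over a subring\<close>

definition is_subring :: "'a::comm_ring_1 set \<Rightarrow> bool" where
  "is_subring Z \<longleftrightarrow> 1 \<in> Z \<and> (\<forall>a\<in>Z. \<forall>b\<in>Z. a - b \<in> Z \<and> a * b \<in> Z)"

lemma is_subringD:
  assumes "is_subring Z"
  shows subring_1: "1 \<in> Z"
    and subring_diff: "a \<in> Z \<Longrightarrow> b \<in> Z \<Longrightarrow> a - b \<in> Z"
    and subring_mult: "a \<in> Z \<Longrightarrow> b \<in> Z \<Longrightarrow> a * b \<in> Z"
  using assms by (auto simp: is_subring_def)

lemma subring_0: "is_subring Z \<Longrightarrow> 0 \<in> Z"
  using subring_diff[of Z 1 1] subring_1[of Z] by simp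

lemma subring_uminus: "is_subring Z \<Longrightarrow> a \<in> Z \<Longrightarrow> - a \<in> Z"
  using subring_diff[of Z 0 a] subring_0[of Z] by simp

lemma subring_add: "is_subring Z \<Longrightarrow> a \<in> Z \<Longrightarrow> b \<in> Z \<Longrightarrow> a + b \<in> Z"
  using subring_diff[of Z a "- b"] subring_uminus[of Z b] by simp

lemma subring_sum: "is_subring Z \<Longrightarrow> (\<And>i. i \<in> A \<Longrightarrow> f i \<in> Z) \<Longrightarrow> sum f A \<in> Z"
  by (induction A rule: infinite_finite_induct) (auto intro: subring_0 subring_add)

lemma subring_prod: "is_subring Z \<Longrightarrow> (\<And>i. i \<in> A \<Longrightarrow> f i \<in> Z) \<Longrightarrow> prod f A \<in> Z"
  by (induction A rule: infinite_finite_induct) (auto intro: subring_1 subring_mult)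

lemma subring_power: "is_subring Z \<Longrightarrow> a \<in> Z \<Longrightarrow> a ^ n \<in> Z"
  by (induction n) (auto intro: subring_1 subring_mult)

lemma subring_of_nat: "is_subring Z \<Longrightarrow> of_nat n \<in> Z"
  by (induction n) (auto intro: subring_0 subring_1 subring_add)

lemma subring_of_int: "is_subring Z \<Longrightarrow> of_int n \<in> Z"
  by (cases n) (auto intro: subring_of_nat subring_uminus simp del: of_nat_Suc)

definition fps_over :: "'a::zero set \<Rightarrow> 'a fps set" where
  "fps_over Z = {A. \<forall>n. fps_nth A n \<in> Z}"

lemma fps_overI: "(\<And>n. fps_nth A n \<in> Z) \<Longrightarrow> A \<in> fps_over Z"
  by (simp add: fps_over_def)

lemma fps_overD: "A \<in> fps_over Z \<Longrightarrow> fps_nth A n \<in> Z"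
  by (simp add: fps_over_def)

lemma fps_over_mono: "Z \<subseteq> Y \<Longrightarrow> fps_over Z \<subseteq> fps_over Y"
  by (auto simp: fps_over_def)

lemma is_subring_fps_over:
  assumes Z: "is_subring Z" shows "is_subring (fps_over Z)"
  unfolding is_subring_def fps_over_def
  by (auto simp: fps_mult_nth Z intro!: subring_1 subring_0 subring_diff subring_sum subring_mult)

lemma fps_const_over: "is_subring Z \<Longrightarrow> c \<in> Z \<Longrightarrow> fps_const c \<in> fps_over Z"
  by (auto simp: fps_over_def intro: subring_0)

lemma fps_X_over: "is_subring Z \<Longrightarrow> fps_X \<in> fps_over Z"
  by (auto simp: fps_over_def fps_X_def intro: subring_0 subring_1)


section \<open>Exponentials of power series\<close>

text \<open>
  The equation \<open>F' = F g\<close> is a recursion for the coefficients of \<open>F\<close>. All identities between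
  exponentials below are obtained by comparing derivatives, which spares a theory of logarithms.
\<close>

lemma logderiv_unique:
  fixes F H :: "'a::{idom, semiring_char_0} fps"
  assumes F: "fps_deriv F = F * g" and H: "fps_deriv H = H * g"
    and 0: "fps_nth F 0 = fps_nth H 0"
  shows "F = H"
proof (rule fps_ext)
  fix n show "fps_nth F n = fps_nth H n"
  proof (induction n rule: less_induct)
    case (less n)
    show ?case
    proof (cases n)
      case (Suc m)
      have "of_nat (Suc m) * fps_nth F (Suc m) = of_nat (Suc m) * fps_nth H (Suc m)"
        using arg_cong[OF F, of "\<lambda>x. fps_nth x m"] arg_cong[OF H, of "\<lambda>x. fps_nth x m"] less.IH
        by (simp add: fps_mult_nth Suc del: of_nat_Suc)
      then show ?thesis unfolding Suc using of_nat_neq_0 mult_left_cancel by blast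
    qed (use 0 in simp)
  qed
qed

lemma exp_series_nth_0: "fps_nth (exp_series G) 0 = 1"
  by (simp add: exp_series_def)

lemma exp_series_deriv:
  assumes "fps_nth G 0 = 0"
  shows "fps_deriv (exp_series G) = exp_series G * fps_deriv G"
proof -
  have "fps_deriv (Abs_fps (\<lambda>m. fps_const (1 / fact m))) = Abs_fps (\<lambda>m. fps_const (1 / fact m :: 'a))"
  proof (rule fps_ext)
    fix n
    have "fps_const (of_nat (Suc n)) * fps_const (1 / fact (Suc n) :: 'a) = fps_const (1 / fact n)"
      unfolding fps_const_mult by (intro arg_cong[of _ _ fps_const]) (simp add: field_simps del: of_nat_Suc)
    then show "fps_nth (fps_deriv (Abs_fps (\<lambda>m. fps_const (1 / fact m)))) n =
        fps_nth (Abs_fps (\<lambda>m. fps_const (1 / fact m :: 'a))) n"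
      by (simp add: fps_of_nat del: of_nat_Suc)
  qed
  then show ?thesis
    unfolding exp_series_def by (subst fps_compose_deriv[OF assms]) simp
qed

lemma exp_series_eqI:
  assumes "fps_nth G 0 = 0" "fps_nth F 0 = 1" "fps_deriv F = F * fps_deriv G"
  shows "exp_series G = F"
  by (rule logderiv_unique[OF exp_series_deriv[OF assms(1)] assms(3)]) (simp add: exp_series_nth_0 assms(2))

lemma exp_series_0: "exp_series 0 = 1"
  by (rule exp_series_eqI) auto

lemma exp_series_add:
  assumes "fps_nth G 0 = 0" "fps_nth H 0 = 0"
  shows "exp_series (G + H) = exp_series G * exp_series H"
  by (rule exp_series_eqI) (simp_all add: assms exp_series_nth_0 exp_series_deriv algebra_simps)

lemma exp_series_sum:
  assumes "\<And>i. i \<in> I \<Longrightarrow> fps_nth (G i) 0 = 0"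
  shows "exp_series (\<Sum>i\<in>I. G i) = (\<Prod>i\<in>I. exp_series (G i))"
  using assms
  by (induction I rule: infinite_finite_induct) (auto simp: exp_series_0 exp_series_add fps_sum_nth)

lemma exp_series_of_nat_mult:
  assumes "fps_nth G 0 = 0"
  shows "exp_series (of_nat m * G) = exp_series G ^ m"
  by (induction m) (simp_all add: exp_series_0 exp_series_add assms algebra_simps fps_mult_nth)

text \<open>
  The recursion for the coefficients of an exponential in \<open>s\<close> consists of sums and products of series in
  \<open>T\<close> and divisions by integers, all of which respect congruences modulo \<open>T ^ h\<close>.
\<close>

lemma exp_series_cong_T:
  fixes G H :: "'a::field_char_0 fps fps"
  assumes G: "fps_nth G 0 = 0" and H: "fps_nth H 0 = 0"
    and eq: "\<And>k j. j < h \<Longrightarrow> fps_nth (fps_nth G k) j = fps_nth (fps_nth H k) j"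
    and "j < h"
  shows "fps_nth (fps_nth (exp_series G) m) j = fps_nth (fps_nth (exp_series H) m) j"
  using \<open>j < h\<close>
proof (induction m arbitrary: j rule: less_induct)
  case (less n)
  show ?case
  proof (cases n)
    case (Suc m)
    have rec: "of_nat (Suc m) * fps_nth (fps_nth (exp_series Q) (Suc m)) j =
        (\<Sum>i=0..m. \<Sum>l=0..j. fps_nth (fps_nth (exp_series Q) i) l *
           (of_nat (Suc (m - i)) * fps_nth (fps_nth Q (Suc (m - i))) (j - l)))"
      if "fps_nth Q 0 = 0" for Q :: "'a fps fps"
    proof -
      have c: "fps_nth (of_nat c * A) l = of_nat c * fps_nth A l" for c l and A :: "'a fps"
        by (simp add: fps_of_nat[symmetric])
      have "of_nat (Suc m) * fps_nth (exp_series Q) (Suc m) =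
          (\<Sum>i=0..m. fps_nth (exp_series Q) i * (of_nat (Suc (m - i)) * fps_nth Q (Suc (m - i))))"
        using arg_cong[OF exp_series_deriv[OF that], of "\<lambda>x. fps_nth x m"]
        by (simp add: fps_mult_nth del: of_nat_Suc)
      from arg_cong[OF this, of "\<lambda>x. fps_nth x j"] show ?thesis
        by (simp only: c fps_sum_nth fps_mult_nth[of "fps_nth (exp_series Q) _"])
    qed
    have "of_nat (Suc m) * fps_nth (fps_nth (exp_series G) (Suc m)) j =
        of_nat (Suc m) * fps_nth (fps_nth (exp_series H) (Suc m)) j"
      unfolding rec[OF G] rec[OF H] using less.prems
      by (intro sum.cong refl arg_cong2[of _ _ _ _ "(*)"] less.IH eq) (auto simp: Suc)
    then show ?thesis unfolding Suc using of_nat_neq_0 mult_left_cancel by blast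
  qed (simp add: exp_series_nth_0)
qed


section \<open>The Artin--Hasse exponential\<close>

text \<open>
  The localization of the integers at \<open>p\<close>, as a subset of any field of characteristic 0. The
  coefficients of the Artin--Hasse series lie in it, and \<open>W(\<F>\<^sub>p)\<close> contains it.
\<close>

definition p_integral :: "nat \<Rightarrow> 'a::field_char_0 set" where
  "p_integral p = {of_int a / of_int b | a b. \<not> int p dvd b}"

lemma p_integralI: "\<not> int p dvd b \<Longrightarrow> of_int a / of_int b \<in> p_integral p"
  by (auto simp: p_integral_def)

lemma is_subring_p_integral:
  assumes "prime p" shows "is_subring (p_integral p :: 'a::field_char_0 set)"
proof -
  have pr: "prime (int p)" using assms by simp
  have "x - y \<in> p_integral p \<and> x * y \<in> p_integral p"
    if "x \<in> p_integral p" "y \<in> p_integral p" for x y :: 'a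
  proof -
    obtain a b c d where b: "\<not> int p dvd b" "\<not> int p dvd d"
      and xy: "x = of_int a / of_int b" "y = of_int c / of_int d"
      using \<open>x \<in> _\<close> \<open>y \<in> _\<close> unfolding p_integral_def by blast
    have bd: "\<not> int p dvd b * d" using b pr by (simp add: prime_dvd_mult_iff)
    have nz: "b \<noteq> 0" "d \<noteq> 0" using b by auto
    have "x - y = of_int (a * d - c * b) / of_int (b * d)" "x * y = of_int (a * c) / of_int (b * d)"
      using nz by (simp_all add: xy field_simps)
    then show ?thesis using p_integralI[OF bd] by metis
  qed
  moreover have "(1::'a) \<in> p_integral p"
    using p_integralI[of p 1 1] prime_gt_1_nat[OF assms] by simp
  ultimately show ?thesis unfolding is_subring_def by blast
qed

text \<open>
  Fermat's little theorem in the local ring follows from the one for integers, since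
  \<open>(a / b) ^ p - a / b = (a ^ p b - a b ^ p) / b ^ (p + 1)\<close>.
\<close>

lemma p_integral_fermat:
  assumes p: "prime p" and x: "x \<in> p_integral p"
  shows "x ^ p - x \<in> (*) (of_nat p) ` (p_integral p :: 'a::field_char_0 set)"
proof -
  obtain a b where b: "\<not> int p dvd b" and x: "x = of_int a / of_int b"
    using x unfolding p_integral_def by blast
  have pr: "prime (int p)" using p by simp
  have fermat: "int p dvd c ^ p - c" for c :: int
  proof -
    have nn: "int p dvd int n ^ p - int n" for n
    proof (induction n)
      case 0 then show ?case using p prime_gt_0_nat by (simp add: power_0_left)
    next
      case (Suc n)
      have "int (Suc n) ^ p - int (Suc n) = ((int n + 1) ^ p - int n ^ p - 1 ^ p) + (int n ^ p - int n)"
        by (simp add: add.commute)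
      then show ?case using freshman_dvd[OF p, of "int n" 1] Suc by (metis dvd_add of_nat_id int_ops(1) of_nat_eq_id)
    qed
    have "(c ^ p - c) mod int p = ((c mod int p) ^ p - (c mod int p)) mod int p"
      by (metis mod_diff_left_eq mod_diff_right_eq power_mod)
    moreover have "c mod int p = int (nat (c mod int p))" using prime_gt_0_nat[OF p] by simp
    ultimately show ?thesis using nn[of "nat (c mod int p)"] by (metis dvd_eq_mod_eq_0)
  qed
  have "int p dvd (a ^ p - a) * b - (b ^ p - b) * a"
    by (intro dvd_diff dvd_mult2 fermat)
  then obtain c where "(a ^ p - a) * b - (b ^ p - b) * a = int p * c" by (rule dvdE)
  then have c: "a ^ p * b - a * b ^ p = int p * c" by (simp add: algebra_simps)
  have nz: "b \<noteq> 0" using b by auto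
  have "\<not> int p dvd b ^ p * b" using b pr by (simp add: prime_dvd_mult_iff prime_dvd_power_iff prime_gt_0_nat[OF p])
  then have "of_int c / of_int (b ^ p * b) \<in> (p_integral p :: 'a set)" by (rule p_integralI)
  moreover have "x ^ p - x = of_nat p * (of_int c / of_int (b ^ p * b))"
  proof -
    have "x ^ p - x = of_int (a ^ p * b - a * b ^ p) / of_int (b ^ p * b)"
      using nz by (simp add: x field_simps)
    then show ?thesis unfolding c by simp
  qed
  ultimately show ?thesis by blast
qed

text \<open>
  Divisibility by \<open>p\<close> is meaningless in a field, so congruences modulo \<open>p\<close> are expressed by the set of
  multiples \<open>p Y\<close> of the elements of a subring \<open>Y\<close>.
\<close>

lemma subring_freshman:
  assumes p: "prime p" and Y: "is_subring Y" and a: "a \<in> Y" and b: "b \<in> Y"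
  shows "(a + b) ^ p - a ^ p - b ^ p \<in> (*) (of_nat p) ` (Y :: 'a::comm_ring_1 set)"
proof -
  have p1: "p > 1" using p by (rule prime_gt_1_nat)
  have split: "{..p} = insert 0 (insert p {1..<p})" using p1 by auto
  have "(a + b) ^ p = b ^ p + (a ^ p + (\<Sum>k\<in>{1..<p}. of_nat (p choose k) * a ^ k * b ^ (p - k)))"
    unfolding binomial_ring split using p1 by simp
  moreover have "of_nat (p choose k) = of_nat p * (of_nat ((p choose k) div p) :: 'a)" if "k \<in> {1..<p}" for k
    using dvd_choose_prime[of k p] that p p1 by (auto simp flip: of_nat_mult)
  ultimately have "(a + b) ^ p - a ^ p - b ^ p =
      of_nat p * (\<Sum>k\<in>{1..<p}. of_nat ((p choose k) div p) * a ^ k * b ^ (p - k))"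
    by (simp add: sum_distrib_left algebra_simps)
  moreover have "(\<Sum>k\<in>{1..<p}. of_nat ((p choose k) div p) * a ^ k * b ^ (p - k)) \<in> Y"
    by (intro subring_sum[OF Y] subring_mult[OF Y] subring_of_nat[OF Y] subring_power[OF Y] a b)
  ultimately show ?thesis by blast
qed

lemma multiples_closed:
  assumes Y: "is_subring (Y :: 'a::comm_ring_1 set)" and c: "c = (of_nat p :: 'a)"
  shows "0 \<in> (*) c ` Y"
    and "x \<in> (*) c ` Y \<Longrightarrow> y \<in> (*) c ` Y \<Longrightarrow> x + y \<in> (*) c ` Y"
    and "x \<in> (*) c ` Y \<Longrightarrow> y \<in> (*) c ` Y \<Longrightarrow> x - y \<in> (*) c ` Y"
    and "x \<in> Y \<Longrightarrow> y \<in> (*) c ` Y \<Longrightarrow> x * y \<in> (*) c ` Y"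
proof -
  show "0 \<in> (*) c ` Y" using subring_0[OF Y] by (auto intro!: image_eqI[of _ _ 0])
  show "x + y \<in> (*) c ` Y" if "x \<in> (*) c ` Y" "y \<in> (*) c ` Y"
    using that subring_add[OF Y] by (auto simp flip: distrib_left)
  show "x - y \<in> (*) c ` Y" if "x \<in> (*) c ` Y" "y \<in> (*) c ` Y"
    using that subring_diff[OF Y] by (auto simp flip: right_diff_distrib)
  show "x * y \<in> (*) c ` Y" if "x \<in> Y" "y \<in> (*) c ` Y"
    using that subring_mult[OF Y] by (auto simp: mult.left_commute[of x])
qed

lemma multiples_sum:
  assumes Y: "is_subring (Y :: 'a::comm_ring_1 set)"
    and "\<And>i. i \<in> A \<Longrightarrow> f i \<in> (*) (of_nat p) ` Y"
  shows "sum f A \<in> (*) (of_nat p) ` Y"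
  using assms(2) by (induction A rule: infinite_finite_induct) (auto intro: multiples_closed[OF Y refl])

lemma multiples_nth: "A \<in> (*) (of_nat p) ` fps_over Z \<Longrightarrow> fps_nth A n \<in> (*) (of_nat p) ` Z"
  by (auto simp: fps_over_def simp flip: fps_of_nat)

text \<open>
  The congruence \<open>F(X) ^ p \<equiv> F(X ^ p)\<close> modulo \<open>p\<close>, one monomial at a time: the freshman's dream separates
  the new monomial, and Fermat's theorem treats its coefficient.
\<close>

lemma frobenius_lift_cong:
  fixes a :: "nat \<Rightarrow> 'a::field_char_0"
  assumes p: "prime p" and a: "\<And>i. i < n \<Longrightarrow> a i \<in> p_integral p"
  shows "(\<Sum>i<n. fps_const (a i) * fps_X ^ i) ^ p - (\<Sum>i<n. fps_const (a i) * fps_X ^ (p * i))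
           \<in> (*) (of_nat p) ` fps_over (p_integral p)"
  using a
proof (induction n)
  case 0
  then show ?case
    using multiples_closed(1)[OF is_subring_fps_over[OF is_subring_p_integral[OF p]] refl] prime_gt_0_nat[OF p]
    by (simp add: power_0_left)
next
  case (Suc n)
  note Z = is_subring_p_integral[OF p, where 'a = 'a]
  note Y = is_subring_fps_over[OF Z]
  let ?P = "\<Sum>i<n. fps_const (a i) * fps_X ^ i" and ?Q = "\<Sum>i<n. fps_const (a i) * fps_X ^ (p * i)"
  let ?M = "(*) (of_nat p) ` fps_over (p_integral p) :: 'a fps set"
  have P: "?P \<in> fps_over (p_integral p)"
    using Suc.prems by (intro subring_sum[OF Y] subring_mult[OF Y] subring_power[OF Y] fps_const_over[OF Z] fps_X_over[OF Z]) auto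
  have t: "fps_const (a n) * fps_X ^ n \<in> fps_over (p_integral p)"
    using Suc.prems by (intro subring_mult[OF Y] subring_power[OF Y] fps_const_over[OF Z] fps_X_over[OF Z]) auto
  obtain z where z: "z \<in> p_integral p" "a n ^ p - a n = of_nat p * z"
    using p_integral_fermat[OF p Suc.prems[of n]] by auto
  have "(fps_const (a n) * fps_X ^ n) ^ p - fps_const (a n) * fps_X ^ (p * n) =
      fps_const (a n ^ p - a n) * fps_X ^ (p * n)"
    by (simp add: power_mult_distrib fps_const_power algebra_simps flip: power_mult fps_const_sub)
  also have "\<dots> = of_nat p * (fps_const z * fps_X ^ (p * n))"
    unfolding z(2) by (simp add: mult.assoc flip: fps_const_mult fps_of_nat)
  also have "\<dots> \<in> ?M"
    by (intro imageI subring_mult[OF Y] subring_power[OF Y] fps_const_over[OF Z] fps_X_over[OF Z] z)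
  finally have t': "(fps_const (a n) * fps_X ^ n) ^ p - fps_const (a n) * fps_X ^ (p * n) \<in> ?M" .
  have IH: "?P ^ p - ?Q \<in> ?M" by (rule Suc.IH) (use Suc.prems in auto)
  have "((?P + fps_const (a n) * fps_X ^ n) ^ p - ?P ^ p - (fps_const (a n) * fps_X ^ n) ^ p)
       + ((?P ^ p - ?Q) + ((fps_const (a n) * fps_X ^ n) ^ p - fps_const (a n) * fps_X ^ (p * n))) \<in> ?M"
    by (intro multiples_closed(2)[OF Y refl] subring_freshman[OF p Y] P t t' IH)
  then show ?case by (simp add: algebra_simps)
qed

lemma fps_nth_compose_fps_X_power:
  fixes F :: "'a::comm_ring_1 fps" assumes "p > 0"
  shows "fps_nth (F oo fps_X ^ p) n = (if p dvd n then fps_nth F (n div p) else 0)"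
proof -
  have "fps_nth (F oo fps_X ^ p) n = (\<Sum>i=0..n. if n = p * i then fps_nth F i else 0)"
    unfolding fps_compose_nth power_mult[symmetric] by (intro sum.cong) (auto simp: fps_X_power_iff)
  also have "\<dots> = (if p dvd n then fps_nth F (n div p) else 0)"
    using assms by (auto simp: sum.delta' elim!: dvdE intro!: sum.neutral)
  finally show ?thesis .
qed

text \<open>
  Dwork's lemma. The coefficient \<open>F\<^sub>n\<close> enters the coefficient of \<open>X ^ n\<close> in \<open>F ^ p\<close> only as \<open>p F\<^sub>n\<close>. On the
  right-hand side only \<open>F\<^sub>m\<close> with \<open>m < n\<close> occur, because \<open>n div p < n\<close>. What remains is divisible by \<open>p\<close>
  by \<open>frobenius_lift_cong\<close>, applied to the part \<open>P\<close> of \<open>F\<close> below degree \<open>n\<close>.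
\<close>

lemma dwork_integrality:
  fixes F :: "'a::field_char_0 fps"
  assumes p: "prime p" and F0: "fps_nth F 0 = 1"
    and eq: "F ^ p = (F oo fps_X ^ p) * (1 + H)"
    and H: "H \<in> (*) (of_nat p) ` fps_over (p_integral p)" and H0: "fps_nth H 0 = 0"
  shows "F \<in> fps_over (p_integral p)"
proof (rule fps_overI)
  note Z = is_subring_p_integral[OF p, where 'a = 'a]
  note Y = is_subring_fps_over[OF Z]
  have p0: "p > 0" "p > 1" using p prime_gt_0_nat prime_gt_1_nat by auto
  fix n show "fps_nth F n \<in> p_integral p"
  proof (induction n rule: less_induct)
    case (less n)
    show ?case
    proof (cases "n = 0")
      case False
      then have n: "n > 0" by simp
      let ?M = "(*) (of_nat p) ` p_integral p :: 'a set"
      define P where "P = (\<Sum>i<n. fps_const (fps_nth F i) * fps_X ^ i)"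
      have P_nth: "fps_nth P m = (if m < n then fps_nth F m else 0)" for m
        by (simp add: P_def fps_sum_nth fps_X_power_iff if_distrib sum.delta' cong: if_cong)
      have Pp: "P oo fps_X ^ p = (\<Sum>i<n. fps_const (fps_nth F i) * fps_X ^ (p * i))"
        unfolding P_def using p0
        by (simp add: fps_compose_sum_distrib fps_compose_mult_distrib fps_compose_power[symmetric] power_mult)
      have "P ^ p - (P oo fps_X ^ p) \<in> (*) (of_nat p) ` fps_over (p_integral p)"
        unfolding Pp unfolding P_def by (rule frobenius_lift_cong[OF p less.IH])
      then have A: "fps_nth (P ^ p) n - fps_nth (P oo fps_X ^ p) n \<in> ?M"
        using multiples_nth[of "P ^ p - (P oo fps_X ^ p)" p "p_integral p" n] by simp
      \<comment> \<open>\<open>F - P\<close> starts in degree \<open>n\<close>, and the cofactor in \<open>F ^ p - P ^ p\<close> has the constant term \<open>p\<close>.\<close>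
      have B: "fps_nth (F ^ p) n - fps_nth (P ^ p) n = of_nat p * fps_nth F n"
      proof -
        let ?Q = "\<Sum>i<p. P ^ (p - Suc i) * F ^ i"
        have "fps_nth (F ^ p - P ^ p) n = (\<Sum>i=0..n. fps_nth (F - P) i * fps_nth ?Q (n - i))"
          by (simp only: power_diff_sumr2 fps_mult_nth)
        also have "\<dots> = fps_nth (F - P) n * fps_nth ?Q 0"
          by (subst sum.remove[of _ n]) (auto simp: P_nth intro!: sum.neutral)
        also have "\<dots> = fps_nth F n * of_nat p"
          using n by (simp add: P_nth fps_sum_nth fps_power_zeroth F0)
        finally show ?thesis by (simp add: mult.commute)
      qed
      have div: "m div p < n" if "m \<le> n" for m
        using that n p0(2) by (cases "m = 0") (auto intro: order.strict_trans2[OF div_less_dividend])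
      have small: "fps_nth (F oo fps_X ^ p) m = fps_nth (P oo fps_X ^ p) m" if "m \<le> n" for m
        using div[OF that] by (simp add: fps_nth_compose_fps_X_power[OF p0(1)] P_nth)
      have C: "fps_nth (F ^ p) n - fps_nth (P oo fps_X ^ p) n \<in> ?M"
      proof -
        have "fps_nth (F ^ p) n = fps_nth (F oo fps_X ^ p) n + (\<Sum>i=0..n. fps_nth (F oo fps_X ^ p) i * fps_nth H (n - i))"
          unfolding eq by (simp add: distrib_left fps_mult_nth)
        moreover have "(\<Sum>i=0..n. fps_nth (F oo fps_X ^ p) i * fps_nth H (n - i)) \<in> ?M"
        proof (intro multiples_sum[OF Z] multiples_closed(4)[OF Z refl] multiples_nth[OF H])
          fix i assume "i \<in> {0..n}"
          then show "fps_nth (F oo fps_X ^ p) i \<in> p_integral p"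
            using less.IH[OF div[of i]] subring_0[OF Z] by (simp add: fps_nth_compose_fps_X_power[OF p0(1)])
        qed
        ultimately show ?thesis by (simp add: small)
      qed
      have "fps_nth (F ^ p) n - fps_nth (P oo fps_X ^ p) n - (fps_nth (P ^ p) n - fps_nth (P oo fps_X ^ p) n) \<in> ?M"
        by (rule multiples_closed(3)[OF Z refl C A])
      then have "of_nat p * fps_nth F n \<in> ?M" using B by simp
      then show ?thesis using p0 by auto
    qed (simp add: F0 subring_1[OF Z])
  qed
qed

text \<open>
  The factors of \<open>(p m)!\<close> that are divisible by \<open>p\<close> are \<open>p, 2 p, \<dots>, m p\<close>. This gives the bound
  \<open>n - 1\<close> for the exponent of \<open>p\<close> in \<open>n!\<close> by induction, and with it the \<open>p\<close>-divisibility of the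
  coefficients of \<open>exp (p X) - 1\<close>.
\<close>

lemma fact_mult_prime:
  fixes p m :: nat
  assumes p: "prime p"
  shows "\<exists>b. \<not> p dvd b \<and> fact (p * m) = p ^ m * fact m * b"
proof (induction m)
  case 0 then show ?case using p by (intro exI[of _ 1]) (auto simp: not_prime_unit)
next
  case (Suc m)
  then obtain b where b: "\<not> p dvd b" "fact (p * m) = p ^ m * fact m * b" by blast
  have pos: "p > 0" using p prime_gt_0_nat by simp
  have "fact (p * m + r) = fact (p * m) * (\<Prod>i=1..r. p * m + i)" for r
    by (induction r) (simp_all add: algebra_simps)
  from this[of "p - 1"] have f: "fact (p * m + (p - 1)) = fact (p * m) * (\<Prod>i=1..p-1. p * m + i)" .
  have "\<not> p dvd (\<Prod>i=1..p-1. p * m + i)"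
  proof
    assume "p dvd (\<Prod>i=1..p-1. p * m + i)"
    then obtain i where "i \<in> {1..p-1}" "p dvd p * m + i"
      using p by (auto simp: prime_dvd_prod_iff)
    then show False using pos by (auto dest!: dvd_imp_le simp: dvd_add_right_iff)
  qed
  then have nd: "\<not> p dvd b * (\<Prod>i=1..p-1. p * m + i)" using b p by (simp add: prime_dvd_mult_iff)
  have "p * Suc m = Suc (p * m + (p - 1))" using pos by simp
  then have "fact (p * Suc m) = (p * Suc m) * fact (p * m + (p - 1))"
    by (metis fact_Suc of_nat_id)
  also have "\<dots> = p ^ Suc m * fact (Suc m) * (b * (\<Prod>i=1..p-1. p * m + i))"
    unfolding f b(2) by (simp add: algebra_simps)
  finally show ?case using nd by blast
qed

lemma fact_prime_part:
  fixes p n :: nat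
  assumes p: "prime p" and "n > 0"
  shows "\<exists>e b. e < n \<and> \<not> p dvd b \<and> fact n = p ^ e * b"
  using \<open>n > 0\<close>
proof (induction n rule: less_induct)
  case (less n)
  have p1: "p > 1" using p prime_gt_1_nat by simp
  show ?case
  proof (cases "p dvd n")
    case True
    then obtain m where m: "n = p * m" by (rule dvdE)
    then have m0: "m > 0" "m < n" using less.prems p1 by auto
    obtain e b where eb: "e < m" "\<not> p dvd b" "fact m = p ^ e * b" using less.IH[OF m0(2,1)] by blast
    obtain c where c: "\<not> p dvd c" "fact (p * m) = p ^ m * fact m * c" using fact_mult_prime[OF p] by blast
    have "fact n = p ^ (m + e) * (b * c)" unfolding m c(2) eb(3) by (simp add: power_add algebra_simps)
    moreover have "\<not> p dvd b * c" using eb c p by (simp add: prime_dvd_mult_iff)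
    moreover have "m + e < n"
    proof -
      have "m * 2 \<le> m * p" using p1 by (intro mult_le_mono2) simp
      then have "m * 2 \<le> n" using m by (simp add: mult.commute)
      then show ?thesis using eb(1) by linarith
    qed
    ultimately show ?thesis by blast
  next
    case False
    obtain m where m: "n = Suc m" using less.prems gr0_implies_Suc by blast
    show ?thesis
    proof (cases "m = 0")
      case True
      then show ?thesis using m p by (intro exI[of _ 0] exI[of _ 1]) (auto simp: not_prime_unit)
    next
      case False
      then obtain e b where eb: "e < m" "\<not> p dvd b" "fact m = p ^ e * b" using less.IH[of m] m by blast
      have "fact n = p ^ e * (n * b)" unfolding m fact_Suc eb(3) by (simp add: algebra_simps)
      moreover have "\<not> p dvd n * b" using eb \<open>\<not> p dvd n\<close> p by (simp add: prime_dvd_mult_iff)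
      ultimately show ?thesis using eb(1) m by (intro exI[of _ e] exI[of _ "n * b"]) auto
    qed
  qed
qed

lemma p_power_div_fact:
  assumes p: "prime p" and n: "n > 0"
  shows "of_nat p ^ n / fact n \<in> (*) (of_nat p) ` (p_integral p :: 'a::field_char_0 set)"
proof -
  obtain e b where eb: "e < n" "\<not> p dvd b" "fact n = p ^ e * b" using fact_prime_part[OF p n] by blast
  have p0: "p \<noteq> 0" and b0: "b \<noteq> 0" using p eb(2) by (auto intro: Nat.gr0I)
  have "fact n = (of_nat (fact n) :: 'a)" by simp
  then have f: "fact n = (of_nat p ^ e * of_nat b :: 'a)" unfolding eb(3) by simp
  have n': "n = Suc (n - Suc e) + e" using eb(1) by simp
  have "of_nat p ^ n / fact n = of_nat p * (of_int (int p ^ (n - Suc e)) / (of_int (int b) :: 'a))"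
    unfolding f by (subst n', subst power_add) (use p0 b0 in \<open>simp add: field_simps\<close>)
  moreover have "of_int (int p ^ (n - Suc e)) / of_int (int b) \<in> (p_integral p :: 'a set)"
    using eb(2) by (intro p_integralI) simp
  ultimately show ?thesis by blast
qed

text \<open>
  The exponential over a field of coefficients; \<open>exp_series\<close> is the one over a ring of power series.
\<close>

definition fps_exp_of :: "'a::field_char_0 fps \<Rightarrow> 'a fps" where
  "fps_exp_of g = fps_exp 1 oo g"

lemma fps_exp_of_nth_0: "fps_nth (fps_exp_of g) 0 = 1"
  by (simp add: fps_exp_of_def)

lemma fps_exp_of_deriv: "fps_nth g 0 = 0 \<Longrightarrow> fps_deriv (fps_exp_of g) = fps_exp_of g * fps_deriv g"
  by (simp add: fps_exp_of_def fps_compose_deriv)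

lemma fps_exp_of_0: "fps_exp_of 0 = 1"
  by (simp add: fps_exp_of_def)

lemma fps_exp_of_add:
  assumes "fps_nth g 0 = 0" "fps_nth h 0 = 0"
  shows "fps_exp_of (g + h) = fps_exp_of g * fps_exp_of h"
  by (rule logderiv_unique[of _ "fps_deriv (g + h)"])
     (simp_all add: assms fps_exp_of_deriv fps_exp_of_nth_0 algebra_simps)

lemma fps_exp_of_sum:
  assumes "\<And>i. i \<in> I \<Longrightarrow> fps_nth (g i) 0 = 0"
  shows "fps_exp_of (\<Sum>i\<in>I. g i) = (\<Prod>i\<in>I. fps_exp_of (g i))"
  using assms
  by (induction I rule: infinite_finite_induct) (auto simp: fps_exp_of_0 fps_exp_of_add fps_sum_nth)

lemma fps_exp_of_compose:
  assumes "fps_nth g 0 = 0" "fps_nth h 0 = 0"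
  shows "fps_exp_of g oo h = fps_exp_of (g oo h)"
  unfolding fps_exp_of_def by (rule fps_compose_assoc[symmetric]) (use assms in auto)

text \<open>
  The series \<open>X + X ^ p / p + X ^ (p ^ 2) / p ^ 2 + \<dots>\<close>, the logarithm of the Artin--Hasse exponential.
\<close>

definition ah_log :: "nat \<Rightarrow> 'a::field_char_0 fps" where
  "ah_log p = Abs_fps (\<lambda>n. if \<exists>i. n = p ^ i then 1 / of_nat n else 0)"

definition artin_hasse :: "nat \<Rightarrow> 'a::field_char_0 fps" where
  "artin_hasse p = fps_exp_of (ah_log p)"

lemma ah_log_0: "p > 0 \<Longrightarrow> fps_nth (ah_log p) 0 = 0"
  by (auto simp: ah_log_def)

lemma artin_hasse_nth_0: "fps_nth (artin_hasse p) 0 = 1"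
  by (simp add: artin_hasse_def fps_exp_of_nth_0)

lemma artin_hasse_nth_1:
  assumes "p > 0" shows "fps_nth (artin_hasse p) 1 = (1 :: 'a::field_char_0)"
proof -
  have "\<exists>i. Suc 0 = p ^ i" by (rule exI[of _ 0]) simp
  then have "fps_nth (ah_log p) (Suc 0) = (1 :: 'a)" by (simp add: ah_log_def)
  then show ?thesis
    using arg_cong[OF fps_exp_of_deriv[OF ah_log_0[OF assms, where 'a = 'a]], of "\<lambda>f. fps_nth f 0"]
    by (simp add: artin_hasse_def fps_exp_of_nth_0)
qed

lemma ah_log_functional_eq:
  assumes p: "prime p"
  shows "of_nat p * ah_log p = (ah_log p oo fps_X ^ p) + fps_const (of_nat p) * (fps_X :: 'a::field_char_0 fps)"
proof (rule fps_ext)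
  fix n
  have p0: "p > 0" "p > 1" using p prime_gt_0_nat prime_gt_1_nat by auto
  have pw: "(\<exists>i. n = p ^ i) \<longleftrightarrow> n = 1 \<or> (p dvd n \<and> (\<exists>i. n div p = p ^ i))"
  proof
    assume "\<exists>i. n = p ^ i"
    then obtain i where i: "n = p ^ i" by blast
    show "n = 1 \<or> (p dvd n \<and> (\<exists>i. n div p = p ^ i))"
      by (cases i) (use p0 i in auto)
  next
    assume "n = 1 \<or> (p dvd n \<and> (\<exists>i. n div p = p ^ i))"
    then show "\<exists>i. n = p ^ i"
      by (metis dvd_mult_div_cancel power_0 power_Suc)
  qed
  show "fps_nth (of_nat p * ah_log p) n =
      fps_nth ((ah_log p oo fps_X ^ p) + fps_const (of_nat p) * (fps_X :: 'a fps)) n"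
  proof (cases "n = 1")
    case True
    then show ?thesis using p0
      by (auto simp: fps_nth_compose_fps_X_power ah_log_def fps_of_nat[symmetric] intro: exI[of _ 0])
  next
    case False
    have "of_nat p / of_nat n = 1 / (of_nat (n div p) :: 'a)" if "p dvd n" "n \<noteq> 0"
      using that p0 by (auto elim!: dvdE simp: field_simps)
    moreover have "\<nexists>i. 0 = p ^ i" using p0 by simp
    ultimately show ?thesis using p0 pw False
      by (cases "p dvd n"; cases "n = 0")
         (auto simp: fps_nth_compose_fps_X_power ah_log_def fps_of_nat[symmetric] simp del: of_nat_power)
  qed
qed

text \<open>
  The functional equation of the logarithm gives \<open>E(X) ^ p = E(X ^ p) exp (p X)\<close>, to which Dwork's lemma
  applies.
\<close>

theorem artin_hasse_integral:
  assumes p: "prime p" shows "(artin_hasse p :: 'a::field_char_0 fps) \<in> fps_over (p_integral p)"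
proof -
  have p0: "p > 0" using p prime_gt_0_nat by auto
  define H where "H = fps_exp_of (fps_const (of_nat p) * fps_X) - (1 :: 'a fps)"
  have nth: "fps_nth (fps_exp_of (fps_const (of_nat p) * fps_X)) n = of_nat p ^ n / (fact n :: 'a)" for n
    by (simp add: fps_exp_of_def fps_nth_compose_linear)
  show ?thesis
  proof (rule dwork_integrality[OF p artin_hasse_nth_0])
    have "artin_hasse p ^ p = fps_exp_of (of_nat p * ah_log p :: 'a fps)"
      using fps_exp_of_sum[of "{..<p}" "\<lambda>_. ah_log p :: 'a fps"] ah_log_0[OF p0, where 'a = 'a]
      by (simp add: artin_hasse_def)
    also have "\<dots> = fps_exp_of (ah_log p oo fps_X ^ p) * fps_exp_of (fps_const (of_nat p) * fps_X)"
      unfolding ah_log_functional_eq[OF p] by (rule fps_exp_of_add) (simp_all add: ah_log_0[OF p0])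
    also have "fps_exp_of (ah_log p oo fps_X ^ p) = (artin_hasse p oo fps_X ^ p :: 'a fps)"
      unfolding artin_hasse_def by (rule fps_exp_of_compose[symmetric]) (use p0 in \<open>auto simp: ah_log_0\<close>)
    finally show "artin_hasse p ^ p = (artin_hasse p oo fps_X ^ p) * (1 + H)" by (simp add: H_def)
    show "fps_nth H 0 = 0" by (simp add: H_def nth)
    have "\<exists>z. z \<in> p_integral p \<and> fps_nth H n = of_nat p * z" for n
      using p_power_div_fact[OF p, of n, where 'a = 'a] subring_0[OF is_subring_p_integral[OF p, where 'a = 'a]]
      by (cases "n = 0") (auto simp: H_def nth intro: exI[of _ 0])
    then obtain z where z: "\<And>n. z n \<in> p_integral p" "\<And>n. fps_nth H n = of_nat p * z n" by metis
    have "H = of_nat p * Abs_fps z" by (rule fps_ext) (simp add: z(2) flip: fps_of_nat)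
    moreover have "Abs_fps z \<in> fps_over (p_integral p)" by (simp add: fps_over_def z(1))
    ultimately show "H \<in> (*) (of_nat p) ` fps_over (p_integral p)" by blast
  qed
qed

text \<open>
  The coefficient of \<open>X ^ n\<close> in \<open>A(g)\<close> is \<open>g\<^sub>n\<close> plus an integral expression in the \<open>g\<^sub>j\<close> with \<open>j < n\<close>,
  because \<open>g ^ i\<close> for \<open>i \<ge> 2\<close> involves no later coefficient up to degree \<open>n\<close>.
\<close>

lemma compositional_inverse_over:
  assumes Z: "is_subring Z" and A: "A \<in> fps_over Z" "fps_nth A 1 = 1"
    and g: "fps_nth g 0 = 0" "A oo g = fps_X"
  shows "g \<in> fps_over Z"
proof (rule fps_overI)
  fix n show "fps_nth g n \<in> Z"
  proof (induction n rule: less_induct)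
    case (less n)
    \<comment> \<open>A coefficient of \<open>g ^ (i + 1)\<close> in degree below \<open>n + i\<close> only involves the \<open>g\<^sub>j\<close> with \<open>j < n\<close>, as each factor has degree at least 1.\<close>
    have pow: "fps_nth (g ^ Suc i) m \<in> Z" if "m < n + i" for i m
      using that
    proof (induction i arbitrary: m)
      case 0 then show ?case using less.IH by simp
    next
      case (Suc i)
      have "fps_nth g j * fps_nth (g ^ Suc i) (m - j) \<in> Z" if "j \<in> {0..m}" for j
      proof -
        consider "j = 0" | "0 < j" "j < n" | "n \<le> j" by linarith
        then show ?thesis
        proof cases
          case 2 then show ?thesis using Suc.prems that by (intro subring_mult[OF Z] less.IH Suc.IH) auto
        next
          case 3
          then have "m - j < Suc i" using Suc.prems by linarith
          then have "fps_nth (g ^ Suc i) (m - j) = 0" using startsby_zero_power_prefix[OF g(1)] by blast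
          then show ?thesis by (simp add: subring_0[OF Z])
        qed (simp add: g subring_0[OF Z])
      qed
      then show ?case unfolding power_Suc[of g "Suc i"] fps_mult_nth by (intro subring_sum[OF Z]) auto
    qed
    have "fps_nth (g ^ i) n \<in> Z" if "i \<noteq> 1" for i
    proof -
      have "i = 0 \<or> i = Suc (Suc (i - 2))" using that by arith
      then consider "i = 0" | k where "i = Suc (Suc k)" by blast
      then show ?thesis
      proof cases
        case 2
        then show ?thesis using pow[of n "Suc k"] by simp
      qed (simp add: subring_0[OF Z] subring_1[OF Z])
    qed
    then have r: "(\<Sum>i\<in>{0..n} - {1}. fps_nth A i * fps_nth (g ^ i) n) \<in> Z"
      by (intro subring_sum[OF Z] subring_mult[OF Z] fps_overD[OF A(1)]) auto
    show ?case
    proof (cases "n = 0")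
      case False
      have "fps_nth fps_X n = (\<Sum>i\<in>{0..n}. fps_nth A i * fps_nth (g ^ i) n)"
        by (simp flip: g(2) add: fps_compose_nth)
      also have "\<dots> = fps_nth g n + (\<Sum>i\<in>{0..n} - {1}. fps_nth A i * fps_nth (g ^ i) n)"
        using False by (subst sum.remove[of _ 1]) (auto simp: A(2)[simplified])
      finally have "fps_nth g n = fps_nth fps_X n - (\<Sum>i\<in>{0..n} - {1}. fps_nth A i * fps_nth (g ^ i) n)"
        by simp
      then show ?thesis using subring_diff[OF Z fps_overD[OF fps_X_over[OF Z]] r] by simp
    qed (simp add: g subring_0[OF Z])
  qed
qed

text \<open>
  The series \<open>\<pi>(T)\<close> with \<open>E(\<pi>(T)) = 1 + T\<close>.
\<close>

definition ah_param :: "nat \<Rightarrow> 'a::field_char_0 fps" where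
  "ah_param p = fps_inv (artin_hasse p - 1)"

lemma ah_param_0: "fps_nth (ah_param p) 0 = 0"
  by (simp add: ah_param_def fps_inv_def)

lemma artin_hasse_ah_param:
  assumes "p > 0" shows "artin_hasse p oo ah_param p = 1 + (fps_X :: 'a::field_char_0 fps)"
proof -
  have "(artin_hasse p - 1) oo ah_param p = (fps_X :: 'a fps)"
    unfolding ah_param_def using artin_hasse_nth_1[OF assms, where 'a = 'a]
    by (intro fps_inv_right) (auto simp: artin_hasse_nth_0)
  then show ?thesis by (simp add: fps_compose_sub_distrib algebra_simps)
qed

lemma ah_param_integral:
  assumes p: "prime p" shows "(ah_param p :: 'a::field_char_0 fps) \<in> fps_over (p_integral p)"
proof (rule compositional_inverse_over)
  note Z = is_subring_p_integral[OF p, where 'a = 'a]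
  have p0: "p > 0" using p prime_gt_0_nat by auto
  show "is_subring (p_integral p :: 'a set)" by (rule Z)
  show "(artin_hasse p - 1 :: 'a fps) \<in> fps_over (p_integral p)"
    by (intro subring_diff[OF is_subring_fps_over[OF Z]] subring_1[OF is_subring_fps_over[OF Z]] artin_hasse_integral p)
  show "fps_nth (artin_hasse p - 1 :: 'a fps) 1 = 1" using artin_hasse_nth_1[OF p0, where 'a = 'a] by simp
  show "(artin_hasse p - 1 :: 'a fps) oo ah_param p = fps_X"
    using artin_hasse_ah_param[OF p0, where 'a = 'a] by (simp add: fps_compose_sub_distrib)
qed (rule ah_param_0)

lemma sum_frobenius_orbit:
  fixes y :: "'a::comm_ring_1"
  assumes "y ^ (p ^ m) = y"
  shows "(\<Sum>j<m. (y ^ (p ^ j)) ^ (p ^ i)) = (\<Sum>j<m. y ^ (p ^ j))"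
proof (induction i)
  case (Suc i)
  have "(\<Sum>j<m. (y ^ (p ^ j)) ^ (p ^ Suc i)) = (\<Sum>j<m. (y ^ (p ^ Suc j)) ^ (p ^ i))"
    by (intro sum.cong refl) (simp only: power_mult[symmetric] power_Suc mult_ac)
  also have "\<dots> = (\<Sum>j<Suc m. (y ^ (p ^ j)) ^ (p ^ i)) - y ^ (p ^ i)"
    by (subst sum.lessThan_Suc_shift) simp
  also have "\<dots> = (\<Sum>j<m. (y ^ (p ^ j)) ^ (p ^ i))" using assms by simp
  finally show ?case using Suc by simp
qed simp

text \<open>
  The logarithm of the left-hand side is \<open>\<Sum>i. \<pi> ^ p ^ i / p ^ i * (\<Sum>j<m. (y ^ p ^ j) ^ p ^ i)\<close>. The inner
  sums all equal \<open>t = \<Sum>j<m. y ^ p ^ j\<close>, since \<open>z \<mapsto> z ^ p\<close> permutes the powers \<open>y ^ p ^ j\<close>. So the product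
  is \<open>exp (t L)\<close> with \<open>exp L = E(\<pi>) = 1 + T\<close>.
\<close>

theorem prod_artin_hasse:
  fixes y :: "'a::field_char_0"
  assumes p0: "p > 0" and y: "y ^ (p ^ m) = y"
  shows "(\<Prod>j<m. artin_hasse p oo (fps_const (y ^ (p ^ j)) * ah_param p)) = fps_binomial (\<Sum>j<m. y ^ (p ^ j))"
proof -
  let ?t = "\<Sum>j<m. y ^ (p ^ j)" and ?c = "\<lambda>j. fps_const (y ^ (p ^ j))" and ?g = "ah_param p :: 'a fps"
  define L where "L = ah_log p oo ?g"
  have L0: "fps_nth L 0 = 0" by (simp add: L_def ah_log_0[OF p0])
  have scale: "(?c j * fps_X) oo ?g = ?c j * ?g" for j
    by (simp add: fps_compose_mult_distrib ah_param_0)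
  have s: "(\<Sum>j<m. ah_log p oo (?c j * fps_X)) = fps_const ?t * ah_log p"
  proof (rule fps_ext)
    fix n
    have "(\<Sum>j<m. (y ^ (p ^ j)) ^ n) = ?t" if "\<exists>i. n = p ^ i"
      using that sum_frobenius_orbit[OF y] by blast
    then show "fps_nth (\<Sum>j<m. ah_log p oo (?c j * fps_X)) n = fps_nth (fps_const ?t * ah_log p) n"
      by (auto simp: fps_sum_nth fps_nth_compose_linear ah_log_def simp flip: sum_distrib_right sum_divide_distrib)
  qed
  have "(\<Sum>j<m. ah_log p oo (?c j * ?g)) = (\<Sum>j<m. ah_log p oo (?c j * fps_X)) oo ?g"
    unfolding fps_compose_sum_distrib scale[symmetric]
    by (intro sum.cong refl fps_compose_assoc) (auto simp: ah_param_0)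
  also have "\<dots> = fps_const ?t * L"
    unfolding s L_def by (simp add: fps_compose_mult_distrib ah_param_0)
  finally have sum: "(\<Sum>j<m. ah_log p oo (?c j * ?g)) = fps_const ?t * L" .
  have "(\<Prod>j<m. artin_hasse p oo (?c j * ?g)) = (\<Prod>j<m. fps_exp_of (ah_log p oo (?c j * ?g)))"
    unfolding artin_hasse_def by (intro prod.cong refl fps_exp_of_compose) (auto simp: ah_param_0 ah_log_0[OF p0])
  also have "\<dots> = fps_exp_of (fps_const ?t * L)"
    unfolding sum[symmetric] by (rule fps_exp_of_sum[symmetric]) (simp add: ah_log_0[OF p0])
  also have "\<dots> = fps_binomial ?t"
  proof (rule logderiv_unique)
    show "fps_deriv (fps_exp_of (fps_const ?t * L)) = fps_exp_of (fps_const ?t * L) * (fps_const ?t * fps_deriv L)"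
      by (subst fps_exp_of_deriv) (simp_all add: L0)
    have "fps_exp_of L = 1 + fps_X"
      unfolding L_def using artin_hasse_ah_param[OF p0, where 'a = 'a]
      by (simp add: artin_hasse_def fps_exp_of_compose ah_param_0 ah_log_0[OF p0])
    from arg_cong[OF this, of fps_deriv] have "(1 + fps_X) * fps_deriv L = 1"
      by (subst (asm) fps_exp_of_deriv[OF L0]) (simp add: \<open>fps_exp_of L = 1 + fps_X\<close>)
    \<comment> \<open>So \<open>L\<close> has the derivative \<open>1 / (1 + T)\<close> of the logarithm of \<open>1 + T\<close>.\<close>
    then have inv: "x * fps_deriv L * (1 + fps_X) = x" for x
      by (simp add: mult.assoc mult.commute[of "fps_deriv L"])
    have nz: "(1 + fps_X :: 'a fps) \<noteq> 0"
      using \<open>(1 + fps_X) * fps_deriv L = 1\<close> by (auto simp del: fps_add_nth)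
    have dv: "x / (1 + fps_X) = x * fps_deriv L" for x
      using nonzero_mult_div_cancel_right[OF nz, of "x * fps_deriv L"] unfolding inv .
    show "fps_deriv (fps_binomial ?t) = fps_binomial ?t * (fps_const ?t * fps_deriv L)"
      by (simp add: fps_binomial_deriv dv mult_ac)
  qed (simp add: fps_exp_of_nth_0)
  finally show ?thesis .
qed

lemma fps_compose_truncate:
  assumes "fps_nth g 0 = 0" "j < h"
  shows "fps_nth (A oo g) j = fps_nth (\<Sum>i<h. fps_const (fps_nth A i) * g ^ i) j"
proof -
  have "fps_nth (A oo g) j = (\<Sum>i\<in>{0..j}. fps_nth A i * fps_nth (g ^ i) j)" by (rule fps_compose_nth)
  also have "\<dots> = (\<Sum>i<h. fps_nth A i * fps_nth (g ^ i) j)"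
    using assms startsby_zero_power_prefix[OF assms(1)]
    by (intro sum.mono_neutral_left) auto
  finally show ?thesis by (simp add: fps_sum_nth)
qed


section \<open>Units and roots of unity in Witt vector rings\<close>

lemma witt_eqI: "(\<And>n. witt_nth x n = witt_nth y n) \<Longrightarrow> x = y"
  by (simp add: witt_nth_inject[symmetric] fun_eq_iff)

lemma witt_nth_Abs [simp]: "witt_nth (Abs_witt f) = f"
  by (simp add: Abs_witt_inverse)

text \<open>
  Adding a Witt vector \<open>z\<close> that vanishes below \<open>n\<close> involves no carries up to the component \<open>n\<close>: this is
  visible on ghost components, where \<open>z\<close> contributes \<open>0\<close> below \<open>n\<close> and \<open>p ^ n z\<^sub>n\<close> at \<open>n\<close>.
\<close>

lemma wadd_low:
  fixes x z :: "nat \<Rightarrow> 'a::comm_ring_1"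
  assumes p: "prime p" and z: "\<And>m. m < n \<Longrightarrow> z m = 0" and "k \<le> n"
  shows "wadd p x z k = x k + z k"
proof -
  have p0: "p > 0" using p prime_gt_0_nat by auto
  define X :: "nat \<Rightarrow> (nat \<times> nat) zpoly" where "X = witt_vars 0"
  define Z :: "nat \<Rightarrow> (nat \<times> nat) zpoly" where "Z = (\<lambda>m. if m < n then 0 else witt_vars 1 m)"
  have gZ: "ghost p Z m = (if m = n then of_nat p ^ n * Z n else 0)" if "m \<le> n" for m
    using that p0 unfolding ghost_lessThan by (auto simp: Z_def power_0_left intro!: sum.neutral)
  have low: "wadd p X Z m = X m" if "m < n" for m
    by (rule ghost_inj_upto[OF p0]) (use that gZ in \<open>simp add: ghost_wadd[OF p]\<close>)
  have "wadd p X Z k = X k + Z k"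
  proof (cases "k < n")
    case True then show ?thesis using low by (simp add: Z_def)
  next
    case False
    then have [simp]: "k = n" using \<open>k \<le> n\<close> by simp
    have "ghost p (wadd p X Z) n = ghost p X n + of_nat p ^ n * Z n"
      using gZ[of n] by (simp add: ghost_wadd[OF p])
    then have "of_nat p ^ n * wadd p X Z n = of_nat p ^ n * (X n + Z n)"
      unfolding ghost_lessThan using low by (simp add: algebra_simps)
    then show ?thesis using zpoly_torsion_free_power[OF p0] by simp
  qed
  then have "zeval (args2 x z) (wadd p X Z k) = zeval (args2 x z) (X k + Z k)" by simp
  moreover have "(\<lambda>i. zeval (args2 x z) (Z i)) = z" using z by (auto simp: Z_def fun_eq_iff)
  moreover have "zeval (args2 x z) (Z k) = z k" using z by (auto simp: Z_def)
  ultimately show ?thesis by (simp add: zeval_wadd X_def)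
qed

lemma witt_nth_add_low:
  fixes x z :: "'a::comm_ring_prime_char witt"
  assumes "\<And>m. m < n \<Longrightarrow> witt_nth z m = 0" "k \<le> n"
  shows "witt_nth (x + z) k = witt_nth x k + witt_nth z k"
  unfolding plus_witt.rep_eq by (rule wadd_low[OF CHAR_prime assms])

lemma witt_nth_mult_low:
  fixes x z :: "'a::comm_ring_prime_char witt"
  assumes "\<And>m. m < n \<Longrightarrow> witt_nth z m = 0" "k \<le> n"
  shows "witt_nth (x * z) k = witt_nth x 0 ^ (CHAR('a) ^ k) * witt_nth z k"
  unfolding times_witt.rep_eq
  using wmult_lead[OF CHAR_prime[where 'a = 'a], of 0 "witt_nth x" k "witt_nth z"] assms by auto

lemma witt_nth_0_add [simp]: "witt_nth (x + y :: 'a::comm_ring_prime_char witt) 0 = witt_nth x 0 + witt_nth y 0"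
  by (rule witt_nth_add_low) auto

lemma witt_nth_1: "witt_nth (1 :: 'a::comm_ring_prime_char witt) n = (if n = 0 then 1 else 0)"
  by (simp add: one_witt.rep_eq wone_def)

lemma witt_nth_0_uminus [simp]: "witt_nth (- x :: 'a::comm_ring_prime_char witt) 0 = - witt_nth x 0"
  using witt_nth_0_add[of x "- x"] by (simp add: add_eq_0_iff del: witt_nth_0_add)

lemma witt_nth_0_of_nat: "witt_nth (of_nat n :: 'a::comm_ring_prime_char witt) 0 = of_nat n"
  by (induction n) (simp_all add: witt_nth_1)

lemma witt_nth_0_of_int: "witt_nth (of_int n :: 'a::comm_ring_prime_char witt) 0 = of_int n"
  by (cases n) (simp_all add: witt_nth_0_of_nat del: of_nat_Suc)

lemma witt_agree_iff:
  fixes x y :: "'a::comm_ring_prime_char witt"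
  shows "(\<forall>m<n. witt_nth x m = witt_nth y m) \<longleftrightarrow> (\<forall>m<n. witt_nth (x - y) m = 0)"
proof
  assume L: "\<forall>m<n. witt_nth x m = witt_nth y m"
  have "witt_nth (x - y) m = 0" if "m < n" for m
    using that
  proof (induction m rule: less_induct)
    case (less m)
    have "witt_nth (y + (x - y)) m = witt_nth y m + witt_nth (x - y) m"
      by (rule witt_nth_add_low[of m]) (use less in auto)
    then show ?case using L less.prems by simp
  qed
  then show "\<forall>m<n. witt_nth (x - y) m = 0" by blast
next
  assume R: "\<forall>m<n. witt_nth (x - y) m = 0"
  have "witt_nth (y + (x - y)) m = witt_nth y m" if "m < n" for m
    using witt_nth_add_low[of n "x - y" m y] R that by simp
  then show "\<forall>m<n. witt_nth x m = witt_nth y m" by simp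
qed

text \<open>
  Newton-like approximation: if \<open>x y\<close> agrees with \<open>1\<close> below the component \<open>n\<close>, adding to \<open>y\<close> a vector
  \<open>V\<close> concentrated in the component \<open>n\<close> changes the component \<open>n\<close> of \<open>x y\<close> by \<open>x\<^sub>0 ^ p ^ n V\<^sub>n\<close> and nothing
  before it. The components of the approximations \<open>ys n\<close> below \<open>n\<close> never change again.
\<close>

lemma witt_unit:
  fixes x :: "'k::field_prime_char witt"
  assumes x0: "witt_nth x 0 \<noteq> 0"
  shows "\<exists>y. x * y = 1"
proof -
  define c where "c n y = (witt_nth 1 n - witt_nth (x * y) n) / witt_nth x 0 ^ (CHAR('k) ^ n)" for n y
  define V where "V n y = Abs_witt (\<lambda>m. if m = n then c n y else 0)" for n y
  define ys where "ys = rec_nat 0 (\<lambda>n y. y + V n y)"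
  have ys_Suc: "ys (Suc n) = ys n + V n (ys n)" for n by (simp add: ys_def)
  have V_low: "m < n \<Longrightarrow> witt_nth (V n y) m = 0" for m n y by (simp add: V_def)
  have xV: "m < n \<Longrightarrow> witt_nth (x * V n y) m = 0" for m n y
    using witt_nth_mult_low[of n "V n y" m x] V_low by simp
  have approx: "\<forall>m<n. witt_nth (x * ys n) m = witt_nth 1 m" for n
  proof (induction n)
    case (Suc n)
    have eq: "witt_nth (x * ys (Suc n)) m = witt_nth (x * ys n) m + witt_nth (x * V n (ys n)) m" if "m \<le> n" for m
      unfolding ys_Suc distrib_left by (rule witt_nth_add_low[of n]) (use xV that in auto)
    have "witt_nth (x * V n (ys n)) n = witt_nth 1 n - witt_nth (x * ys n) n"
      using witt_nth_mult_low[of n "V n (ys n)" n x] V_low x0 by (simp add: V_def c_def)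
    then show ?case using eq xV Suc by (auto simp: less_Suc_eq)
  qed simp
  have stable: "witt_nth (ys (n + k)) m = witt_nth (ys n) m" if "m < n" for n k m
  proof (induction k)
    case (Suc k)
    have "witt_nth (ys (n + Suc k)) m = witt_nth (ys (n + k)) m + witt_nth (V (n + k) (ys (n + k))) m"
      unfolding add_Suc_right ys_Suc by (rule witt_nth_add_low[of "n + k"]) (use that V_low in auto)
    then show ?case using Suc V_low that by simp
  qed simp
  define y where "y = Abs_witt (\<lambda>i. witt_nth (ys (Suc i)) i)"
  have y: "witt_nth y m = witt_nth (ys n) m" if "m < n" for m n
    using stable[of m "Suc m" "n - Suc m"] that by (simp add: y_def)
  have "x * y = 1"
  proof (rule witt_eqI)
    fix n
    have low: "witt_nth (y - ys (Suc n)) m = 0" if "m < Suc n" for m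
      using witt_agree_iff[of "Suc n" y "ys (Suc n)"] y that by blast
    have "x * y = x * ys (Suc n) + x * (y - ys (Suc n))" by (simp add: algebra_simps)
    moreover have "witt_nth (x * ys (Suc n) + x * (y - ys (Suc n))) n =
        witt_nth (x * ys (Suc n)) n + witt_nth (x * (y - ys (Suc n))) n"
      by (rule witt_nth_add_low[of n]) (use witt_nth_mult_low[of "Suc n" "y - ys (Suc n)" _ x] low in auto)
    ultimately show "witt_nth (x * y) n = witt_nth 1 n"
      using witt_nth_mult_low[of "Suc n" "y - ys (Suc n)" n x] low approx[of "Suc n"] by simp
  qed
  then show ?thesis ..
qed

text \<open>
  Witt addition and multiplication are given by polynomials with integer coefficients, which commute
  with \<open>x \<mapsto> x ^ p\<close> in characteristic \<open>p\<close>. So \<open>witt_frob\<close> is a ring endomorphism, and \<open>Zq\<close>, its ring of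
  fixed points under an iterate, is a subring.
\<close>

lemma zeval_frobenius:
  fixes \<phi> :: "'v \<Rightarrow> 'a::comm_ring_prime_char"
  shows "zeval (\<lambda>v. \<phi> v ^ CHAR('a)) P = zeval \<phi> P ^ CHAR('a)"
proof (induction P rule: zpoly_induct)
  case zero
  have "CHAR('a) > 0" using prime_gt_0_nat[OF CHAR_prime] .
  then show ?case by (simp add: power_0_left)
next
  case (mono m)
  have "mon_eval (\<lambda>v. \<phi> v ^ CHAR('a)) m = mon_eval \<phi> m ^ CHAR('a)"
    by (simp add: mon_eval_def mult.commute prod_power_distrib flip: power_mult)
  then show ?case by (simp add: zeval_frag_of)
next
  case (diff a b)
  have "(zeval \<phi> a - zeval \<phi> b + zeval \<phi> b) ^ CHAR('a) =
      (zeval \<phi> a - zeval \<phi> b) ^ CHAR('a) + zeval \<phi> b ^ CHAR('a)"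
    by (rule freshmans_dream) simp_all
  then show ?case using diff by (simp add: algebra_simps)
qed

lemma witt_nth_frob:
  fixes w :: "'k::field_prime_char witt"
  shows "witt_nth (witt_frob w) n = witt_nth w n ^ CHAR('k)"
  by (simp add: witt_frob_def)

lemma args2_power: "(\<lambda>v. args2 x y v ^ n) = args2 (\<lambda>i. x i ^ n) (\<lambda>i. y i ^ n)"
  by (auto simp: args2_def)

lemma witt_frob_add: "witt_frob (x + y) = witt_frob x + witt_frob y"
  by (rule witt_eqI)
     (simp add: witt_nth_frob plus_witt.rep_eq wadd_def args2_power flip: zeval_frobenius,
      simp add: witt_frob_def)

lemma witt_frob_mult: "witt_frob (x * y) = witt_frob x * witt_frob y"
  by (rule witt_eqI)
     (simp add: witt_nth_frob times_witt.rep_eq wmult_def args2_power flip: zeval_frobenius,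
      simp add: witt_frob_def)

lemma witt_frob_0 [simp]: "witt_frob 0 = 0"
  using witt_frob_add[of 0 0] by simp

lemma witt_frob_1 [simp]: "witt_frob (1 :: 'k::field_prime_char witt) = 1"
  by (rule witt_eqI) (simp add: witt_nth_frob witt_nth_1 power_0_left prime_gt_0_nat[OF CHAR_prime])

lemma witt_frob_diff: "witt_frob (x - y) = witt_frob x - witt_frob y"
  using witt_frob_add[of "x - y" y] by (simp add: eq_diff_eq)

lemma witt_frob_iter:
  "(witt_frob ^^ j) (x + y) = (witt_frob ^^ j) x + (witt_frob ^^ j) y"
  "(witt_frob ^^ j) (x * y) = (witt_frob ^^ j) x * (witt_frob ^^ j) y"
  "(witt_frob ^^ j) (x - y) = (witt_frob ^^ j) x - (witt_frob ^^ j) y"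
  "(witt_frob ^^ j) 0 = 0" "(witt_frob ^^ j) (1 :: 'k::field_prime_char witt) = 1"
  by (induction j) (simp_all add: witt_frob_add witt_frob_mult witt_frob_diff)

lemma witt_nth_frob_iter:
  fixes w :: "'k::field_prime_char witt"
  shows "witt_nth ((witt_frob ^^ j) w) n = witt_nth w n ^ (CHAR('k) ^ j)"
  by (induction j) (simp_all add: witt_nth_frob mult.commute flip: power_mult)

lemma Zq_iff_frob:
  fixes w :: "'k::field_prime_char witt"
  shows "w \<in> Zq (CHAR('k) ^ m) \<longleftrightarrow> (witt_frob ^^ m) w = w"
proof -
  have "w \<in> Zq (CHAR('k) ^ m) \<longleftrightarrow> (\<forall>n. witt_nth ((witt_frob ^^ m) w) n = witt_nth w n)"
    by (simp add: Zq_def Fq_def witt_nth_frob_iter)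
  then show ?thesis using witt_eqI by metis
qed

lemma is_subring_Zq: "is_subring (Zq (CHAR('k) ^ m) :: 'k::field_prime_char witt set)"
  by (auto simp: is_subring_def Zq_iff_frob witt_frob_iter)

lemma of_int_fract: "of_int n = to_fract (of_int n :: 'a::idom)"
  by (cases n) (simp_all add: of_nat_fract del: of_nat_Suc)

lemma is_subring_to_fract: "is_subring Z \<Longrightarrow> is_subring (to_fract ` Z)"
  by (auto simp: is_subring_def image_iff Bex_def simp flip: to_fract_diff to_fract_mult)

text \<open>
  An integer prime to \<open>p\<close> is a unit of the Witt vector ring because its first component is not 0. Its inverse
  is fixed by the Frobenius, by uniqueness of inverses.
\<close>

lemma p_integral_subset_Zq:
  "p_integral CHAR('k) \<subseteq> to_fract ` (Zq (CHAR('k) ^ m) :: 'k::field_prime_char witt set)"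
proof
  fix x :: "'k witt fract" assume "x \<in> p_integral CHAR('k)"
  then obtain a b where b: "\<not> int CHAR('k) dvd b" and x: "x = of_int a / of_int b"
    unfolding p_integral_def by blast
  note Z = is_subring_Zq[where 'k = 'k, of m]
  have "witt_nth (of_int b :: 'k witt) 0 \<noteq> 0"
    unfolding witt_nth_0_of_int using b by (simp add: of_int_eq_0_iff_char_dvd)
  then obtain y :: "'k witt" where y: "of_int b * y = 1" using witt_unit by blast
  have "(witt_frob ^^ m) (of_int b * y) = of_int b * (witt_frob ^^ m) y"
    using subring_of_int[OF Z, of b] by (simp add: witt_frob_iter Zq_iff_frob)
  then have "of_int b * (witt_frob ^^ m) y = of_int b * y" using y by (simp add: witt_frob_iter)
  then have "(witt_frob ^^ m) y = y" using y by (metis mult_left_cancel mult_zero_left zero_neq_one)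
  then have "of_int a * y \<in> Zq (CHAR('k) ^ m)"
    using subring_of_int[OF Z] subring_mult[OF Z] Zq_iff_frob by blast
  moreover have "x = to_fract (of_int a * y)"
  proof -
    have "of_int b * to_fract y = 1" using arg_cong[OF y, of to_fract] by (simp add: of_int_fract)
    moreover have "b \<noteq> 0" using b by auto
    ultimately show ?thesis unfolding x by (simp add: of_int_fract[symmetric] divide_eq_eq mult_ac)
  qed
  ultimately show "x \<in> to_fract ` Zq (CHAR('k) ^ m)" by blast
qed

lemma teich_nth: "witt_nth (teich x) n = (if n = 0 then x else 0)"
  by (simp add: teich_def)

lemma teich_1: "teich 1 = 1"
  by (rule witt_eqI) (simp add: teich_nth witt_nth_1)

lemma ghost_concentrated:
  assumes "p > 0" shows "ghost p (\<lambda>i. if i = 0 then X else 0) n = X ^ (p ^ n)"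
  using assms by (simp add: ghost_def sum.atMost_shift power_0_left)

text \<open>
  The ghost components of a vector concentrated in the component 0 are the powers \<open>X ^ p ^ n\<close>, which are
  multiplicative in \<open>X\<close>.
\<close>

lemma teich_mult: "teich (x * y) = teich x * teich (y :: 'k::field_prime_char)"
proof (rule witt_eqI)
  fix n
  let ?p = "CHAR('k)"
  have p: "prime ?p" "?p > 0" using prime_gt_0_nat[OF CHAR_prime] by auto
  define X Y :: "(nat \<times> nat) zpoly" where "X = witt_vars 0 0" "Y = witt_vars 1 0"
  let ?c = "\<lambda>X i. if i = 0 then X else 0 :: (nat \<times> nat) zpoly"
  have "wmult ?p (?c X) (?c Y) = ?c (X * Y)"
    by (rule ghost_inj[OF p(2)]) (simp add: ghost_wmult[OF p(1)] ghost_concentrated[OF p(2)] power_mult_distrib)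
  then have "zeval (args2 (\<lambda>_. x) (\<lambda>_. y)) (wmult ?p (?c X) (?c Y) n) =
      zeval (args2 (\<lambda>_. x) (\<lambda>_. y)) (?c (X * Y) n)" by simp
  then have "wmult ?p (\<lambda>i. if i = 0 then x else 0) (\<lambda>i. if i = 0 then y else 0) n = (if n = 0 then x * y else 0)"
    by (simp add: zeval_wmult X_Y_def if_distrib[of "zeval _"] cong: if_cong)
  then show "witt_nth (teich (x * y)) n = witt_nth (teich x * teich y) n"
    by (simp add: teich_nth times_witt.rep_eq teich_def)
qed

lemma teich_power: "teich (x ^ n) = teich x ^ n"
  by (induction n) (simp_all add: teich_1 teich_mult)

lemma teich_prod: "teich (prod g A) = (\<Prod>i\<in>A. teich (g i))"
  by (induction A rule: infinite_finite_induct) (simp_all add: teich_1 teich_mult)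

lemma witt_frob_teich:
  fixes x :: "'k::field_prime_char"
  shows "witt_frob (teich x) = teich x ^ CHAR('k)"
  by (rule witt_eqI)
     (auto simp: witt_nth_frob teich_nth power_0_left prime_gt_0_nat[OF CHAR_prime] simp flip: teich_power)

lemma teich_inj: "teich x = teich y \<Longrightarrow> x = y"
  by (drule arg_cong[of _ _ "\<lambda>w. witt_nth w 0"]) (simp add: teich_nth)

text \<open>
  The polynomial \<open>X ^ N - 1\<close> splits, and a double root would be a root of its derivative \<open>N X ^ (N - 1)\<close>,
  hence 0.
\<close>

lemma card_roots_of_unity_alg_closed:
  fixes N :: nat
  assumes N: "of_nat N \<noteq> (0 :: 'k::alg_closed_field)"
  shows "card {x :: 'k. x ^ N = 1} = N"
proof -
  have N0: "N > 0" using N by (cases N) auto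
  define f :: "'k poly" where "f = monom 1 N + [:-1:]"
  have deg: "degree f = N" "lead_coeff f = 1"
  proof -
    show d: "degree f = N" unfolding f_def using N0
      by (subst degree_add_eq_left) (auto simp: degree_monom_eq)
    show "lead_coeff f = 1" unfolding d using N0 by (cases N) (auto simp: f_def)
  qed
  have f0: "f \<noteq> 0" using deg by auto
  obtain A where A: "size A = N" "f = (\<Prod>x\<in>#A. [:-x, 1:])"
    using alg_closed_imp_factorization[OF f0] deg by auto
  have root: "poly f x = 0 \<longleftrightarrow> x ^ N = 1" for x by (simp add: f_def poly_monom)
  have set: "set_mset A = {x. x ^ N = 1}"
    unfolding root[symmetric] A(2) by (auto simp: poly_prod_mset prod_mset_zero_iff)
  have "count A x \<le> 1" for x
  proof (rule ccontr)
    assume "\<not> count A x \<le> 1"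
    then have xA: "x \<in># A" "x \<in># A - {#x#}" by (auto simp flip: count_greater_zero_iff)
    then obtain B where "A = add_mset x (add_mset x B)" by (metis insert_DiffM)
    then have "f = [:-x, 1:] * ([:-x, 1:] * (\<Prod>x\<in>#B. [:-x, 1:]))" by (simp add: A(2))
    then have "poly (pderiv f) x = 0" by (simp only: pderiv_mult poly_add poly_mult) simp
    moreover have "poly (pderiv f) x = of_nat N * x ^ (N - 1)"
      by (simp add: f_def pderiv_add pderiv_monom poly_monom)
    ultimately have "x = 0" using N by simp
    moreover have "x ^ N = 1" using xA(1) set by auto
    ultimately show False using N0 by (simp add: power_0_left)
  qed
  then have "A = mset_set (set_mset A)"
    by (intro multiset_eqI) (metis One_nat_def count_mset_set(1) count_mset_set(3) finite_set_mset
      le_Suc_eq le_zero_eq not_in_iff)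
  then have "size A = card (set_mset A)" by (metis size_mset_set)
  then show ?thesis using A set by simp
qed

lemma card_power_eq_1_le:
  assumes "n > 0" shows "finite {x::'a::idom. x ^ n = 1}" "card {x::'a::idom. x ^ n = 1} \<le> n"
proof -
  let ?f = "monom 1 n + [:-1:] :: 'a poly"
  have d: "degree ?f = n" using assms by (subst degree_add_eq_left) (auto simp: degree_monom_eq)
  then have f0: "?f \<noteq> 0" using assms by auto
  have "{x. x ^ n = 1} = {x. poly ?f x = 0}" by (simp add: poly_monom)
  then show "finite {x::'a. x ^ n = 1}" "card {x::'a. x ^ n = 1} \<le> n"
    using poly_roots_finite[OF f0] card_poly_roots_bound[OF f0] d by auto
qed

context
  fixes Q m :: nat
  assumes m: "m > 0" and Q: "Q = CHAR('k::{alg_closed_field, field_prime_char}) ^ m"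
begin

lemma Q_gt_1: "Q > 1"
  unfolding Q using m prime_gt_1_nat[OF CHAR_prime[where 'a = 'k]] by (intro one_less_power) auto

text \<open>
  The representatives \<open>teich x\<close> provide \<open>Q - 1\<close> elements of \<open>mu Q\<close>, and an integral domain has no more
  roots of \<open>X ^ (Q - 1) = 1\<close> than that.
\<close>

lemma card_mu: "card (mu Q :: 'k witt set) = Q - 1" and finite_mu: "finite (mu Q :: 'k witt set)"
  and mu_eq_teich: "(mu Q :: 'k witt set) = teich ` {x. x ^ (Q - 1) = 1}"
proof -
  let ?N = "Q - 1" and ?R = "{x :: 'k. x ^ (Q - 1) = 1}"
  have N0: "?N > 0" using Q_gt_1 by simp
  have "of_nat Q = (0 :: 'k)" unfolding Q using m by (simp add: power_0_left)
  moreover have "of_nat Q = (of_nat ?N + 1 :: 'k)" using Q_gt_1 by (simp add: of_nat_diff)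
  ultimately have "of_nat ?N \<noteq> (0 :: 'k)" by auto
  then have cR: "card ?R = ?N" by (rule card_roots_of_unity_alg_closed)
  have sub: "teich ` ?R \<subseteq> mu Q"
  proof
    fix z assume "z \<in> teich ` ?R"
    then obtain x where x: "x ^ ?N = 1" "z = teich x" by blast
    have "x ^ Q = x * x ^ ?N" using Q_gt_1 by (simp flip: power_Suc)
    then have "\<forall>i. witt_nth z i \<in> Fq Q" using x Q_gt_1 by (auto simp: teich_nth Fq_def power_0_left)
    moreover have "z ^ ?N = 1" using x by (simp add: teich_1 flip: teich_power)
    ultimately show "z \<in> mu Q" by (simp add: mu_def Zq_def)
  qed
  have sup: "mu Q \<subseteq> {z :: 'k witt. z ^ ?N = 1}" by (auto simp: mu_def)
  note fin = card_power_eq_1_le[OF N0, where 'a = "'k witt"]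
  show f: "finite (mu Q :: 'k witt set)" by (rule finite_subset[OF sup fin(1)])
  have "card (teich ` ?R) = ?N" using cR by (subst card_image) (auto intro: inj_onI teich_inj)
  moreover have "card (mu Q :: 'k witt set) \<le> ?N"
    using card_mono[OF fin(1) sup] fin(2) by linarith
  moreover have "card (teich ` ?R) \<le> card (mu Q :: 'k witt set)" by (rule card_mono[OF f sub])
  ultimately show "card (mu Q :: 'k witt set) = ?N" by linarith
  then show "mu Q = teich ` ?R"
    using card_subset_eq[OF f sub] \<open>card (teich ` ?R) = ?N\<close> by simp
qed

lemma mu_power_Q: "z \<in> mu Q \<Longrightarrow> z ^ Q = (z :: 'k witt)"
  using Q_gt_1 power_Suc[of z "Q - 1"] by (simp add: mu_def)

lemma mu_nonzero: "z \<in> mu Q \<Longrightarrow> z \<noteq> (0 :: 'k witt)"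
  using Q_gt_1 by (auto simp: mu_def power_0_left)

lemma mu_1: "1 \<in> (mu Q :: 'k witt set)"
  using subring_1[OF is_subring_Zq, of m] by (simp add: mu_def Q)

lemma mu_mult: "y \<in> mu Q \<Longrightarrow> z \<in> mu Q \<Longrightarrow> y * z \<in> (mu Q :: 'k witt set)"
  using subring_mult[OF is_subring_Zq, of y m z] by (auto simp: mu_def Q power_mult_distrib)

lemma mu_power: "z \<in> mu Q \<Longrightarrow> z ^ n \<in> (mu Q :: 'k witt set)"
  by (induction n) (auto intro: mu_1 mu_mult)

lemma mu_prod: "(\<And>i. i \<in> A \<Longrightarrow> g i \<in> mu Q) \<Longrightarrow> prod g A \<in> (mu Q :: 'k witt set)"
  by (induction A rule: infinite_finite_induct) (auto intro: mu_1 mu_mult)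

lemma witt_inverse_eq: "z * w = 1 \<Longrightarrow> inverse z = (w :: 'k witt)"
  unfolding inverse_witt_def
  by (auto intro!: the_equality dest: mult_left_cancel[THEN iffD1, rotated] simp: dvd_def)
     (metis mult.assoc mult.commute mult_1)+

lemma mu_inverse:
  assumes "z \<in> mu Q" shows "inverse z \<in> (mu Q :: 'k witt set)" "z * inverse z = 1"
proof -
  have "Q - 1 = Suc (Q - 2)" using Q_gt_1 by simp
  then have "z * z ^ (Q - 2) = z ^ (Q - 1)" by simp
  then have "z * z ^ (Q - 2) = 1" using assms by (simp add: mu_def)
  then show "inverse z \<in> mu Q" "z * inverse z = 1"
    using witt_inverse_eq mu_power[OF assms] by auto
qed

lemma mu_powi: "z \<in> mu Q \<Longrightarrow> z powi n \<in> (mu Q :: 'k witt set)"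
  by (simp add: power_int_def mu_power mu_inverse)

lemma to_fract_powi: "z \<in> mu Q \<Longrightarrow> to_fract (z powi n) = to_fract (z :: 'k witt) powi n"
proof -
  assume z: "z \<in> mu Q"
  have "to_fract z * to_fract (inverse z) = 1"
    using arg_cong[OF mu_inverse(2)[OF z], of to_fract] by simp
  then have "to_fract (inverse z) = inverse (to_fract z)" by (metis inverse_unique)
  moreover have "to_fract (y ^ k) = to_fract y ^ k" for y :: "'k witt" and k by (induction k) simp_all
  ultimately show ?thesis by (simp add: power_int_def)
qed

lemma witt_frob_iter_mu: "z \<in> mu Q \<Longrightarrow> (witt_frob ^^ j) z = (z :: 'k witt) ^ (CHAR('k) ^ j)"
proof (induction j)
  case (Suc j)
  obtain x where "z = teich x" using Suc.prems mu_eq_teich by auto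
  then show ?case using Suc by (simp add: witt_frob_teich flip: teich_power) (simp add: mult.commute flip: power_mult)
qed simp

lemma fract_mu_power_1: "z \<in> mu Q \<Longrightarrow> to_fract (z :: 'k witt) ^ (Q - 1) = 1"
proof -
  assume "z \<in> mu Q"
  moreover have "to_fract (y ^ k) = to_fract y ^ k" for y :: "'k witt" and k by (induction k) simp_all
  ultimately show ?thesis unfolding mu_def by (metis (mono_tags, lifting) mem_Collect_eq to_fract_1)
qed

lemma powi_mu_mod:
  assumes "z \<in> mu Q"
  shows "to_fract (z :: 'k witt) powi v = to_fract z ^ nat (v mod int (Q - 1))"
proof -
  let ?N = "Q - 1"
  have z0: "to_fract z \<noteq> 0" using mu_nonzero[OF assms] by simp
  have N: "int ?N > 0" using Q_gt_1 by simp
  have "to_fract z powi v = to_fract z powi (int ?N * (v div int ?N) + v mod int ?N)"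
    by (simp only: mult_div_mod_eq)
  also have "\<dots> = (to_fract z powi int ?N) powi (v div int ?N) * to_fract z powi (v mod int ?N)"
    by (simp only: power_int_add[OF disjI1[OF z0]] power_int_mult)
  also have "\<dots> = to_fract z ^ nat (v mod int ?N)"
  proof -
    have "to_fract z powi (v mod int ?N) = to_fract z ^ nat (v mod int ?N)"
      using pos_mod_sign[OF N, of v] by (simp only: power_int_def if_True)
    then show ?thesis
      using fract_mu_power_1[OF assms] by (simp only: power_int_of_nat power_int_1_left mult_1)
  qed
  finally show ?thesis .
qed

lemma exists_mu_powi_neq_1:
  assumes "\<not> int (Q - 1) dvd v"
  shows "\<exists>g\<in>mu Q. to_fract (g :: 'k witt) powi v \<noteq> 1"
proof (rule ccontr)
  let ?r = "nat (v mod int (Q - 1))"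
  have N: "int (Q - 1) > 0" using Q_gt_1 by simp
  have "0 \<le> v mod int (Q - 1)" "v mod int (Q - 1) < int (Q - 1)" "v mod int (Q - 1) \<noteq> 0"
    using pos_mod_bound[OF N, of v] pos_mod_sign[OF N, of v] assms by (auto simp only: dvd_eq_mod_eq_0)
  then have r: "0 < ?r" "?r < Q - 1" by linarith+
  assume "\<not> ?thesis"
  then have "to_fract ` mu Q \<subseteq> {x :: 'k witt fract. x ^ ?r = 1}" using powi_mu_mod by auto
  then have "card (to_fract ` (mu Q :: 'k witt set)) \<le> ?r"
    using card_mono card_power_eq_1_le[OF r(1), where 'a = "'k witt fract"] by (meson le_trans)
  moreover have "card (to_fract ` (mu Q :: 'k witt set)) = Q - 1"
    by (subst card_image) (auto simp: card_mu intro: inj_onI)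
  ultimately show False using r(2) by linarith
qed

end


section \<open>Fredholm determinants\<close>

lemma fps_deriv_prod:
  fixes g :: "'b \<Rightarrow> 'a::comm_ring_1 fps"
  assumes "finite S"
  shows "fps_deriv (prod g S) = (\<Sum>i\<in>S. fps_deriv (g i) * prod g (S - {i}))"
  using assms
proof (induction S)
  case (insert x S)
  have "(\<Sum>i\<in>S. fps_deriv (g i) * prod g (insert x S - {i})) = (\<Sum>i\<in>S. g x * (fps_deriv (g i) * prod g (S - {i})))"
  proof (rule sum.cong)
    fix i assume i: "i \<in> S"
    then have "insert x S - {i} = insert x (S - {i})" using insert by auto
    then show "fps_deriv (g i) * prod g (insert x S - {i}) = g x * (fps_deriv (g i) * prod g (S - {i}))"
      using insert by simp
  qed simp
  then show ?case using insert by (simp add: sum_distrib_left algebra_simps)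
qed simp

text \<open>
  Jacobi's formula. By the Leibniz rule the derivative is the sum of the determinants with one row
  differentiated; these are expanded along that row.
\<close>

lemma fps_deriv_det:
  fixes N :: "'a::comm_ring_1 fps mat"
  assumes N: "N \<in> carrier_mat n n"
  shows "fps_deriv (det N) = (\<Sum>i<n. \<Sum>j<n. fps_deriv (N $$ (i, j)) * cofactor N i j)"
proof -
  define R where "R i = mat n n (\<lambda>(k, j). if k = i then fps_deriv (N $$ (k, j)) else N $$ (k, j))" for i
  have R: "R i \<in> carrier_mat n n" for i by (simp add: R_def)
  have cof: "cofactor (R i) i j = cofactor N i j" for i j
  proof -
    have "mat_delete (R i) i j = mat_delete N i j"
      using N by (intro eq_matI) (auto simp: mat_delete_def R_def)
    then show ?thesis by (simp add: cofactor_def)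
  qed
  have sgn: "fps_deriv (signof p * f) = signof p * fps_deriv f" for p :: "nat \<Rightarrow> nat" and f :: "'a fps"
    by (simp add: sign_def)
  have "fps_deriv (det N) = (\<Sum>p | p permutes {0..<n}. \<Sum>i = 0..<n.
      signof p * (fps_deriv (N $$ (i, p i)) * (\<Prod>k\<in>{0..<n} - {i}. N $$ (k, p k))))"
    unfolding det_def'[OF N] by (simp add: fps_deriv_sum sgn fps_deriv_prod sum_distrib_left)
  also have "\<dots> = (\<Sum>i = 0..<n. det (R i))"
    unfolding det_def'[OF R]
  proof (subst sum.swap, intro sum.cong refl)
    fix i p assume i: "i \<in> {0..<n}" and p: "p \<in> {p. p permutes {0..<n}}"
    then have pr: "k < n \<Longrightarrow> p k < n" for k using permutes_in_image[of p "{0..<n}" k] by auto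
    have "(\<Prod>k = 0..<n. R i $$ (k, p k)) = R i $$ (i, p i) * (\<Prod>k\<in>{0..<n} - {i}. R i $$ (k, p k))"
      using i by (intro prod.remove) auto
    also have "\<dots> = fps_deriv (N $$ (i, p i)) * (\<Prod>k\<in>{0..<n} - {i}. N $$ (k, p k))"
      using i pr by (intro arg_cong2[of _ _ _ _ "(*)"] prod.cong) (auto simp: R_def)
    finally show "signof p * (fps_deriv (N $$ (i, p i)) * (\<Prod>k\<in>{0..<n} - {i}. N $$ (k, p k)))
        = signof p * (\<Prod>k = 0..<n. R i $$ (k, p k))" by simp
  qed
  also have "\<dots> = (\<Sum>i<n. \<Sum>j<n. fps_deriv (N $$ (i, j)) * cofactor N i j)"
    unfolding atLeast0LessThan
    by (intro sum.cong refl, subst laplace_expansion_row[OF R]) (auto simp: cof, auto simp: R_def intro!: sum.cong)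
  finally show ?thesis .
qed

text \<open>The matrix \<open>1 - s M\<close>.\<close>

definition char_mat :: "nat \<Rightarrow> (nat \<Rightarrow> nat \<Rightarrow> 'a::comm_ring_1) \<Rightarrow> 'a fps mat" where
  "char_mat n M = mat n n (\<lambda>(i, j). (if i = j then 1 else 0) - fps_const (M i j) * fps_X)"

lemma char_mat_carrier: "char_mat n M \<in> carrier_mat n n"
  by (simp add: char_mat_def)

text \<open>
  Here \<open>Pw k\<close> stands for the power \<open>M ^ k\<close>. As \<open>\<Sum>k. s ^ k M ^ k\<close> is inverse to \<open>1 - s M\<close>, the adjugate of
  \<open>1 - s M\<close> is its determinant times this series, and Jacobi's formula turns into the statement that the
  logarithmic derivative is \<open>- Tr (M \<Sum>k. s ^ k M ^ k)\<close>.
\<close>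

lemma det_char_mat_logderiv:
  fixes M :: "nat \<Rightarrow> nat \<Rightarrow> 'a::comm_ring_1"
  assumes P0: "\<And>i j. i < n \<Longrightarrow> j < n \<Longrightarrow> Pw 0 i j = (if i = j then 1 else 0)"
    and PS: "\<And>k i j. i < n \<Longrightarrow> j < n \<Longrightarrow> Pw (Suc k) i j = (\<Sum>l<n. M i l * Pw k l j)"
  shows "fps_deriv (det (char_mat n M)) = det (char_mat n M) * Abs_fps (\<lambda>k. - (\<Sum>i<n. Pw (Suc k) i i))"
proof -
  let ?N = "char_mat n M" and ?D = "det (char_mat n M)"
  define W where "W = mat n n (\<lambda>(i, j). Abs_fps (\<lambda>k. Pw k i j))"
  note N = char_mat_carrier[of n M]
  have W: "W \<in> carrier_mat n n" by (simp add: W_def)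
  have "?N * W = 1\<^sub>m n"
  proof (rule eq_matI)
    fix i j assume "i < dim_row (1\<^sub>m n :: 'a fps mat)" "j < dim_col (1\<^sub>m n :: 'a fps mat)"
    then have ij: "i < n" "j < n" by auto
    have "(?N * W) $$ (i, j) = (\<Sum>l<n. ?N $$ (i, l) * W $$ (l, j))"
      using ij W N by (simp add: scalar_prod_def atLeast0LessThan)
    also have "\<dots> = (\<Sum>l<n. (if l = i then Abs_fps (\<lambda>k. Pw k l j) else 0) - fps_X * (fps_const (M i l) * Abs_fps (\<lambda>k. Pw k l j)))"
      using ij by (intro sum.cong) (auto simp: char_mat_def W_def algebra_simps)
    also have "\<dots> = Abs_fps (\<lambda>k. Pw k i j) - fps_X * (\<Sum>l<n. fps_const (M i l) * Abs_fps (\<lambda>k. Pw k l j))"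
      using ij by (simp add: sum_subtractf sum_distrib_left)
    also have "\<dots> = (if i = j then 1 else 0)"
    proof (rule fps_ext)
      fix k
      show "fps_nth (Abs_fps (\<lambda>k. Pw k i j) - fps_X * (\<Sum>l<n. fps_const (M i l) * Abs_fps (\<lambda>k. Pw k l j))) k
          = fps_nth (if i = j then 1 else 0) k"
        using ij by (cases k) (simp_all add: P0 PS fps_sum_nth)
    qed
    finally show "(?N * W) $$ (i, j) = 1\<^sub>m n $$ (i, j)" using ij by simp
  qed (use N W in auto)
  then have "adj_mat ?N * (?N * W) = adj_mat ?N"
    using adj_mat(1)[OF N] by simp
  then have "adj_mat ?N = (adj_mat ?N * ?N) * W"
    using assoc_mult_mat[OF adj_mat(1)[OF N] N W] by simp
  also have "\<dots> = ?D \<cdot>\<^sub>m W" unfolding adj_mat(3)[OF N] mult_smult_assoc_mat[OF one_carrier_mat W] using W by simp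
  finally have adj: "adj_mat ?N = ?D \<cdot>\<^sub>m W" .
  have cof: "cofactor ?N i j = ?D * Abs_fps (\<lambda>k. Pw k j i)" if "i < n" "j < n" for i j
    using arg_cong[OF adj, of "\<lambda>A. A $$ (j, i)"] that N W by (simp add: adj_mat_def W_def)
  have "fps_deriv ?D = (\<Sum>i<n. \<Sum>j<n. - fps_const (M i j) * (?D * Abs_fps (\<lambda>k. Pw k j i)))"
    unfolding fps_deriv_det[OF N] by (intro sum.cong refl) (auto simp: cof, auto simp: char_mat_def)
  also have "\<dots> = ?D * (\<Sum>i<n. \<Sum>j<n. - fps_const (M i j) * Abs_fps (\<lambda>k. Pw k j i))"
    by (simp add: sum_distrib_left mult_ac sum_negf)
  also have "(\<Sum>i<n. \<Sum>j<n. - fps_const (M i j) * Abs_fps (\<lambda>k. Pw k j i)) = Abs_fps (\<lambda>k. - (\<Sum>i<n. Pw (Suc k) i i))"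
    by (rule fps_ext) (simp add: fps_sum_nth PS sum_negf)
  finally show ?thesis .
qed

lemma det_char_mat_nth_0: "fps_nth (det (char_mat n M)) 0 = (1 :: 'a::comm_ring_1)"
proof -
  interpret h: comm_ring_hom "\<lambda>f :: 'a fps. fps_nth f 0" by unfold_locales auto
  have "map_mat (\<lambda>f. fps_nth f 0) (char_mat n M) = 1\<^sub>m n"
    by (rule eq_matI) (auto simp: char_mat_def)
  then show ?thesis using h.hom_det[of "char_mat n M"] by simp
qed

theorem det_char_mat_eq_exp:
  fixes M :: "nat \<Rightarrow> nat \<Rightarrow> 'a::field_char_0 fps"
  assumes "\<And>i j. i < n \<Longrightarrow> j < n \<Longrightarrow> Pw 0 i j = (if i = j then 1 else 0)"
    and "\<And>k i j. i < n \<Longrightarrow> j < n \<Longrightarrow> Pw (Suc k) i j = (\<Sum>l<n. M i l * Pw k l j)"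
  shows "det (char_mat n M) =
    exp_series (Abs_fps (\<lambda>k. if k = 0 then 0 else - (fps_const (1 / of_nat k) * (\<Sum>i<n. Pw k i i))))"
proof (rule exp_series_eqI[symmetric])
  let ?G = "Abs_fps (\<lambda>k. if k = 0 then 0 else - (fps_const (1 / of_nat k) * (\<Sum>i<n. Pw k i i)))"
  have "fps_deriv ?G = Abs_fps (\<lambda>k. - (\<Sum>i<n. Pw (Suc k) i i))"
  proof (rule fps_ext)
    fix k
    have c: "of_nat (Suc k) * (fps_const (1 / of_nat (Suc k)) * x) = x" for x :: "'a fps"
      by (simp add: mult.assoc[symmetric] del: of_nat_Suc flip: fps_of_nat)
    show "fps_nth (fps_deriv ?G) k = fps_nth (Abs_fps (\<lambda>k. - (\<Sum>i<n. Pw (Suc k) i i))) k"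
      using c[of "\<Sum>i<n. Pw (Suc k) i i"] by (simp del: of_nat_Suc)
  qed
  then show "fps_deriv (det (char_mat n M)) = det (char_mat n M) * fps_deriv ?G"
    using det_char_mat_logderiv[OF assms] by simp
qed (simp_all add: det_char_mat_nth_0)

lemma det_char_mat_over:
  assumes Z: "is_subring Z" and M: "\<And>i j. i < n \<Longrightarrow> j < n \<Longrightarrow> M i j \<in> Z"
  shows "det (char_mat n M) \<in> fps_over Z"
proof -
  note Y = is_subring_fps_over[OF Z]
  show ?thesis
    unfolding det_def'[OF char_mat_carrier]
  proof (intro subring_sum[OF Y] subring_mult[OF Y] subring_prod[OF Y] subring_of_int[OF Y])
    fix p i assume p: "p \<in> {p. p permutes {0..<n}}" and i: "i \<in> {0..<n}"
    then have "p i < n" using permutes_in_image[of p "{0..<n}" i] by auto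
    then show "char_mat n M $$ (i, p i) \<in> fps_over Z"
      using i M by (auto simp: char_mat_def intro!: subring_diff[OF Y] subring_uminus[OF Y] subring_mult[OF Y] fps_const_over[OF Z]
          fps_X_over[OF Z] subring_1[OF Y] subring_0[OF Y])
  qed
qed


section \<open>Growth of coefficients\<close>

text \<open>
  The order of \<open>a\<close> in \<open>T\<close> is at least \<open>r / C\<close>. The common denominator \<open>C\<close> keeps the estimates in the integers.
\<close>

definition T_ord_ge :: "int \<Rightarrow> int \<Rightarrow> 'a::zero fps \<Rightarrow> bool" where
  "T_ord_ge C r a \<longleftrightarrow> (\<forall>j. fps_nth a j \<noteq> 0 \<longrightarrow> r \<le> C * int j)"

lemma T_ord_geD: "T_ord_ge C r a \<Longrightarrow> fps_nth a j \<noteq> 0 \<Longrightarrow> r \<le> C * int j"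
  by (simp add: T_ord_ge_def)

lemma T_ord_ge_0 [simp]: "T_ord_ge C r 0"
  by (simp add: T_ord_ge_def)

lemma T_ord_ge_nonpos: "C \<ge> 0 \<Longrightarrow> r \<le> 0 \<Longrightarrow> T_ord_ge C r a"
  by (auto simp: T_ord_ge_def intro: order_trans)

lemma T_ord_ge_mono: "T_ord_ge C r a \<Longrightarrow> r' \<le> r \<Longrightarrow> T_ord_ge C r' a"
  by (force simp: T_ord_ge_def)

lemma T_ord_ge_uminus [simp]: "T_ord_ge C r (- a :: 'a::ring_1 fps) \<longleftrightarrow> T_ord_ge C r a"
  by (simp add: T_ord_ge_def)

lemma T_ord_ge_add: "T_ord_ge C r a \<Longrightarrow> T_ord_ge C r b \<Longrightarrow> T_ord_ge C r (a + b :: 'a::ring_1 fps)"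
  unfolding T_ord_ge_def by (metis add.right_neutral add_0 fps_add_nth)

lemma T_ord_ge_sum: "(\<And>i. i \<in> A \<Longrightarrow> T_ord_ge C r (g i)) \<Longrightarrow> T_ord_ge C r (sum g A :: 'a::ring_1 fps)"
  by (induction A rule: infinite_finite_induct) (auto intro: T_ord_ge_add)

lemma T_ord_ge_mult:
  assumes "T_ord_ge C r a" "T_ord_ge C r' b" shows "T_ord_ge C (r + r') (a * b :: 'a::comm_ring_1 fps)"
  unfolding T_ord_ge_def
proof (intro allI impI)
  fix j assume "fps_nth (a * b) j \<noteq> 0"
  then obtain i where "i \<le> j" "fps_nth a i * fps_nth b (j - i) \<noteq> 0"
    unfolding fps_mult_nth by (metis (no_types, lifting) atLeastAtMost_iff sum.neutral)
  then have nz: "fps_nth a i \<noteq> 0" "fps_nth b (j - i) \<noteq> 0" and i: "i \<le> j" by auto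
  then have "r \<le> C * int i" "r' \<le> C * int (j - i)"
    using T_ord_geD[OF assms(1) nz(1)] T_ord_geD[OF assms(2) nz(2)] by auto
  then have "r + r' \<le> C * int i + C * int (j - i)" by simp
  also have "\<dots> = C * int j" using i by (simp add: of_nat_diff algebra_simps)
  finally show "r + r' \<le> C * int j" .
qed

lemma T_ord_ge_power:
  assumes "T_ord_ge C r a" shows "T_ord_ge C (int n * r) (a ^ n :: 'a::comm_ring_1 fps)"
proof (induction n)
  case (Suc n)
  then show ?case using T_ord_ge_mult[OF assms Suc] by (simp add: algebra_simps)
qed (simp add: T_ord_ge_def)

text \<open>
  The Newton polygon of \<open>P\<close> lies on or above the line with slope \<open>\<rho> / C\<close> and intercept \<open>\<kappa> / C\<close>. For a
  fixed slope, intercepts add up under multiplication.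
\<close>

definition slope_ge :: "int \<Rightarrow> int \<Rightarrow> int \<Rightarrow> 'a::zero fps fps \<Rightarrow> bool" where
  "slope_ge C \<rho> \<kappa> P \<longleftrightarrow> (\<forall>m. T_ord_ge C (\<rho> * int m + \<kappa>) (fps_nth P m))"

lemma slope_ge_mono: "slope_ge C \<rho> \<kappa> P \<Longrightarrow> \<kappa>' \<le> \<kappa> \<Longrightarrow> slope_ge C \<rho> \<kappa>' P"
  by (auto simp: slope_ge_def intro: T_ord_ge_mono)

lemma slope_ge_1: "slope_ge C \<rho> 0 (1 :: 'a::comm_ring_1 fps fps)"
  by (auto simp: slope_ge_def T_ord_ge_def)

lemma slope_ge_mult:
  assumes "slope_ge C \<rho> \<kappa> P" "slope_ge C \<rho> \<kappa>' Q"
  shows "slope_ge C \<rho> (\<kappa> + \<kappa>') (P * Q :: 'a::comm_ring_1 fps fps)"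
  unfolding slope_ge_def fps_mult_nth
proof (intro allI T_ord_ge_sum)
  fix m i :: nat assume "i \<in> {0..m}"
  then have e: "\<rho> * int m + (\<kappa> + \<kappa>') = (\<rho> * int i + \<kappa>) + (\<rho> * int (m - i) + \<kappa>')"
    by (simp add: of_nat_diff algebra_simps)
  show "T_ord_ge C (\<rho> * int m + (\<kappa> + \<kappa>')) (fps_nth P i * fps_nth Q (m - i))"
    unfolding e by (rule T_ord_ge_mult) (use assms in \<open>auto simp: slope_ge_def\<close>)
qed

lemma slope_ge_prod:
  assumes "\<And>i. i \<in> A \<Longrightarrow> slope_ge C \<rho> (\<kappa> i) (g i)"
  shows "slope_ge C \<rho> (sum \<kappa> A) (prod g A :: 'a::comm_ring_1 fps fps)"
  using assms
  by (induction A rule: infinite_finite_induct) (auto intro: slope_ge_1 slope_ge_mult)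

lemma slope_ge_sum:
  assumes "\<And>i. i \<in> A \<Longrightarrow> slope_ge C \<rho> \<kappa> (g i)"
  shows "slope_ge C \<rho> \<kappa> (sum g A :: 'a::comm_ring_1 fps fps)"
  using assms by (auto simp: slope_ge_def fps_sum_nth intro: T_ord_ge_sum)

text \<open>
  Each entry of \<open>1 - s M\<close> satisfies the slope estimate with the intercept
  \<open>w i - w j - (if w i < R then R else 0)\<close>: the constant term \<open>1\<close> occurs only for \<open>i = j\<close>, and the
  coefficient of \<open>s\<close> has order at least \<open>(w i - w j) + w i - c\<close>, which suffices if \<open>w i \<ge> R\<close>, and
  otherwise because of the correction. In each term of the Leibniz expansion
  the differences \<open>w i - w (\<sigma> i)\<close> cancel. The remaining intercept depends only on the number of
  indices of small weight, not on the size of the matrix.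
\<close>

theorem slope_ge_det_char_mat:
  fixes M :: "nat \<Rightarrow> nat \<Rightarrow> 'a::comm_ring_1 fps" and w :: "nat \<Rightarrow> int"
  assumes C: "C \<ge> 0" and q: "q \<ge> 2" and R: "R \<ge> 0" and w: "\<And>i. w i \<ge> 0"
    and M: "\<And>i j. i < n \<Longrightarrow> j < n \<Longrightarrow> T_ord_ge C (q * w i - w j - c) (M i j)"
  shows "slope_ge C (R - c) (- (R * int (card {i. i < n \<and> w i < R}))) (det (char_mat n M))"
proof -
  \<comment> \<open>The intercepts; the correction \<open>R\<close> is paid once for every index of weight below \<open>R\<close>.\<close>
  define \<kappa> where "\<kappa> i j = w i - w j - (if w i < R then R else 0)" for i j
  have entry: "slope_ge C (R - c) (\<kappa> i j) (char_mat n M $$ (i, j))" if "i < n" "j < n" for i j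
    unfolding slope_ge_def
  proof
    fix m :: nat
    have qw: "q * w i \<ge> 2 * w i" using q w by (intro mult_right_mono) auto
    consider "m = 0" | "m = 1" | "m \<ge> 2" by linarith
    then show "T_ord_ge C ((R - c) * int m + \<kappa> i j) (fps_nth (char_mat n M $$ (i, j)) m)"
    proof cases
      case 1
      then show ?thesis using that C R by (auto simp: char_mat_def \<kappa>_def intro!: T_ord_ge_nonpos)
    next
      case 2
      then have "fps_nth (char_mat n M $$ (i, j)) m = - M i j" using that by (simp add: char_mat_def)
      moreover have "(R - c) * int m + \<kappa> i j \<le> q * w i - w j - c"
        using 2 qw w[of i] by (auto simp: \<kappa>_def)
      ultimately show ?thesis using T_ord_ge_mono[OF M[OF that]] by simp
    next
      case 3
      then have "fps_nth (char_mat n M $$ (i, j)) m = 0" using that by (auto simp: char_mat_def fps_X_def)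
      then show ?thesis by simp
    qed
  qed
  show ?thesis
    unfolding det_def'[OF char_mat_carrier]
  proof (rule slope_ge_sum)
    fix p assume p: "p \<in> {p. p permutes {0..<n}}"
    then have pi: "i < n \<Longrightarrow> p i < n" for i using permutes_in_image[of p "{0..<n}" i] by auto
    let ?P = "\<Prod>i = 0..<n. char_mat n M $$ (i, p i)"
    have "slope_ge C (R - c) (\<Sum>i = 0..<n. \<kappa> i (p i)) ?P"
      by (rule slope_ge_prod) (use pi entry in auto)
    moreover have "(\<Sum>i = 0..<n. w (p i)) = (\<Sum>i = 0..<n. w i)"
      using sum.permute[of p "{0..<n}" w] p by (simp add: o_def)
    then have "(\<Sum>i = 0..<n. \<kappa> i (p i)) = - (\<Sum>i = 0..<n. if w i < R then R else 0)"
      by (simp add: \<kappa>_def sum_subtractf)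
    moreover have "(\<Sum>i = 0..<n. if w i < R then R else 0) = R * int (card {i. i < n \<and> w i < R})"
      by (simp add: sum.If_cases Int_def atLeast0LessThan)
    ultimately have "slope_ge C (R - c) (- (R * int (card {i. i < n \<and> w i < R}))) ?P" by simp
    then show "slope_ge C (R - c) (- (R * int (card {i. i < n \<and> w i < R}))) (signof p * ?P)"
      by (auto simp: sign_def slope_ge_def)
  qed
qed


section \<open>Laurent polynomials\<close>

definition wt :: "int ^ 'n::finite \<Rightarrow> int" where
  "wt v = (\<Sum>i\<in>UNIV. \<bar>v $ i\<bar>)"

lemma wt_nonneg [simp]: "wt v \<ge> 0"
  by (simp add: wt_def sum_nonneg)

lemma wt_0 [simp]: "wt 0 = 0"
  by (simp add: wt_def)

lemma wt_uminus [simp]: "wt (- v) = wt v"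
  by (simp add: wt_def)

lemma wt_add: "wt (u + v) \<le> wt u + wt v"
  unfolding wt_def sum.distrib[symmetric] by (intro sum_mono) (simp add: abs_triangle_ineq)

lemma wt_scale: "wt (c *s v) = \<bar>c\<bar> * wt v"
  by (simp add: wt_def sum_distrib_left abs_mult)

lemma wt_scale_diff: "c \<ge> 0 \<Longrightarrow> wt (c *s u - v) \<ge> c * wt u - wt v"
  using wt_add[of "c *s u - v" v] by (simp add: wt_scale)

lemma vecs_eq_image: "{x :: 'a ^ 'n::finite. \<forall>i. x $ i \<in> S} = vec_lambda ` (PiE UNIV (\<lambda>_. S))"
  by (force simp: image_iff intro!: bexI[of _ "vec_nth _"])

lemma finite_vecs: "finite S \<Longrightarrow> finite {x :: 'a ^ 'n::finite. \<forall>i. x $ i \<in> S}"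
  unfolding vecs_eq_image by (intro finite_imageI finite_PiE) auto

lemma card_vecs: "finite S \<Longrightarrow> card {x :: 'a ^ 'n::finite. \<forall>i. x $ i \<in> S} = card S ^ CARD('n)"
  unfolding vecs_eq_image by (subst card_image) (auto simp: card_PiE intro: inj_onI)

lemma finite_wt_le: "finite {v :: int ^ 'n::finite. wt v \<le> R}"
proof (rule finite_subset)
  show "{v :: int ^ 'n. wt v \<le> R} \<subseteq> {v. \<forall>i. v $ i \<in> {-R..R}}"
  proof safe
    fix v :: "int ^ 'n" and i assume "wt v \<le> R"
    moreover have "\<bar>v $ i\<bar> \<le> wt v" unfolding wt_def by (intro member_le_sum) auto
    ultimately show "v $ i \<in> {-R..R}" by auto
  qed
qed (rule finite_vecs, simp)

lemma finite_wt_less: "finite {v :: int ^ 'n::finite. wt v < R}"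
  by (rule finite_subset[OF _ finite_wt_le[of R]]) auto

lemma poly_mapping_monomials:
  "(P :: 'b \<Rightarrow>\<^sub>0 'a::comm_monoid_add) = (\<Sum>v\<in>Poly_Mapping.keys P. Poly_Mapping.single v (Poly_Mapping.lookup P v))"
  by (rule poly_mapping_eqI) (auto simp: lookup_sum lookup_single when_def in_keys_iff sum.delta)

lemma lookup_times_single:
  fixes P :: "'b::ab_group_add \<Rightarrow>\<^sub>0 'a::comm_ring_1"
  shows "Poly_Mapping.lookup (P * Poly_Mapping.single a c) v = Poly_Mapping.lookup P (v - a) * c"
proof -
  have "P * Poly_Mapping.single a c =
      (\<Sum>u\<in>Poly_Mapping.keys P. Poly_Mapping.single (u + a) (Poly_Mapping.lookup P u * c))"
    by (subst poly_mapping_monomials[of P]) (simp add: sum_distrib_right mult_single)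
  then have "Poly_Mapping.lookup (P * Poly_Mapping.single a c) v =
      (\<Sum>u\<in>Poly_Mapping.keys P. if u = v - a then Poly_Mapping.lookup P u * c else 0)"
    by (simp only: lookup_sum lookup_single when_def) (rule sum.cong, auto simp: eq_diff_eq)
  then show ?thesis by (simp only: sum.delta[OF finite_keys]) (simp add: in_keys_iff)
qed

lemma lookup_times_sum_singles:
  fixes P :: "'b::ab_group_add \<Rightarrow>\<^sub>0 'a::comm_ring_1"
  shows "Poly_Mapping.lookup (P * (\<Sum>w\<in>A. Poly_Mapping.single (g w) (c w))) v =
    (\<Sum>w\<in>A. Poly_Mapping.lookup P (v - g w) * c w)"
  by (simp add: sum_distrib_left lookup_sum lookup_times_single)

lemma lookup_times:
  fixes P :: "'b::ab_group_add \<Rightarrow>\<^sub>0 'a::comm_ring_1"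
  shows "Poly_Mapping.lookup (P * Q) v = (\<Sum>w\<in>Poly_Mapping.keys Q. Poly_Mapping.lookup P (v - w) * Poly_Mapping.lookup Q w)"
  by (subst (1) poly_mapping_monomials[of Q], rule lookup_times_sum_singles)

definition monom_at :: "'a::field ^ 'n::finite \<Rightarrow> int ^ 'n \<Rightarrow> 'a" where
  "monom_at x u = (\<Prod>i\<in>UNIV. (x $ i) powi (u $ i))"

definition laurent_at :: "(int ^ 'n::finite \<Rightarrow>\<^sub>0 'a::field fps) \<Rightarrow> 'a ^ 'n \<Rightarrow> 'a fps" where
  "laurent_at P x = (\<Sum>v\<in>Poly_Mapping.keys P. Poly_Mapping.lookup P v * fps_const (monom_at x v))"

definition in_torus :: "'a::field ^ 'n \<Rightarrow> bool" where
  "in_torus x \<longleftrightarrow> (\<forall>i. x $ i \<noteq> 0)"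

lemma monom_at_0 [simp]: "monom_at x 0 = 1"
  by (simp add: monom_at_def)

lemma monom_at_add: "in_torus x \<Longrightarrow> monom_at x (u + v) = monom_at x u * monom_at x v"
  by (simp add: monom_at_def in_torus_def power_int_add prod.distrib)

lemma monom_at_scale: "monom_at x (int c *s u) = monom_at x u ^ c"
proof -
  have "(x $ i) powi (int c * u $ i) = ((x $ i) powi (u $ i)) ^ c" for i
    by (metis mult.commute power_int_mult power_int_of_nat)
  then show ?thesis by (simp add: monom_at_def prod_power_distrib)
qed

lemma monom_at_frob: "monom_at (\<chi> i. x $ i ^ c) u = monom_at x u ^ c"
proof -
  have "(x $ i ^ c) powi (u $ i) = ((x $ i) powi (u $ i)) ^ c" for i
    by (metis mult.commute power_int_mult power_int_of_nat)
  then show ?thesis by (simp add: monom_at_def prod_power_distrib)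
qed

lemma laurent_at_superset:
  assumes "finite A" "Poly_Mapping.keys P \<subseteq> A"
  shows "laurent_at P x = (\<Sum>v\<in>A. Poly_Mapping.lookup P v * fps_const (monom_at x v))"
  unfolding laurent_at_def using assms by (intro sum.mono_neutral_left) (auto simp: in_keys_iff)

lemma laurent_at_single: "laurent_at (Poly_Mapping.single v c) x = c * fps_const (monom_at x v)"
  by (subst laurent_at_superset[of "{v}"]) auto

lemma laurent_at_add: "laurent_at (P + Q) x = laurent_at P x + laurent_at Q x"
proof -
  let ?A = "Poly_Mapping.keys P \<union> Poly_Mapping.keys Q"
  have "Poly_Mapping.keys (P + Q) \<subseteq> ?A" by (rule keys_add)
  then show ?thesis
    by (simp add: laurent_at_superset[of ?A] lookup_add distrib_right sum.distrib)
qed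

lemma laurent_at_sum: "laurent_at (sum g A) x = (\<Sum>i\<in>A. laurent_at (g i) x)"
  by (induction A rule: infinite_finite_induct) (simp_all add: laurent_at_add laurent_at_def[of 0])

lemma laurent_at_mult:
  assumes "in_torus x" shows "laurent_at (P * Q) x = laurent_at P x * laurent_at Q x"
proof -
  have "P * Q = (\<Sum>u\<in>Poly_Mapping.keys P. \<Sum>v\<in>Poly_Mapping.keys Q.
      Poly_Mapping.single (u + v) (Poly_Mapping.lookup P u * Poly_Mapping.lookup Q v))"
    by (subst poly_mapping_monomials[of P], subst poly_mapping_monomials[of Q])
       (simp add: sum_product mult_single)
  then have "laurent_at (P * Q) x = (\<Sum>u\<in>Poly_Mapping.keys P. \<Sum>v\<in>Poly_Mapping.keys Q.
      Poly_Mapping.lookup P u * Poly_Mapping.lookup Q v * fps_const (monom_at x u * monom_at x v))"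
    by (simp add: laurent_at_sum laurent_at_single monom_at_add[OF assms])
  then show ?thesis
    by (simp add: laurent_at_def sum_product mult_ac flip: fps_const_mult)
qed

lemma laurent_at_1: "laurent_at 1 x = 1"
  using laurent_at_single[of 0 1 x] by simp

lemma laurent_at_prod:
  "in_torus x \<Longrightarrow> laurent_at (prod g A) x = (\<Prod>i\<in>A. laurent_at (g i) x)"
  by (induction A rule: infinite_finite_induct) (simp_all add: laurent_at_mult laurent_at_1)


section \<open>The trace formula\<close>

text \<open>
  Substitution of \<open>X ^ c\<close> for \<open>X\<close>.
\<close>

definition dilate :: "nat \<Rightarrow> (int ^ 'n::finite \<Rightarrow>\<^sub>0 'a::comm_ring_1) \<Rightarrow> (int ^ 'n \<Rightarrow>\<^sub>0 'a)" where
  "dilate c P = (\<Sum>w\<in>Poly_Mapping.keys P. Poly_Mapping.single (int c *s w) (Poly_Mapping.lookup P w))"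

text \<open>
  The product \<open>G(X) G(X ^ q) \<dots> G(X ^ q ^ (k - 1))\<close>, whose coefficients are the entries of the powers of
  the matrix \<open>M\<close>.
\<close>

fun orbit_prod :: "nat \<Rightarrow> (int ^ 'n::finite \<Rightarrow>\<^sub>0 'a::comm_ring_1) \<Rightarrow> nat \<Rightarrow> (int ^ 'n \<Rightarrow>\<^sub>0 'a)" where
  "orbit_prod q G 0 = 1"
| "orbit_prod q G (Suc k) = orbit_prod q G k * dilate (q ^ k) G"

lemma laurent_at_dilate: "laurent_at (dilate c P) x = laurent_at P (\<chi> i. x $ i ^ c)"
  by (simp add: dilate_def laurent_at_sum laurent_at_single monom_at_scale monom_at_frob laurent_at_def[of P])

lemma laurent_at_orbit_prod:
  "in_torus x \<Longrightarrow> laurent_at (orbit_prod q G k) x = (\<Prod>l<k. laurent_at G (\<chi> i. x $ i ^ (q ^ l)))"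
  by (induction k) (simp_all add: laurent_at_1 laurent_at_mult laurent_at_dilate)

lemma lookup_orbit_prod_Suc:
  "Poly_Mapping.lookup (orbit_prod q G (Suc k)) v =
     (\<Sum>w\<in>Poly_Mapping.keys G. Poly_Mapping.lookup (orbit_prod q G k) (v - int (q ^ k) *s w) * Poly_Mapping.lookup G w)"
  by (simp only: orbit_prod.simps dilate_def lookup_times_sum_singles)

context
  fixes G :: "int ^ 'n::finite \<Rightarrow>\<^sub>0 'a::comm_ring_1" and q :: nat and D :: int
  assumes q: "q \<ge> 2" and D: "\<forall>v\<in>Poly_Mapping.keys G. wt v \<le> D" and D0: "D \<ge> 0"
begin

text \<open>
  The exact bound would be \<open>D (1 + q + \<dots> + q ^ (k - 1))\<close>. The cruder one has the same form as the factor
  \<open>q ^ k - 1\<close> by which the box \<open>wt u \<le> D\<close> gets dilated in the trace.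
\<close>

lemma orbit_prod_support:
  "Poly_Mapping.lookup (orbit_prod q G k) v \<noteq> 0 \<Longrightarrow> wt v \<le> D * (int q ^ k - 1)"
proof (induction k arbitrary: v)
  case 0 then show ?case by (auto simp: lookup_one when_def split: if_splits)
next
  case (Suc k)
  then obtain w where w: "w \<in> Poly_Mapping.keys G"
    "Poly_Mapping.lookup (orbit_prod q G k) (v - int (q ^ k) *s w) \<noteq> 0"
    unfolding lookup_orbit_prod_Suc by (metis (no_types, lifting) mult_zero_left sum.neutral)
  have "wt v \<le> wt (v - int (q ^ k) *s w) + wt (int (q ^ k) *s w)"
    using wt_add[of "v - int (q ^ k) *s w" "int (q ^ k) *s w"] by simp
  also have "\<dots> \<le> D * (int q ^ k - 1) + int q ^ k * D"
    using Suc.IH[OF w(2)] mult_left_mono[OF bspec[OF D w(1)], of "int q ^ k"] by (simp add: wt_scale)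
  also have "\<dots> = D * (2 * int q ^ k - 1)" by (simp add: algebra_simps)
  also have "\<dots> \<le> D * (int q ^ Suc k - 1)"
  proof (rule mult_left_mono[OF _ D0])
    have "2 * int q ^ k \<le> int q * int q ^ k" using q by (intro mult_right_mono) auto
    then show "2 * int q ^ k - 1 \<le> int q ^ Suc k - 1" by simp
  qed
  finally show ?case .
qed

text \<open>
  In the sum for the coefficient at \<open>q ^ (k + 1) u - v\<close> the exponents of \<open>G\<close> are written as \<open>q u - w\<close>; then
  the exponents left over for the product of length \<open>k\<close> become \<open>q ^ k w - v\<close>. If \<open>v\<close> is in the box
  \<open>wt v \<le> D\<close>, the support bound forces \<open>w\<close> into the same box, so the box carries the whole matrix power.
\<close>

lemma orbit_prod_matrix_step:
  assumes v: "wt v \<le> D"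
  shows "Poly_Mapping.lookup (orbit_prod q G (Suc k)) (int (q ^ Suc k) *s u - v) =
    (\<Sum>w | wt w \<le> D. Poly_Mapping.lookup G (int q *s u - w) * Poly_Mapping.lookup (orbit_prod q G k) (int (q ^ k) *s w - v))"
proof -
  let ?g = "\<lambda>w. int q *s u - w"
  let ?t = "\<lambda>w. Poly_Mapping.lookup G (?g w) * Poly_Mapping.lookup (orbit_prod q G k) (int (q ^ k) *s w - v)"
  let ?S = "?g ` Poly_Mapping.keys G"
  have shift: "int (q ^ Suc k) *s u - v - int (q ^ k) *s w = int (q ^ k) *s (?g w) - v" for w
    by (intro Finite_Cartesian_Product.vec_eq_iff[THEN iffD2] allI, simp only: vector_minus_component vector_smult_component)
       (simp add: algebra_simps)
  have "Poly_Mapping.lookup (orbit_prod q G (Suc k)) (int (q ^ Suc k) *s u - v) = (\<Sum>w\<in>Poly_Mapping.keys G. ?t (?g w))"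
    unfolding lookup_orbit_prod_Suc shift by (simp add: mult.commute)
  also have "\<dots> = (\<Sum>w\<in>?S. ?t w)"
    by (subst sum.reindex) (auto intro: inj_onI)
  also have "\<dots> = (\<Sum>w\<in>?S \<union> {w. wt w \<le> D}. ?t w)"
  proof (rule sum.mono_neutral_left)
    show "\<forall>w\<in>?S \<union> {w. wt w \<le> D} - ?S. ?t w = 0"
    proof
      fix w assume "w \<in> ?S \<union> {w. wt w \<le> D} - ?S"
      moreover have "w = ?g (?g w)" by simp
      ultimately have "?g w \<notin> Poly_Mapping.keys G" by blast
      then show "?t w = 0" by (simp add: in_keys_iff)
    qed
  qed (auto simp: finite_wt_le)
  also have "\<dots> = (\<Sum>w | wt w \<le> D. ?t w)"
  proof (rule sum.mono_neutral_right)
    show "\<forall>w\<in>?S \<union> {w. wt w \<le> D} - {w. wt w \<le> D}. ?t w = 0"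
    proof
      fix w assume "w \<in> ?S \<union> {w. wt w \<le> D} - {w. wt w \<le> D}"
      then have w: "D + 1 \<le> wt w" by auto
      have "Poly_Mapping.lookup (orbit_prod q G k) (int (q ^ k) *s w - v) = 0"
      proof (rule ccontr)
        assume "Poly_Mapping.lookup (orbit_prod q G k) (int (q ^ k) *s w - v) \<noteq> 0"
        from orbit_prod_support[OF this] wt_scale_diff[of "int (q ^ k)" w v]
        have "int q ^ k * wt w \<le> D * (int q ^ k - 1) + wt v" by simp
        moreover have "int q ^ k * (D + 1) \<le> int q ^ k * wt w" using w by (intro mult_left_mono) auto
        moreover have "int q ^ k > 0" using q by simp
        ultimately show False using v by (simp add: algebra_simps)
      qed
      then show "?t w = 0" by simp
    qed
  qed (auto simp: finite_wt_le)
  finally show ?thesis .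
qed

lemma orbit_prod_multiples:
  assumes k: "k > 0"
  shows "(\<Sum>v\<in>{v \<in> Poly_Mapping.keys (orbit_prod q G k). \<forall>i. int (q ^ k - 1) dvd v $ i}. Poly_Mapping.lookup (orbit_prod q G k) v)
    = (\<Sum>u | wt u \<le> D. Poly_Mapping.lookup (orbit_prod q G k) (int (q ^ k) *s u - u))"
proof -
  let ?c = "int (q ^ k - 1)" and ?P = "orbit_prod q G k"
  have "q ^ k > 1" using q k by (intro one_less_power) auto
  moreover have "int q ^ k > 1" using q k by (intro one_less_power) auto
  ultimately have c: "?c > 0" "?c = int q ^ k - 1" by (auto simp: of_nat_diff)
  have mult: "int (q ^ k) *s u - u = ?c *s u" for u :: "int ^ 'n"
    unfolding c(2)
    by (intro Finite_Cartesian_Product.vec_eq_iff[THEN iffD2] allI, simp only: vector_minus_component vector_smult_component)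
       (simp add: algebra_simps)
  have "(\<Sum>v\<in>{v \<in> Poly_Mapping.keys ?P. \<forall>i. ?c dvd v $ i}. Poly_Mapping.lookup ?P v)
      = (\<Sum>v\<in>(\<lambda>u. ?c *s u) ` {u. wt u \<le> D}. Poly_Mapping.lookup ?P v)"
  proof (rule sum.mono_neutral_left)
    show "{v \<in> Poly_Mapping.keys ?P. \<forall>i. ?c dvd v $ i} \<subseteq> (\<lambda>u. ?c *s u) ` {u. wt u \<le> D}"
    proof
      fix v assume v: "v \<in> {v \<in> Poly_Mapping.keys ?P. \<forall>i. ?c dvd v $ i}"
      define u where "u = (\<chi> i. v $ i div ?c)"
      have vu: "v = ?c *s u" using v by (simp add: Finite_Cartesian_Product.vec_eq_iff u_def)
      have "wt v \<le> D * ?c"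
        using orbit_prod_support[of k v] v unfolding c(2) by (simp add: in_keys_iff)
      moreover have "wt v = ?c * wt u" unfolding vu wt_scale using c(1) by (simp only: abs_of_pos)
      ultimately have "?c * wt u \<le> ?c * D" by (simp only: mult.commute)
      then have "wt u \<le> D" using c by simp
      then show "v \<in> (\<lambda>u. ?c *s u) ` {u. wt u \<le> D}" using vu by blast
    qed
  qed (auto simp: finite_wt_le in_keys_iff)
  also have "\<dots> = (\<Sum>u | wt u \<le> D. Poly_Mapping.lookup ?P (?c *s u))"
  proof (subst sum.reindex)
    have "int q ^ k \<noteq> 1" using c by linarith
    then show "inj_on (\<lambda>u :: int ^ 'n. ?c *s u) {u. wt u \<le> D}"
      unfolding c(2) by (auto intro!: inj_onI simp: Finite_Cartesian_Product.vec_eq_iff)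
  qed simp
  finally show ?thesis unfolding mult .
qed

end

text \<open>
  The points \<open>X\<close> behave like the \<open>N\<close>-torsion of the torus: a monomial sums to zero over \<open>X\<close> unless
  its exponents are divisible by \<open>N\<close>.
\<close>

definition orthogonal_on :: "('a::field ^ 'n::finite) set \<Rightarrow> nat \<Rightarrow> bool" where
  "orthogonal_on X N \<longleftrightarrow> (\<forall>x\<in>X. in_torus x) \<and>
     (\<forall>v. (\<Sum>x\<in>X. monom_at x v) = (if \<forall>i. int N dvd v $ i then of_nat (card X) else 0))"

text \<open>
  The trace formula for a Laurent polynomial. The series \<open>E\<close> is the determinant \<open>det (1 - s M)\<close> of the finite
  matrix on the box that contains the support of \<open>G\<close>, and \<open>\<tau> k\<close> is the trace of \<open>M ^ k\<close>. The slope estimate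
  depends on \<open>G\<close> only through \<open>C\<close> and \<open>c\<close>, which makes it uniform in families.
\<close>

theorem trace_formula:
  fixes G :: "int ^ 'n::finite \<Rightarrow>\<^sub>0 'a::field_char_0 fps"
  assumes q: "q \<ge> 2" and Z: "is_subring Z" and C: "C \<ge> 0"
    and GZ: "\<And>v. Poly_Mapping.lookup G v \<in> fps_over Z"
    and GC: "\<And>v. T_ord_ge C (wt v - c) (Poly_Mapping.lookup G v)"
  obtains \<tau> E where
    "E \<in> fps_over (fps_over Z)"
    "\<And>R. R \<ge> 0 \<Longrightarrow> slope_ge C (R - c) (- (R * int (card {u :: int ^ 'n. wt u < R}))) E"
    "E = exp_series (Abs_fps (\<lambda>k. if k = 0 then 0 else - (fps_const (1 / of_nat k) * \<tau> k)))"
    "\<And>k X. k > 0 \<Longrightarrow> orthogonal_on X (q ^ k - 1) \<Longrightarrow>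
       (\<Sum>x\<in>X. \<Prod>l<k. laurent_at G (\<chi> i. x $ i ^ (q ^ l))) = of_nat (card X) * \<tau> k"
proof -
  \<comment> \<open>Any bound for the weights on the support of \<open>G\<close> will do, and the sum is one.\<close>
  define D where "D = (\<Sum>v\<in>Poly_Mapping.keys G. wt v)"
  have D0: "D \<ge> 0" by (simp add: D_def sum_nonneg)
  have D: "\<forall>v\<in>Poly_Mapping.keys G. wt v \<le> D"
    unfolding D_def by (intro ballI member_le_sum) auto
  let ?B = "{u :: int ^ 'n. wt u \<le> D}"
  obtain b where b: "bij_betw b {..<card ?B} ?B"
    using ex_bij_betw_nat_finite[OF finite_wt_le, of D] by (auto simp: atLeast0LessThan)
  let ?N = "card ?B"
  have bD: "i < ?N \<Longrightarrow> wt (b i) \<le> D" for i using bij_betwE[OF b] by auto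
  have binj: "i < ?N \<Longrightarrow> j < ?N \<Longrightarrow> b i = b j \<longleftrightarrow> i = j" for i j
    using b by (auto simp: bij_betw_def inj_on_eq_iff)
  define M where "M i j = Poly_Mapping.lookup G (int q *s b i - b j)" for i j
  define Pw where "Pw k i j = Poly_Mapping.lookup (orbit_prod q G k) (int (q ^ k) *s b i - b j)" for k i j
  define \<tau> where "\<tau> k = (\<Sum>i<?N. Pw k i i)" for k
  let ?E = "det (char_mat ?N M)"
  show thesis
  proof (rule that[of ?E \<tau>])
    show "?E \<in> fps_over (fps_over Z)"
      by (rule det_char_mat_over[OF is_subring_fps_over[OF Z]]) (simp add: M_def GZ)
    show "?E = exp_series (Abs_fps (\<lambda>k. if k = 0 then 0 else - (fps_const (1 / of_nat k) * \<tau> k)))"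
      unfolding \<tau>_def
    proof (rule det_char_mat_eq_exp[where Pw = Pw])
      fix i j assume ij: "i < ?N" "j < ?N"
      show "Pw 0 i j = (if i = j then 1 else 0)"
        using binj[OF ij] by (simp add: Pw_def lookup_one when_def)
    next
      fix k i j assume ij: "i < ?N" "j < ?N"
      show "Pw (Suc k) i j = (\<Sum>l<?N. M i l * Pw k l j)"
      proof -
        note step = orbit_prod_matrix_step[OF q D D0 bD[OF ij(2)], of k "b i"]

        show ?thesis
          unfolding Pw_def M_def step by (rule sum.reindex_bij_betw[OF b, symmetric])
      qed
    qed
    show "slope_ge C (R - c) (- (R * int (card {u :: int ^ 'n. wt u < R}))) ?E" if R: "R \<ge> 0" for R
    proof (rule slope_ge_mono)
      show "slope_ge C (R - c) (- (R * int (card {i. i < ?N \<and> wt (b i) < R}))) ?E"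
      proof (rule slope_ge_det_char_mat[OF C, of "int q"])
        fix i j
        show "T_ord_ge C (int q * wt (b i) - wt (b j) - c) (M i j)"
          unfolding M_def using wt_scale_diff[of "int q" "b i" "b j"] by (intro T_ord_ge_mono[OF GC]) auto
      qed (use q R in auto)
      have "card {i. i < ?N \<and> wt (b i) < R} = card (b ` {i. i < ?N \<and> wt (b i) < R})"
        by (rule card_image[symmetric]) (auto intro!: inj_onI simp: binj)
      also have "\<dots> \<le> card {u :: int ^ 'n. wt u < R}"
        by (rule card_mono[OF finite_wt_less]) auto
      finally show "- (R * int (card {u :: int ^ 'n. wt u < R})) \<le> - (R * int (card {i. i < ?N \<and> wt (b i) < R}))"
        using R by (simp add: mult_left_mono)
    qed
    show "(\<Sum>x\<in>X. \<Prod>l<k. laurent_at G (\<chi> i. x $ i ^ (q ^ l))) = of_nat (card X) * \<tau> k"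
      if k: "k > 0" and X: "orthogonal_on X (q ^ k - 1)" for k X
    proof -
      let ?P = "orbit_prod q G k" and ?div = "\<lambda>v :: int ^ 'n. \<forall>i. int (q ^ k - 1) dvd v $ i"
      have "(\<Sum>x\<in>X. \<Prod>l<k. laurent_at G (\<chi> i. x $ i ^ (q ^ l))) = (\<Sum>x\<in>X. laurent_at ?P x)"
        using X by (intro sum.cong) (auto simp: orthogonal_on_def laurent_at_orbit_prod)
      also have "\<dots> = (\<Sum>v\<in>Poly_Mapping.keys ?P. Poly_Mapping.lookup ?P v * fps_const (\<Sum>x\<in>X. monom_at x v))"
      proof -
        have "fps_const (\<Sum>x\<in>X. monom_at x v) = (\<Sum>x\<in>X. fps_const (monom_at x v))" for v
          by (rule fps_ext) (simp add: fps_sum_nth)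
        then show ?thesis
          unfolding laurent_at_def by (subst sum.swap) (simp add: sum_distrib_left)
      qed
      also have "\<dots> = (\<Sum>v\<in>Poly_Mapping.keys ?P. if ?div v then of_nat (card X) * Poly_Mapping.lookup ?P v else 0)"
        using X by (intro sum.cong) (auto simp: orthogonal_on_def fps_of_nat mult.commute)
      also have "\<dots> = of_nat (card X) * (\<Sum>v\<in>{v \<in> Poly_Mapping.keys ?P. ?div v}. Poly_Mapping.lookup ?P v)"
        by (simp add: sum.If_cases sum_distrib_left Int_def)
      also have "(\<Sum>v\<in>{v \<in> Poly_Mapping.keys ?P. ?div v}. Poly_Mapping.lookup ?P v) = \<tau> k"
        unfolding orbit_prod_multiples[OF q D D0 k] \<tau>_def Pw_def
        by (rule sum.reindex_bij_betw[OF b, symmetric])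
      finally show ?thesis .
    qed
  qed
qed


section \<open>Entire series from their truncations\<close>

text \<open>
  The numerators and denominators that occur: \<open>T\<close>-adic entire, with constant term 1 and all
  coefficients, with respect to \<open>s\<close> and \<open>T\<close>, in \<open>Z\<close>. The estimate for every slope, with a suitable intercept, is stable under products.
\<close>

definition T_entire_over :: "int \<Rightarrow> 'a::comm_ring_1 set \<Rightarrow> 'a fps fps \<Rightarrow> bool" where
  "T_entire_over C Z A \<longleftrightarrow> fps_nth A 0 = 1 \<and> A \<in> fps_over (fps_over Z) \<and> (\<forall>\<rho>. \<exists>\<kappa>. slope_ge C \<rho> \<kappa> A)"

lemma slope_ge_mono_slope:
  assumes "slope_ge C \<rho> \<kappa> A" "\<rho>' \<le> \<rho>" shows "slope_ge C \<rho>' \<kappa> A"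
  unfolding slope_ge_def
proof
  fix m :: nat
  have "\<rho>' * int m \<le> \<rho> * int m" using assms(2) by (intro mult_right_mono) auto
  then show "T_ord_ge C (\<rho>' * int m + \<kappa>) (fps_nth A m)"
    using assms(1) by (auto simp: slope_ge_def intro: T_ord_ge_mono)
qed

lemma T_entire_over_1: "is_subring Z \<Longrightarrow> T_entire_over C Z 1"
  using slope_ge_1 subring_1[OF is_subring_fps_over[OF is_subring_fps_over]]
  by (auto simp: T_entire_over_def)

lemma T_entire_over_mult:
  assumes Z: "is_subring Z" and "T_entire_over C Z A" "T_entire_over C Z B"
  shows "T_entire_over C Z (A * B)"
  using assms(2,3) subring_mult[OF is_subring_fps_over[OF is_subring_fps_over[OF Z]], of A B]
  unfolding T_entire_over_def by (auto intro: slope_ge_mult) (meson slope_ge_mult)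

lemma T_entire_over_power:
  "is_subring Z \<Longrightarrow> T_entire_over C Z A \<Longrightarrow> T_entire_over C Z (A ^ n)"
  by (induction n) (auto intro: T_entire_over_1 T_entire_over_mult)

lemma T_entire_over_prod:
  "is_subring Z \<Longrightarrow> (\<And>i. i \<in> I \<Longrightarrow> T_entire_over C Z (A i)) \<Longrightarrow> T_entire_over C Z (prod A I)"
  by (induction I rule: infinite_finite_induct) (auto intro: T_entire_over_1 T_entire_over_mult)

lemma T_entire_over_imp_T_adic_entire:
  assumes C: "C > 0" and A: "T_entire_over C Z A"
  shows "T_adic_entire A"
  unfolding T_adic_entire_def tendsto_PInfty
proof
  fix r :: real
  \<comment> \<open>A slope larger than \<open>r\<close> by 1 absorbs the intercept as soon as \<open>i > \<bar>\<kappa>\<bar>\<close>.\<close>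
  obtain \<kappa> where \<kappa>: "slope_ge C (C * (\<lceil>r\<rceil> + 1)) \<kappa> A" using A unfolding T_entire_over_def by blast
  have "ereal r < ord_T (fps_nth A i) / ereal (real i)" if i: "i > nat \<bar>\<kappa>\<bar>" for i
  proof (cases "fps_nth A i = 0")
    case True
    then show ?thesis using i by (simp add: ord_T_def)
  next
    case False
    let ?s = "subdegree (fps_nth A i)"
    have "fps_nth (fps_nth A i) ?s \<noteq> 0" using False by simp
    then have "C * (\<lceil>r\<rceil> + 1) * int i + \<kappa> \<le> C * int ?s"
      using \<kappa> unfolding slope_ge_def by (blast dest: T_ord_geD)
    moreover have "C * int i > - \<kappa>"
    proof -
      have "- \<kappa> < int i" using i by linarith
      also have "int i \<le> C * int i" using C mult_right_mono[of 1 C "int i"] by simp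
      finally show ?thesis .
    qed
    ultimately have "C * (\<lceil>r\<rceil> * int i) < C * int ?s" by (simp add: algebra_simps)
    then have "\<lceil>r\<rceil> * int i < int ?s" using C by simp
    then have "real_of_int (\<lceil>r\<rceil> * int i) < real ?s" by linarith
    moreover have "r * real i \<le> real_of_int (\<lceil>r\<rceil> * int i)" by (simp add: mult_right_mono)
    ultimately have "r * real i < real ?s" by linarith
    then have "r < real ?s / real i"
      using i by (simp add: pos_less_divide_eq)
    moreover have "i > 0" using i by simp
    ultimately show ?thesis using False by (simp add: ord_T_def)
  qed
  then show "\<forall>\<^sub>F i in sequentially. ereal r < ord_T (fps_nth A i) / ereal (real i)"
    by (intro eventually_sequentiallyI[of "Suc (nat \<bar>\<kappa>\<bar>)"]) auto
qed

definition T_cong :: "nat \<Rightarrow> 'a fps \<Rightarrow> 'a fps \<Rightarrow> bool" where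
  "T_cong h a b \<longleftrightarrow> (\<forall>j<h. fps_nth a j = fps_nth b j)"

lemma T_cong_refl [simp]: "T_cong h a a"
  by (simp add: T_cong_def)

lemma T_cong_mult: "T_cong h a b \<Longrightarrow> T_cong h c d \<Longrightarrow> T_cong h (a * c) (b * d :: 'a::comm_ring_1 fps)"
  by (auto simp: T_cong_def fps_mult_nth intro!: sum.cong)

lemma T_cong_prod: "(\<And>i. i \<in> A \<Longrightarrow> T_cong h (f i) (g i)) \<Longrightarrow> T_cong h (prod f A) (prod g A :: 'a::comm_ring_1 fps)"
  by (induction A rule: infinite_finite_induct) (auto intro: T_cong_mult)

lemma T_cong_sum: "(\<And>i. i \<in> A \<Longrightarrow> T_cong h (f i) (g i)) \<Longrightarrow> T_cong h (sum f A) (sum g A :: 'a::comm_ring_1 fps)"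
  by (auto simp: T_cong_def fps_sum_nth intro!: sum.cong)

text \<open>
  The logarithm of a determinant \<open>det (1 - s M)\<close> in terms of the traces \<open>\<tau> k\<close> of the powers \<open>M ^ k\<close>.
\<close>

definition log_det :: "(nat \<Rightarrow> 'a::field_char_0 fps) \<Rightarrow> 'a fps fps" where
  "log_det \<tau> = Abs_fps (\<lambda>k. if k = 0 then 0 else - (fps_const (1 / of_nat k) * \<tau> k))"

lemma log_det_0 [simp]: "fps_nth (log_det \<tau>) 0 = 0"
  by (simp add: log_det_def)

text \<open>
  A coefficient of \<open>T ^ j\<close> depends only on the traces modulo \<open>T ^ (j + 1)\<close>, so it is a coefficient of one of
  the approximating determinants \<open>E\<close>. Integrality and the slope estimates can therefore be read off from
  these, provided that the intercepts \<open>\<beta> R\<close> are the same for all of them.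
\<close>

theorem entire_of_truncations:
  fixes P :: "nat \<Rightarrow> 'a::field_char_0 fps" and \<beta> :: "int \<Rightarrow> int"
  assumes trunc: "\<And>h. \<exists>E \<tau>. E \<in> fps_over (fps_over Z) \<and> (\<forall>R\<ge>0. slope_ge C (R - c) (\<beta> R) E) \<and>
      E = exp_series (log_det \<tau>) \<and> (\<forall>k>0. T_cong h (\<tau> k) (P k))"
  shows "T_entire_over C Z (exp_series (log_det P))"
proof -
  let ?A = "exp_series (log_det P)"
  have approx: "\<exists>E. E \<in> fps_over (fps_over Z) \<and> (\<forall>R\<ge>0. slope_ge C (R - c) (\<beta> R) E) \<and>
      fps_nth (fps_nth ?A m) j = fps_nth (fps_nth E m) j" for m j
  proof -
    obtain E \<tau> where E: "E \<in> fps_over (fps_over Z)" "\<forall>R\<ge>0. slope_ge C (R - c) (\<beta> R) E"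
      "E = exp_series (log_det \<tau>)" "\<forall>k>0. T_cong (Suc j) (\<tau> k) (P k)" using trunc by blast
    have "fps_nth (fps_nth ?A m) j = fps_nth (fps_nth E m) j"
      unfolding E(3)
      by (rule exp_series_cong_T[where h = "Suc j"]) (use E(4) in \<open>auto simp: T_cong_def log_det_def\<close>)
    then show ?thesis using E by blast
  qed
  have "?A \<in> fps_over (fps_over Z)"
    by (intro fps_overI) (metis approx fps_overD)
  moreover have "\<exists>\<kappa>. slope_ge C \<rho> \<kappa> ?A" for \<rho>
  proof -
    \<comment> \<open>The estimate with parameter \<open>R\<close> has slope \<open>R - c\<close>.\<close>
    define R where "R = max 0 (\<rho> + c)"
    have "slope_ge C (R - c) (\<beta> R) ?A"
      unfolding slope_ge_def T_ord_ge_def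
    proof (intro allI impI)
      fix m j assume nz: "fps_nth (fps_nth ?A m) j \<noteq> 0"
      obtain E where E: "\<forall>R\<ge>0. slope_ge C (R - c) (\<beta> R) E" "fps_nth (fps_nth ?A m) j = fps_nth (fps_nth E m) j"
        using approx by blast
      have "slope_ge C (R - c) (\<beta> R) E" using E(1) by (simp add: R_def)
      then show "(R - c) * int m + \<beta> R \<le> C * int j"
        using nz E(2) by (auto simp: slope_ge_def T_ord_ge_def)
    qed
    then have "slope_ge C \<rho> (\<beta> R) ?A" by (rule slope_ge_mono_slope) (simp add: R_def)
    then show ?thesis by blast
  qed
  ultimately show ?thesis by (simp add: T_entire_over_def exp_series_nth_0)
qed


section \<open>The splitting of the exponential sums\<close>

definition laurent_growth :: "int \<Rightarrow> int \<Rightarrow> 'a::comm_ring_1 set \<Rightarrow> (int ^ 'n::finite \<Rightarrow>\<^sub>0 'a fps) \<Rightarrow> bool" where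
  "laurent_growth C c Z P \<longleftrightarrow>
     (\<forall>v. Poly_Mapping.lookup P v \<in> fps_over Z \<and> T_ord_ge C (wt v - c) (Poly_Mapping.lookup P v))"

lemma laurent_growth_single:
  assumes Z: "is_subring Z" and "x \<in> fps_over Z" "T_ord_ge C (wt v - c) x"
  shows "laurent_growth C c Z (Poly_Mapping.single v x)"
  using assms subring_0[OF is_subring_fps_over[OF Z]] by (auto simp: laurent_growth_def lookup_single when_def)

lemma laurent_growth_sum:
  assumes Z: "is_subring Z" and "\<And>i. i \<in> A \<Longrightarrow> laurent_growth C c Z (g i)"
  shows "laurent_growth C c Z (sum g A)"
  using assms(2) unfolding laurent_growth_def lookup_sum
  by (auto intro: subring_sum[OF is_subring_fps_over[OF Z]] T_ord_ge_sum)

lemma laurent_growth_mult: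
  fixes P Q :: "int ^ 'n::finite \<Rightarrow>\<^sub>0 'a::comm_ring_1 fps"
  assumes Z: "is_subring Z" and P: "laurent_growth C c Z P" and Q: "laurent_growth C c' Z Q"
  shows "laurent_growth C (c + c') Z (P * Q)"
  unfolding laurent_growth_def lookup_times
proof (intro allI conjI)
  note Y = is_subring_fps_over[OF Z]
  fix v
  show "(\<Sum>w\<in>Poly_Mapping.keys Q. Poly_Mapping.lookup P (v - w) * Poly_Mapping.lookup Q w) \<in> fps_over Z"
    using P Q by (intro subring_sum[OF Y] subring_mult[OF Y]) (auto simp: laurent_growth_def)
  show "T_ord_ge C (wt v - (c + c')) (\<Sum>w\<in>Poly_Mapping.keys Q. Poly_Mapping.lookup P (v - w) * Poly_Mapping.lookup Q w)"
  proof (rule T_ord_ge_sum)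
    fix w
    have "T_ord_ge C ((wt (v - w) - c) + (wt w - c')) (Poly_Mapping.lookup P (v - w) * Poly_Mapping.lookup Q w)"
      using P Q by (intro T_ord_ge_mult) (auto simp: laurent_growth_def)
    then show "T_ord_ge C (wt v - (c + c')) (Poly_Mapping.lookup P (v - w) * Poly_Mapping.lookup Q w)"
      using wt_add[of "v - w" w] by (elim T_ord_ge_mono) simp
  qed
qed

lemma laurent_growth_prod:
  assumes Z: "is_subring Z" and "\<And>i. i \<in> A \<Longrightarrow> laurent_growth C 0 Z (g i)"
  shows "laurent_growth C 0 Z (prod g A)"
proof -
  have "T_ord_ge C 0 (1 :: 'a fps)" by (simp add: T_ord_ge_def)
  then have 1: "laurent_growth C 0 Z (1 :: int ^ 'n::finite \<Rightarrow>\<^sub>0 'a fps)"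
    using laurent_growth_single[OF Z subring_1[OF is_subring_fps_over[OF Z]], of C 0 0] by simp
  show ?thesis
    using assms(2)
    by (induction A rule: infinite_finite_induct) (use 1 laurent_growth_mult[OF Z, of C 0 _ 0] in auto)
qed

text \<open>
  The series \<open>E(\<pi> * (b X ^ u) ^ p ^ i)\<close>, with \<open>E\<close> truncated to degree below \<open>h\<close> so that a Laurent polynomial results.
\<close>

definition splitting_factor :: "nat \<Rightarrow> nat \<Rightarrow> 'a::field_char_0 \<Rightarrow> int ^ 'n::finite \<Rightarrow> nat \<Rightarrow> (int ^ 'n \<Rightarrow>\<^sub>0 'a fps)" where
  "splitting_factor p h b u i = (\<Sum>j<h. Poly_Mapping.single (int (j * p ^ i) *s u)
     (fps_const (fps_nth (artin_hasse p) j * b ^ (j * p ^ i)) * ah_param p ^ j))"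

text \<open>
  The term of index \<open>j\<close> is divisible by \<open>T ^ j\<close>, because \<open>\<pi>\<close> is divisible by \<open>T\<close>, and its exponent
  \<open>j p ^ i u\<close> has weight at most \<open>C j\<close>.
\<close>

lemma splitting_factor_growth:
  assumes p: "prime p" and Z: "is_subring Z" and pZ: "p_integral p \<subseteq> Z" and b: "b \<in> Z"
    and C: "int (p ^ i) * wt u \<le> C"
  shows "laurent_growth C 0 Z (splitting_factor p h b u i)"
  unfolding splitting_factor_def
proof (rule laurent_growth_sum[OF Z], rule laurent_growth_single[OF Z])
  note Y = is_subring_fps_over[OF Z]
  fix j
  have "artin_hasse p \<in> fps_over Z" "ah_param p \<in> fps_over Z"
    using artin_hasse_integral[OF p] ah_param_integral[OF p] fps_over_mono[OF pZ] by auto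
  then show "fps_const (fps_nth (artin_hasse p) j * b ^ (j * p ^ i)) * ah_param p ^ j \<in> fps_over Z"
    by (intro subring_mult[OF Y] subring_power[OF Y] fps_const_over[OF Z] subring_mult[OF Z] subring_power[OF Z] b)
       (auto simp: fps_overD)
  have C0: "C \<ge> 0" using order_trans[OF _ C] by simp
  have "T_ord_ge C C (ah_param p :: 'a fps)"
    unfolding T_ord_ge_def
  proof (intro allI impI)
    fix m assume "fps_nth (ah_param p :: 'a fps) m \<noteq> 0"
    then have "m > 0" using ah_param_0 by (cases m) auto
    then show "C \<le> C * int m" using C0 mult_left_mono[of 1 "int m" C] by simp
  qed
  from T_ord_ge_mult[OF _ T_ord_ge_power[OF this], of 0]
  have "T_ord_ge C (0 + int j * C) (fps_const (fps_nth (artin_hasse p) j * b ^ (j * p ^ i)) * ah_param p ^ j)"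
    using C0 by (simp add: T_ord_ge_nonpos)
  moreover have "wt (int (j * p ^ i) *s u) - 0 \<le> 0 + int j * C"
    using mult_left_mono[OF C, of "int j"] by (simp add: wt_scale)
  ultimately show "T_ord_ge C (wt (int (j * p ^ i) *s u) - 0)
      (fps_const (fps_nth (artin_hasse p) j * b ^ (j * p ^ i)) * ah_param p ^ j)"
    by (rule T_ord_ge_mono)
qed

lemma laurent_at_splitting_factor:
  "T_cong h (laurent_at (splitting_factor p h b u i) x)
     (artin_hasse p oo (fps_const ((b * monom_at x u) ^ (p ^ i)) * ah_param p))"
proof -
  let ?g = "fps_const ((b * monom_at x u) ^ (p ^ i)) * ah_param p"
  have "laurent_at (splitting_factor p h b u i) x = (\<Sum>j<h. fps_const (fps_nth (artin_hasse p) j) * ?g ^ j)"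
    unfolding splitting_factor_def laurent_at_sum laurent_at_single monom_at_scale
    by (intro sum.cong refl)
       (simp add: power_mult_distrib fps_const_power mult_ac flip: power_mult fps_const_mult)
  then show ?thesis
    unfolding T_cong_def using fps_compose_truncate[of ?g _ h "artin_hasse p"] by (simp add: ah_param_0)
qed

lemma prod_lessThan_blocks:
  fixes F :: "nat \<Rightarrow> 'a::comm_monoid_mult"
  shows "(\<Prod>l<k. \<Prod>i<a. F (a * l + i)) = (\<Prod>j<a * k. F j)"
proof (induction k)
  case (Suc k)
  have "(\<Prod>j<m + a. F j) = (\<Prod>j<m. F j) * (\<Prod>i<a. F (m + i))" for m
    by (induction a) (simp_all add: mult.assoc)
  from this[of "a * k"] show ?case using Suc by (simp add: add.commute)
qed simp

text \<open>
  A Laurent polynomial congruent modulo \<open>T ^ h\<close> to \<open>N G\<close>, for the series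
  \<open>G = X ^ (-d) \<Prod>u. \<Prod>i<a. E(\<pi> * (b\<^sub>u X ^ u) ^ p ^ i)\<close>. The factor \<open>N\<close> will be a power of \<open>q\<close>; it produces
  \<open>A(N s)\<close> from \<open>A(s)\<close> without a separate argument about substitutions.
\<close>

definition splitting_poly ::
  "nat \<Rightarrow> nat \<Rightarrow> nat \<Rightarrow> nat \<Rightarrow> (int ^ 'n \<Rightarrow> 'a) \<Rightarrow> (int ^ 'n) set \<Rightarrow> int ^ 'n::finite \<Rightarrow> (int ^ 'n \<Rightarrow>\<^sub>0 'a::field_char_0 fps)" where
  "splitting_poly p a h N b U d =
     Poly_Mapping.single (- d) (of_nat N) * (\<Prod>u\<in>U. \<Prod>i<a. splitting_factor p h (b u) u i)"

lemma splitting_poly_growth: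
  assumes p: "prime p" and Z: "is_subring Z" and pZ: "p_integral p \<subseteq> Z"
    and b: "\<And>u. u \<in> U \<Longrightarrow> b u \<in> Z"
    and C: "\<And>u i. u \<in> U \<Longrightarrow> i < a \<Longrightarrow> int (p ^ i) * wt u \<le> C" and C0: "C \<ge> 0"
  shows "laurent_growth C (wt d) Z (splitting_poly p a h N b U d)"
proof -
  have "laurent_growth C (wt d) Z (Poly_Mapping.single (- d) (of_nat N))"
    by (intro laurent_growth_single[OF Z] subring_of_nat[OF is_subring_fps_over[OF Z]])
       (simp add: T_ord_ge_nonpos C0)
  moreover have "laurent_growth C 0 Z (\<Prod>u\<in>U. \<Prod>i<a. splitting_factor p h (b u) u i)"
    by (intro laurent_growth_prod[OF Z] splitting_factor_growth[OF p Z pZ] b C) auto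
  ultimately show ?thesis
    unfolding splitting_poly_def using laurent_growth_mult[OF Z, of C "wt d" _ 0] by simp
qed

text \<open>
  Since \<open>b\<^sub>u ^ q = b\<^sub>u\<close>, the value of \<open>b\<^sub>u X ^ u\<close> at \<open>x ^ q ^ l\<close> is the power with exponent \<open>q ^ l\<close> of its value at
  \<open>x\<close>. The exponents \<open>p ^ i q ^ l = p ^ (a l + i)\<close> with \<open>i < a\<close> and \<open>l < k\<close> are all \<open>p ^ j\<close> with \<open>j < a k\<close>.
\<close>

lemma splitting_poly_orbit:
  fixes x :: "'a::field_char_0 ^ 'n::finite"
  assumes x: "in_torus x" and q: "q = p ^ a" and b: "\<And>u. u \<in> U \<Longrightarrow> b u ^ q = b u"
  shows "T_cong h (\<Prod>l<k. laurent_at (splitting_poly p a h N b U d) (\<chi> i. x $ i ^ (q ^ l)))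
    (of_nat N ^ k * (fps_const (\<Prod>l<k. monom_at (\<chi> i. x $ i ^ (q ^ l)) (- d)) *
      (\<Prod>u\<in>U. \<Prod>j<a * k. artin_hasse p oo (fps_const ((b u * monom_at x u) ^ (p ^ j)) * ah_param p))))"
proof -
  let ?x = "\<lambda>l. (\<chi> i. x $ i ^ (q ^ l)) :: 'a ^ 'n"
  let ?E = "\<lambda>u j. artin_hasse p oo (fps_const ((b u * monom_at x u) ^ (p ^ j)) * ah_param p)"
  have torus: "in_torus (?x l)" for l using x by (simp add: in_torus_def)
  have at: "laurent_at (splitting_poly p a h N b U d) (?x l) =
      of_nat N * fps_const (monom_at (?x l) (- d)) * (\<Prod>u\<in>U. \<Prod>i<a. laurent_at (splitting_factor p h (b u) u i) (?x l))" for l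
    by (simp add: splitting_poly_def laurent_at_mult[OF torus] laurent_at_prod[OF torus] laurent_at_single)
  have bq: "b u ^ (q ^ l) = b u" if "u \<in> U" for u l
    by (induction l) (simp_all add: b[OF that] power_mult)
  have fac: "T_cong h (laurent_at (splitting_factor p h (b u) u i) (?x l)) (?E u (a * l + i))" if "u \<in> U" for u i l
  proof -
    have "b u * monom_at (?x l) u = (b u * monom_at x u) ^ (q ^ l)"
      using bq[OF that, of l] by (simp add: monom_at_frob power_mult_distrib)
    then have "(b u * monom_at (?x l) u) ^ (p ^ i) = (b u * monom_at x u) ^ (p ^ (a * l + i))"
      by (simp add: q power_add power_mult)
    then show ?thesis using laurent_at_splitting_factor[of h p "b u" u i "?x l"] by simp
  qed
  have "T_cong h (\<Prod>l<k. laurent_at (splitting_poly p a h N b U d) (?x l))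
      (\<Prod>l<k. of_nat N * fps_const (monom_at (?x l) (- d)) * (\<Prod>u\<in>U. \<Prod>i<a. ?E u (a * l + i)))"
    unfolding at by (intro T_cong_prod T_cong_mult T_cong_refl fac)
  also have "(\<Prod>l<k. of_nat N * fps_const (monom_at (?x l) (- d)) * (\<Prod>u\<in>U. \<Prod>i<a. ?E u (a * l + i))) =
      of_nat N ^ k * ((\<Prod>l<k. fps_const (monom_at (?x l) (- d))) * (\<Prod>l<k. \<Prod>u\<in>U. \<Prod>i<a. ?E u (a * l + i)))"
    by (simp add: prod.distrib mult.assoc)
  also have "(\<Prod>l<k. fps_const (monom_at (?x l) (- d))) = fps_const (\<Prod>l<k. monom_at (?x l) (- d))"
    by (induction k) (simp_all flip: fps_const_mult)
  also have "(\<Prod>l<k. \<Prod>u\<in>U. \<Prod>i<a. ?E u (a * l + i)) = (\<Prod>u\<in>U. \<Prod>j<a * k. ?E u j)"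
    by (rule trans[OF prod.swap]) (intro prod.cong refl prod_lessThan_blocks)
  finally show ?thesis .
qed


section \<open>Sums over roots of unity\<close>

lemma to_fract_power: "to_fract (x ^ n) = to_fract x ^ n"
  by (induction n) simp_all

lemma to_fract_prod: "to_fract (prod g A) = (\<Prod>i\<in>A. to_fract (g i))"
  by (induction A rule: infinite_finite_induct) simp_all

lemma to_fract_sum: "to_fract (sum g A) = (\<Sum>i\<in>A. to_fract (g i))"
  by (induction A rule: infinite_finite_induct) simp_all

definition fract_vec :: "'a::idom ^ 'n \<Rightarrow> 'a fract ^ 'n" where
  "fract_vec x = (\<chi> i. to_fract (x $ i))"

lemma inj_fract_vec: "inj_on fract_vec A"
  by (auto intro!: inj_onI simp: fract_vec_def Finite_Cartesian_Product.vec_eq_iff)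

context
  fixes Q m :: nat
  assumes m: "m > 0" and Q: "Q = CHAR('k::{alg_closed_field, field_prime_char}) ^ m"
begin

definition mu_vecs :: "('k witt ^ 'n::finite) set" where
  "mu_vecs = {x. \<forall>i. x $ i \<in> mu Q}"

lemma fract_vec_torus: "x \<in> mu_vecs \<Longrightarrow> in_torus (fract_vec x)"
  using mu_nonzero[OF m Q] by (auto simp: mu_vecs_def in_torus_def fract_vec_def)

lemma finite_mu_vecs: "finite (mu_vecs :: ('k witt ^ 'n::finite) set)"
  unfolding mu_vecs_def by (rule finite_vecs[OF finite_mu[OF m Q]])

lemma card_mu_vecs: "card (mu_vecs :: ('k witt ^ 'n::finite) set) = (Q - 1) ^ CARD('n)"
  unfolding mu_vecs_def by (simp add: card_vecs[OF finite_mu[OF m Q]] card_mu[OF m Q])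

lemma monom_at_mu:
  "x \<in> mu_vecs \<Longrightarrow> monom_at (fract_vec x) u = to_fract (\<Prod>i\<in>UNIV. (x $ i) powi (u $ i))"
  by (simp add: monom_at_def fract_vec_def to_fract_prod mu_vecs_def to_fract_powi[OF m Q])

text \<open>
  If an exponent \<open>v\<^sub>i\<close> is not divisible by \<open>Q - 1\<close>, some root of unity \<open>g\<close> has \<open>g ^ v\<^sub>i \<noteq> 1\<close>. Multiplying the
  coordinate \<open>i\<close> by \<open>g\<close> permutes the points and multiplies the sum by \<open>g ^ v\<^sub>i\<close>, so the sum is 0.
\<close>

lemma sum_monom_at_mu_vecs:
  fixes v :: "int ^ 'n::finite"
  shows "(\<Sum>x\<in>(mu_vecs :: ('k witt ^ 'n) set). monom_at (fract_vec x) v) =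
     (if \<forall>i. int (Q - 1) dvd v $ i then of_nat (card (mu_vecs :: ('k witt ^ 'n) set)) else 0)"
proof (cases "\<forall>i. int (Q - 1) dvd v $ i")
  case True
  have "monom_at (fract_vec x) v = 1" if "x \<in> mu_vecs" for x :: "'k witt ^ 'n"
    using that True by (simp add: monom_at_def fract_vec_def mu_vecs_def powi_mu_mod[OF m Q])
  then show ?thesis using True by simp
next
  case False
  then obtain i0 where "\<not> int (Q - 1) dvd v $ i0" by blast
  then obtain g :: "'k witt" where g: "g \<in> mu Q" "to_fract g powi (v $ i0) \<noteq> 1"
    using exists_mu_powi_neq_1[OF m Q] by blast
  define t :: "'k witt ^ 'n \<Rightarrow> 'k witt ^ 'n" where "t x = (\<chi> i. if i = i0 then g * x $ i else x $ i)" for x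
  have "t ` mu_vecs \<subseteq> mu_vecs" using mu_mult[OF m Q g(1)] by (auto simp: t_def mu_vecs_def)
  moreover have inj: "inj_on t mu_vecs"
  proof (rule inj_onI)
    fix x y assume "t x = t y"
    then have "\<forall>i. (if i = i0 then g * x $ i else x $ i) = (if i = i0 then g * y $ i else y $ i)"
      by (simp add: t_def Finite_Cartesian_Product.vec_eq_iff)
    then have "x $ i = y $ i" for i
      using mu_nonzero[OF m Q g(1)] by (cases "i = i0") (metis mult_left_cancel, metis)
    then show "x = y" by (simp add: Finite_Cartesian_Product.vec_eq_iff)
  qed
  ultimately have im: "t ` mu_vecs = mu_vecs" using endo_inj_surj[OF finite_mu_vecs] by blast
  have shift: "monom_at (fract_vec (t x)) v = to_fract g powi (v $ i0) * monom_at (fract_vec x) v" for x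
  proof -
    have "monom_at (fract_vec (t x)) v =
        (\<Prod>i\<in>UNIV. (if i = i0 then to_fract g powi (v $ i) else 1) * to_fract (x $ i) powi (v $ i))"
      unfolding monom_at_def fract_vec_def t_def by (intro prod.cong) (auto simp: power_int_mult_distrib)
    then show ?thesis by (simp add: prod.distrib monom_at_def fract_vec_def)
  qed
  have "(\<Sum>x\<in>(mu_vecs :: ('k witt ^ 'n) set). monom_at (fract_vec x) v) = (\<Sum>x\<in>mu_vecs. monom_at (fract_vec (t x)) v)"
    using sum.reindex[OF inj, of "\<lambda>x. monom_at (fract_vec x) v"] im by simp
  also have "\<dots> = to_fract g powi (v $ i0) * (\<Sum>x\<in>mu_vecs. monom_at (fract_vec x) v)"
    by (simp add: shift sum_distrib_left)
  finally have "(\<Sum>x\<in>(mu_vecs :: ('k witt ^ 'n) set). monom_at (fract_vec x) v) = 0" using g(2) by (metis mult_cancel_right1)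
  then show ?thesis using False by (simp only: if_False)
qed

lemma orthogonal_mu_vecs: "orthogonal_on (fract_vec ` (mu_vecs :: ('k witt ^ 'n::finite) set)) (Q - 1)"
  unfolding orthogonal_on_def
  by (auto simp: fract_vec_torus sum.reindex[OF inj_fract_vec] card_image[OF inj_fract_vec] sum_monom_at_mu_vecs o_def)

text \<open>
  On roots of unity the Witt vector Frobenius is \<open>y \<mapsto> y ^ p\<close>, so the trace of each \<open>y u\<close> is a sum of powers
  \<open>(y u) ^ p ^ j\<close>, and \<open>prod_artin_hasse\<close> applies to it.
\<close>

lemma psi_trace:
  assumes I: "finite I" and y: "\<And>u. u \<in> I \<Longrightarrow> y u \<in> mu Q"
  shows "psi (trace_Zp Q (\<Sum>u\<in>I. y u :: 'k witt)) =
    (\<Prod>u\<in>I. \<Prod>j<m. artin_hasse CHAR('k) oo (fps_const (to_fract (y u) ^ (CHAR('k) ^ j)) * ah_param CHAR('k)))"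
proof -
  let ?p = "CHAR('k)"
  have p: "?p > 1" "?p > 0" using prime_gt_1_nat[OF CHAR_prime[where 'a = 'k]] by auto
  have "(THE m'. Q = ?p ^ m') = m"
    using p by (intro the_equality) (auto simp: Q power_inject_exp)
  moreover have frob: "(witt_frob ^^ j) (\<Sum>u\<in>I. y u) = (\<Sum>u\<in>I. y u ^ (?p ^ j))" for j
    using I y
  proof (induction I)
    case (insert u I)
    then show ?case using witt_frob_iter_mu[OF m Q, of "y u"] by (simp add: witt_frob_iter)
  qed (simp add: witt_frob_iter)
  ultimately have "to_fract (trace_Zp Q (\<Sum>u\<in>I. y u)) = (\<Sum>u\<in>I. \<Sum>j<m. to_fract (y u) ^ (?p ^ j))"
    unfolding trace_Zp_def by (simp add: to_fract_sum to_fract_power sum.swap[of _ I])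
  moreover have "fps_binomial (\<Sum>u\<in>I. c u) = (\<Prod>u\<in>I. fps_binomial (c u))" for c :: "_ \<Rightarrow> 'k witt fract"
    using I by (induction I) (simp_all add: fps_binomial_add_mult)
  moreover have "fps_binomial (\<Sum>j<m. to_fract (y u) ^ (?p ^ j)) =
      (\<Prod>j<m. artin_hasse ?p oo (fps_const (to_fract (y u) ^ (?p ^ j)) * ah_param ?p))" if "u \<in> I" for u
  proof (rule prod_artin_hasse[symmetric, OF p(2)])
    show "to_fract (y u) ^ (?p ^ m) = to_fract (y u)"
      using arg_cong[OF mu_power_Q[OF m Q y[OF that]], of to_fract] by (simp add: to_fract_power Q)
  qed
  ultimately show ?thesis unfolding psi_def by (simp cong: prod.cong)
qed

end

lemma powi_prod: "(\<Prod>j\<in>A. g j :: 'a::field) powi n = (\<Prod>j\<in>A. g j powi n)"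
  by (induction A rule: infinite_finite_induct) (simp_all add: power_int_mult_distrib)

text \<open>
  Both the Teichmueller lift and the norm are multiplicative, and the norm of \<open>x\<close> is the product of the \<open>x ^ q ^ l\<close>.
\<close>

lemma chi_eq_monom_at:
  fixes x :: "'k::{alg_closed_field, field_prime_char} witt ^ 'n::finite"
  assumes a: "a > 0" and q: "q = CHAR('k) ^ a" and k: "k > 0"
    and x: "\<And>i. x $ i \<in> mu (q ^ k)"
  shows "to_fract (chi q k d x) = (\<Prod>l<k. monom_at (\<chi> i. fract_vec x $ i ^ (q ^ l)) (- d))"
proof -
  have ak: "a * k > 0" "q ^ k = CHAR('k) ^ (a * k)" using a k by (simp_all add: q power_mult)
  let ?N = "\<lambda>i. \<Prod>l<k. x $ i ^ (q ^ l)"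
  have N: "teich (norm_Fq q k (witt_nth (x $ i) 0)) = ?N i" for i
  proof -
    obtain t where "x $ i = teich t" using x[of i] mu_eq_teich[OF ak] by auto
    then show ?thesis by (simp add: norm_Fq_def teich_prod teich_power teich_nth)
  qed
  have "?N i \<in> mu (q ^ k)" for i by (intro mu_prod[OF ak] mu_power[OF ak] x)
  then have "to_fract (chi q k d x) = (\<Prod>i\<in>UNIV. to_fract (?N i) powi (- (d $ i)))"
    by (simp add: chi_def omega_char_def N to_fract_prod to_fract_powi[OF ak] del: to_fract_prod)
       (simp add: to_fract_prod to_fract_powi[OF ak])
  also have "\<dots> = (\<Prod>i\<in>UNIV. \<Prod>l<k. (to_fract (x $ i) ^ (q ^ l)) powi (- (d $ i)))"
    by (simp add: to_fract_prod to_fract_power powi_prod)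
  also have "\<dots> = (\<Prod>l<k. \<Prod>i\<in>UNIV. (to_fract (x $ i) ^ (q ^ l)) powi (- (d $ i)))"
    by (rule prod.swap)
  finally show ?thesis by (simp add: monom_at_def fract_vec_def)
qed

lemma mu_subset_mu_power:
  assumes a: "a > 0" and q: "q = CHAR('k) ^ a" and k: "k > 0"
  shows "mu q \<subseteq> (mu (q ^ k) :: 'k::{alg_closed_field, field_prime_char} witt set)"
proof
  fix z :: "'k witt" assume z: "z \<in> mu q"
  have ak: "a * k > 0" "q ^ k = CHAR('k) ^ (a * k)" using a k by (simp_all add: q power_mult)
  obtain t where t: "t ^ (q - 1) = 1" "z = teich t" using z mu_eq_teich[OF a q] by auto
  have t0: "t \<noteq> 0" using t(1) Q_gt_1[OF a q] by (auto simp: power_0_left)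
  have "t ^ q = t" using t(1) Q_gt_1[OF a q] power_Suc[of t "q - 1"] by simp
  then have "t ^ (q ^ k) = t" by (induction k) (simp_all add: power_mult)
  moreover have "Suc (q ^ k - 1) = q ^ k" using Q_gt_1[OF ak] by simp
  ultimately have "t * t ^ (q ^ k - 1) = t * 1" by (metis mult_1_right power_Suc)
  then have "t ^ (q ^ k - 1) = 1" using t0 by simp
  then show "z \<in> mu (q ^ k)" unfolding mu_eq_teich[OF ak] using t by blast
qed


section \<open>Meromorphy of the L-series\<close>

lemma S_sum_splitting:
  fixes f :: "('n::finite, 'k::{alg_closed_field, field_prime_char} witt) laurent_poly"
  assumes a: "a > 0" and q: "q = CHAR('k) ^ a" and k: "k > 0"
    and f: "\<forall>u\<in>Poly_Mapping.keys f. Poly_Mapping.lookup f u \<in> mu q"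
  shows "T_cong h
    (\<Sum>x\<in>fract_vec ` mu_vecs (q ^ k). \<Prod>l<k. laurent_at
       (splitting_poly CHAR('k) a h N (\<lambda>u. to_fract (Poly_Mapping.lookup f u)) (Poly_Mapping.keys f) d) (\<chi> i. x $ i ^ (q ^ l)))
    (of_nat N ^ k * S_sum q k f d)"
proof -
  let ?p = "CHAR('k)" and ?U = "Poly_Mapping.keys f" and ?b = "\<lambda>u. to_fract (Poly_Mapping.lookup f u)"
  have ak: "a * k > 0" "q ^ k = ?p ^ (a * k)" using a k by (simp_all add: q power_mult)
  let ?G = "splitting_poly ?p a h N ?b ?U d"
  let ?V = "mu_vecs (q ^ k) :: ('k witt ^ 'n) set"
  have summand: "T_cong h (\<Prod>l<k. laurent_at ?G (\<chi> i. fract_vec x $ i ^ (q ^ l)))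
      (of_nat N ^ k * (fps_const (to_fract (chi q k d x)) * psi (trace_Zp (q ^ k) (laurent_eval f x))))"
    if x: "x \<in> ?V" for x :: "'k witt ^ 'n"
  proof -
    let ?y = "\<lambda>u. Poly_Mapping.lookup f u * (\<Prod>i\<in>UNIV. (x $ i) powi (u $ i))"
    have xi: "x $ i \<in> mu (q ^ k)" for i using x by (simp add: mu_vecs_def[OF ak])
    have y: "?y u \<in> mu (q ^ k)" if "u \<in> ?U" for u
      using f that mu_subset_mu_power[OF a q k] by (intro mu_mult[OF ak] mu_prod[OF ak] mu_powi[OF ak] xi) auto
    have fy: "to_fract (?y u) = ?b u * monom_at (fract_vec x) u" for u
      by (simp add: monom_at_mu[OF ak x])
    have bq: "?b u ^ q = ?b u" if "u \<in> ?U" for u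
      using arg_cong[OF mu_power_Q[OF a q], of "Poly_Mapping.lookup f u" to_fract] f that by (simp add: to_fract_power)
    have "psi (trace_Zp (q ^ k) (laurent_eval f x)) =
        (\<Prod>u\<in>?U. \<Prod>j<a * k. artin_hasse ?p oo (fps_const ((?b u * monom_at (fract_vec x) u) ^ (?p ^ j)) * ah_param ?p))"
    proof -
      have "psi (trace_Zp (q ^ k) (\<Sum>u\<in>?U. ?y u)) =
          (\<Prod>u\<in>?U. \<Prod>j<a * k. artin_hasse ?p oo (fps_const (to_fract (?y u) ^ (?p ^ j)) * ah_param ?p))"
        by (rule psi_trace[OF ak finite_keys y])
      then show ?thesis unfolding laurent_eval_def fy .
    qed
    then show ?thesis
      using splitting_poly_orbit[where U = ?U and b = ?b and x = "fract_vec x" and h = h and k = k and N = N and d = d,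
        OF fract_vec_torus[OF ak x] q bq]
      by (simp add: chi_eq_monom_at[OF a q k xi])
  qed
  have "(\<Sum>x\<in>fract_vec ` ?V. \<Prod>l<k. laurent_at ?G (\<chi> i. x $ i ^ (q ^ l))) =
      (\<Sum>x\<in>?V. \<Prod>l<k. laurent_at ?G (\<chi> i. fract_vec x $ i ^ (q ^ l)))"
    by (subst sum.reindex[OF inj_fract_vec]) simp
  moreover have "T_cong h \<dots> (\<Sum>x\<in>?V. of_nat N ^ k * (fps_const (to_fract (chi q k d x)) * psi (trace_Zp (q ^ k) (laurent_eval f x))))"
    by (rule T_cong_sum) (rule summand)
  ultimately show ?thesis
    by (simp add: S_sum_def sum_distrib_left mu_vecs_def[OF ak])
qed

text \<open>
  The trace of the \<open>k\<close>-th power of the infinite matrix \<open>M\<close>.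
\<close>

definition normalized_sum ::
  "nat \<Rightarrow> ('n::finite, 'k::field_prime_char witt) laurent_poly \<Rightarrow> int ^ 'n \<Rightarrow> nat \<Rightarrow> 'k witt fract fps" where
  "normalized_sum q f d k = fps_const (1 / of_nat ((q ^ k - 1) ^ CARD('n))) * S_sum q k f d"

text \<open>
  The series \<open>A(N s)\<close>. The constant \<open>C\<close> bounds the weights of the exponents of the Artin--Hasse factors; it
  depends neither on \<open>N\<close> nor on the truncation.
\<close>

theorem fredholm_series_entire:
  fixes f :: "('n::finite, 'k::{alg_closed_field, field_prime_char} witt) laurent_poly"
  assumes a: "a > 0" and q: "q = CHAR('k) ^ a"
    and f: "\<forall>u\<in>Poly_Mapping.keys f. Poly_Mapping.lookup f u \<in> mu q"
  shows "\<exists>C>0. \<forall>N. T_entire_over C (to_fract ` Zq q)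
    (exp_series (log_det (\<lambda>k. of_nat N ^ k * normalized_sum q f d k)))"
proof -
  let ?p = "CHAR('k)" and ?U = "Poly_Mapping.keys f" and ?Z = "to_fract ` (Zq q :: 'k witt set)"
  let ?b = "\<lambda>u. to_fract (Poly_Mapping.lookup f u)"
  have p: "prime ?p" by simp
  have q1: "q > 1" by (rule Q_gt_1[OF a q])
  have Z: "is_subring ?Z" unfolding q by (intro is_subring_to_fract is_subring_Zq)
  have pZ: "p_integral ?p \<subseteq> ?Z" unfolding q by (rule p_integral_subset_Zq)
  define C where "C = 1 + (\<Sum>u\<in>?U. int q * wt u)"
  have C0: "C > 0" unfolding C_def by (intro add_pos_nonneg sum_nonneg) auto
  have C: "int (?p ^ i) * wt u \<le> C" if "u \<in> ?U" "i < a" for u i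
  proof -
    have "?p ^ i \<le> q" unfolding q using that by (intro power_increasing prime_ge_1_nat p) simp
    then have "int (?p ^ i) * wt u \<le> int q * wt u" by (intro mult_right_mono) auto
    also have "\<dots> \<le> (\<Sum>u\<in>?U. int q * wt u)" using that by (intro member_le_sum) auto
    finally show ?thesis by (simp add: C_def)
  qed
  have "T_entire_over C ?Z (exp_series (log_det (\<lambda>k. of_nat N ^ k * normalized_sum q f d k)))" for N
  proof (rule entire_of_truncations)
    fix h
    let ?G = "splitting_poly ?p a h N ?b ?U d"
    have growth: "laurent_growth C (wt d) ?Z ?G"
      by (rule splitting_poly_growth[OF p Z pZ _ C]) (use C0 f in \<open>auto simp: mu_def\<close>)
    obtain \<tau> E where E: "E \<in> fps_over (fps_over ?Z)"
      "\<And>R. R \<ge> 0 \<Longrightarrow> slope_ge C (R - wt d) (- (R * int (card {u :: int ^ 'n. wt u < R}))) E"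
      "E = exp_series (Abs_fps (\<lambda>k. if k = 0 then 0 else - (fps_const (1 / of_nat k) * \<tau> k)))"
      and tr: "\<And>k X. k > 0 \<Longrightarrow> orthogonal_on X (q ^ k - 1) \<Longrightarrow>
         (\<Sum>x\<in>X. \<Prod>l<k. laurent_at ?G (\<chi> i. x $ i ^ (q ^ l))) = of_nat (card X) * \<tau> k"
      by (rule trace_formula[of q ?Z C ?G "wt d"]) (use q1 Z C0 growth in \<open>auto simp: laurent_growth_def\<close>)
    have "T_cong h (\<tau> k) (of_nat N ^ k * normalized_sum q f d k)" if k: "k > 0" for k
    proof -
      have ak: "a * k > 0" "q ^ k = ?p ^ (a * k)" using a k by (simp_all add: q power_mult)
      let ?M = "(q ^ k - 1) ^ CARD('n)"
      have M0: "of_nat ?M \<noteq> (0 :: 'k witt fract)" using Q_gt_1[OF ak] by (simp del: of_nat_power)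
      let ?X = "fract_vec ` (mu_vecs (q ^ k) :: ('k witt ^ 'n) set)"
      have "card ?X = ?M"
        unfolding card_image[OF inj_fract_vec] by (rule card_mu_vecs[OF ak])
      then have "T_cong h (of_nat ?M * \<tau> k) (of_nat N ^ k * S_sum q k f d)"
        using S_sum_splitting[OF a q k f, of h N d] tr[OF k orthogonal_mu_vecs[OF ak]] by simp
      then have "T_cong h (fps_const (1 / of_nat ?M) * (of_nat ?M * \<tau> k)) (fps_const (1 / of_nat ?M) * (of_nat N ^ k * S_sum q k f d))"
        by (rule T_cong_mult[OF T_cong_refl])
      moreover have "fps_const (1 / of_nat ?M) * (of_nat ?M * \<tau> k) = \<tau> k"
        using M0 by (simp add: mult.assoc[symmetric] del: of_nat_power flip: fps_of_nat)
      ultimately have "T_cong h (\<tau> k) (fps_const (1 / of_nat ?M) * (of_nat N ^ k * S_sum q k f d))" by (simp only:)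
      then show ?thesis by (simp only: normalized_sum_def mult.left_commute)
    qed
    then show "\<exists>E \<tau>. E \<in> fps_over (fps_over ?Z) \<and>
        (\<forall>R\<ge>0. slope_ge C (R - wt d) (- (R * int (card {u :: int ^ 'n. wt u < R}))) E) \<and>
        E = exp_series (log_det \<tau>) \<and> (\<forall>k>0. T_cong h (\<tau> k) (of_nat N ^ k * normalized_sum q f d k))"
      using E unfolding log_det_def by blast
  qed
  then show ?thesis using C0 by blast
qed

text \<open>
  The binomial expansion of \<open>(x - 1) ^ n\<close>, with the negative terms moved to the other side. For \<open>x = q ^ k\<close>
  it relates the sums \<open>S\<^sub>k\<close> to the traces that define the series \<open>A(q ^ i s)\<close>.
\<close>

lemma power_minus_1_split:
  fixes x :: "'a::comm_ring_1"
  shows "(x - 1) ^ n + (\<Sum>i | i \<le> n \<and> odd (n - i). of_nat (n choose i) * x ^ i) =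
    (\<Sum>i | i \<le> n \<and> even (n - i). of_nat (n choose i) * x ^ i)"
proof -
  let ?t = "\<lambda>i. of_nat (n choose i) * x ^ i"
  have "(x - 1) ^ n = (\<Sum>i\<le>n. ?t i * (- 1) ^ (n - i))"
    using binomial_ring[of x "- 1" n] by simp
  also have "\<dots> = (\<Sum>i\<le>n. if even (n - i) then ?t i else - ?t i)"
    by (intro sum.cong) auto
  also have "\<dots> = (\<Sum>i | i \<le> n \<and> even (n - i). ?t i) + (\<Sum>i | i \<le> n \<and> odd (n - i). - ?t i)"
  proof (subst sum.If_cases)
    have "{..n} \<inter> {i. even (n - i)} = {i. i \<le> n \<and> even (n - i)}"
      "{..n} \<inter> - {i. even (n - i)} = {i. i \<le> n \<and> odd (n - i)}" by auto
    then show "sum ?t ({..n} \<inter> {i. even (n - i)}) + (\<Sum>i\<in>{..n} \<inter> - {i. even (n - i)}. - ?t i) =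
      (\<Sum>i | i \<le> n \<and> even (n - i). ?t i) + (\<Sum>i | i \<le> n \<and> odd (n - i). - ?t i)" by simp
  qed simp
  finally show ?thesis by (simp add: sum_negf)
qed

theorem theorem1p8:
  fixes a q :: nat
    and f :: "('n::finite, 'k::{alg_closed_field, field_prime_char} witt) laurent_poly"
    and d :: "int ^ 'n"
  assumes "a > 0" and "q = CHAR('k) ^ a"
    and "\<forall>u\<in>Poly_Mapping.keys f. Poly_Mapping.lookup f u \<in> mu q"
    and "\<nexists>c. f = Poly_Mapping.single 0 c"
  shows "T_adic_meromorphic q (L_series q f d)"
proof -
  let ?n = "CARD('n)" and ?P = "normalized_sum q f d" and ?Z = "to_fract ` (Zq q :: 'k witt set)"
  define g where "g i = log_det (\<lambda>k. of_nat (q ^ i) ^ k * ?P k)" for i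
  define Ev where "Ev = {i. i \<le> ?n \<and> even (?n - i)}"
  define Od where "Od = {i. i \<le> ?n \<and> odd (?n - i)}"
  define GL where "GL = Abs_fps (\<lambda>k. if k = 0 then 0 else fps_const (1 / of_nat k) * S_sum q k f d)"
  have L: "L_series q f d = exp_series GL" by (simp add: L_series_def GL_def)
  have g0: "fps_nth (g i) 0 = 0" for i by (simp add: g_def)
  have cg0: "fps_nth (of_nat c * g i) 0 = 0" for c i by (simp add: fps_mult_nth g0)
  have GL: "GL + (\<Sum>i\<in>Ev. of_nat (?n choose i) * g i) = (\<Sum>i\<in>Od. of_nat (?n choose i) * g i)"
  proof (rule fps_ext)
    fix k
    show "fps_nth (GL + (\<Sum>i\<in>Ev. of_nat (?n choose i) * g i)) k = fps_nth (\<Sum>i\<in>Od. of_nat (?n choose i) * g i) k"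
    proof (cases "k = 0")
      case True
      then show ?thesis using g0 by (simp add: GL_def fps_sum_nth fps_mult_nth)
    next
      case False
      then have k: "k > 0" by simp
      have ak: "a * k > 0" "q ^ k = CHAR('k) ^ (a * k)" using assms(1,2) k by (simp_all add: power_mult)
      let ?M = "(q ^ k - 1) ^ ?n" and ?x = "of_nat (q ^ k) :: 'k witt fract fps"
      have M0: "of_nat ?M \<noteq> (0 :: 'k witt fract)" using Q_gt_1[OF ak] by (simp del: of_nat_power)
      have S: "S_sum q k f d = (?x - 1) ^ ?n * ?P k"
      proof -
        have "of_nat ?M * ?P k = S_sum q k f d"
          using M0 by (simp add: normalized_sum_def mult.assoc[symmetric] del: of_nat_power flip: fps_of_nat)
        moreover have "(of_nat ?M :: 'k witt fract fps) = (?x - 1) ^ ?n"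
          using Q_gt_1[OF ak] by (simp only: of_nat_power of_nat_diff[of 1 "q ^ k"] of_nat_1 less_imp_le)
        ultimately show ?thesis by simp
      qed
      have c: "fps_nth (of_nat c * A) k = of_nat c * fps_nth A k" for c and A :: "'k witt fract fps fps"
        by (simp flip: fps_of_nat)
      have gk: "of_nat (?n choose i) * fps_nth (g i) k = - (fps_const (1 / of_nat k) * ?P k * (of_nat (?n choose i) * ?x ^ i))" for i
        using k by (simp add: g_def log_det_def mult_ac flip: power_mult)
      have "fps_const (1 / of_nat k) * ?P k * (?x - 1) ^ ?n =
          fps_const (1 / of_nat k) * ?P k * (\<Sum>i\<in>Ev. of_nat (?n choose i) * ?x ^ i)
          - fps_const (1 / of_nat k) * ?P k * (\<Sum>i\<in>Od. of_nat (?n choose i) * ?x ^ i)"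
        unfolding Ev_def Od_def power_minus_1_split[of ?x ?n, symmetric] by (simp add: distrib_left)
      moreover have "fps_nth GL k = fps_const (1 / of_nat k) * ?P k * (?x - 1) ^ ?n"
        using k by (simp add: GL_def S mult_ac)
      moreover have "fps_nth (\<Sum>i\<in>I. of_nat (?n choose i) * g i) k =
          - (fps_const (1 / of_nat k) * ?P k * (\<Sum>i\<in>I. of_nat (?n choose i) * ?x ^ i))" for I
        by (simp only: fps_sum_nth c gk sum_negf sum_distrib_left)
      moreover have "e - o' + - e = - o'" for e o' :: "'k witt fract fps" by simp
      ultimately show ?thesis by (simp only: fps_add_nth)
    qed
  qed
  define A where "A i = exp_series (g i) ^ (?n choose i)" for i
  have "L_series q f d * prod A Ev = exp_series (GL + (\<Sum>i\<in>Ev. of_nat (?n choose i) * g i))"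
    unfolding L A_def
    by (subst exp_series_add) (simp_all add: GL_def exp_series_sum cg0 exp_series_of_nat_mult g0 fps_sum_nth)
  also have "\<dots> = prod A Od"
    unfolding GL A_def by (simp add: exp_series_sum cg0 exp_series_of_nat_mult g0)
  finally have eq: "L_series q f d * prod A Ev = prod A Od" .
  have Z: "is_subring ?Z" unfolding assms(2) by (intro is_subring_to_fract is_subring_Zq)
  obtain C where C: "C > 0" "\<And>N. T_entire_over C ?Z (exp_series (log_det (\<lambda>k. of_nat N ^ k * ?P k)))"
    using fredholm_series_entire[OF assms(1-3)] by blast
  have good: "T_entire_over C ?Z (prod A I)" for I
    unfolding A_def g_def by (intro T_entire_over_prod[OF Z] T_entire_over_power[OF Z] C(2))
  have mem: "prod A I \<in> one_plus_s_Zq q" for I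
    using good[of I] by (auto simp: T_entire_over_def one_plus_s_Zq_def dest!: fps_overD)
  show ?thesis
    unfolding T_adic_meromorphic_def using eq mem T_entire_over_imp_T_adic_entire[OF C(1) good] by blast
qed

end
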